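(* Let $a(y,t)$ be a sufficiently smooth function on $\{(y,t):t\ge0,\ y\in\overline{\Omega(t)}\}$ and let $T$ be the solution of $$\frac{\partial T}{\partial t}(y,t)-\Delta T(y,t)+a(y,t)T(y,t)=0,\quad y\in\Omega(t);\qquad T(y,t)=0,\quad y\in\partial\Omega(t),\ \forall t;\qquad T(y,0)=T_0(y),\quad y\in\Omega_0.$$ Assume that $T_0\in L^2(\Omega_0)$, $T_0(x)\ge0$ for $x\in\Omega_0$, and that $$\alpha(t)\le a(y,t)\qquad\text{for all } y\in\Omega(t)\text{ and all } t,$$ for some smooth function $\alpha(t)$ such that, for some constant $\alpha_0$, $$\liminf_{t\to\infty}\frac1t\int_0^t\alpha(s)\,ds>\alpha_0>0.$$ Then $$\int_{\Omega(t)}T(y,t)\,dy\le e^{-\int_0^t\alpha(s)\,ds}\int_{\Omega_0}T_0(x)\,dx\longrightarrow0\qquad\text{as } t\to\infty.$$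
   Context: $\Omega_0\subset\mathbb{R}^n$ is a bounded smooth open set (domain). $\vec{V}:\mathbb{R}^n\to\mathbb{R}^n$ is a smooth vector field such that all solutions of the autonomous ODE $\dot Y=\vec{V}(Y)$ are defined for all $t\in\mathbb{R}$. For $t\in\mathbb{R}$, $\phi(t):\mathbb{R}^n\to\mathbb{R}^n$ is the flow map: $\phi(t)x=Y(t;x)$, where $Y(\cdot;x)$ is the solution with $Y(0;x)=x$. The moving domain is $\Omega(t)=\phi(t)\Omega_0$, with $\partial\Omega(t)=\phi(t)\partial\Omega_0$. Notion of solution: $T$ is a solution if its pull-back $\overline{T}(x,t)=T(\phi(t)x,t)$ is $C^2$ in $x$ and $C^1$ in $t$ on $\overline{\Omega_0}\times(0,\infty)$ (with these derivatives continuous there), the equation and the boundary condition hold pointwise for $t>0$, and $\overline{T}(\cdot,t)\to T_0$ in $L^2(\Omega_0)$ as $t\to0^+$. Inequalities for the $L^2$ function $T_0$ are understood almost everywhere. *)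

theory Defs
  imports "HOL-Analysis.Analysis"
begin

text \<open>Derivatives are taken within \<open>S\<close>, so the notion is meant for sets on which they are unique:
  open sets, and intervals of the real line such as \<open>{0..}\<close>
  (where the derivative at the endpoint is one-sided).\<close>

primrec Ck_on :: "nat \<Rightarrow> 'a::euclidean_space set \<Rightarrow> ('a \<Rightarrow> 'b::real_normed_vector) \<Rightarrow> bool" where
  "Ck_on 0 S f \<longleftrightarrow> continuous_on S f"
| "Ck_on (Suc k) S f \<longleftrightarrow>
     f differentiable_on S \<and>
     (\<forall>i\<in>Basis. Ck_on k S (\<lambda>x. frechet_derivative f (at x within S) i))"

definition smooth_on :: "'a::euclidean_space set \<Rightarrow> ('a \<Rightarrow> 'b::real_normed_vector) \<Rightarrow> bool" where
  "smooth_on S f \<longleftrightarrow> (\<forall>k. Ck_on k S f)"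

text \<open>An open set is smooth if, near each boundary point, it is one side of the zero set of a smooth
  function without critical points.\<close>

definition smooth_open_set :: "'a::euclidean_space set \<Rightarrow> bool" where
  "smooth_open_set \<Omega> \<longleftrightarrow> open \<Omega> \<and>
     (\<forall>x\<in>frontier \<Omega>. \<exists>U (\<rho> :: 'a \<Rightarrow> real). open U \<and> x \<in> U \<and> smooth_on U \<rho> \<and>
        (\<forall>y\<in>U. frechet_derivative \<rho> (at y) \<noteq> (\<lambda>h. 0)) \<and>
        \<Omega> \<inter> U = {y\<in>U. \<rho> y < 0})"

text \<open>Existence of such a \<open>\<phi>\<close> expresses that the solutions of \<open>Y' = V Y\<close> are global;
  for smooth \<open>V\<close>, \<open>\<phi>\<close> is determined by \<open>V\<close>.\<close>

definition is_flow :: "('a::euclidean_space \<Rightarrow> 'a) \<Rightarrow> (real \<Rightarrow> 'a \<Rightarrow> 'a) \<Rightarrow> bool" where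
  "is_flow V \<phi> \<longleftrightarrow>
     (\<forall>x. \<phi> 0 x = x \<and> (\<forall>t. ((\<lambda>s. \<phi> s x) has_vector_derivative V (\<phi> t x)) (at t)))"

definition laplacian :: "('a::euclidean_space \<Rightarrow> real) \<Rightarrow> 'a \<Rightarrow> real" where
  "laplacian u y = (\<Sum>i\<in>Basis. (deriv ^^ 2) (\<lambda>r. u (y + r *\<^sub>R i)) 0)"

text \<open>\<open>w x t\<close> is \<open>C\<^sup>2\<close> in \<open>x\<close> and \<open>C\<^sup>1\<close> in \<open>t\<close> on \<open>K \<times> (0,\<infinity>)\<close>, with derivatives jointly continuous
  there. It is applied to the closure \<open>K\<close> of a smooth open set, where derivatives within \<open>K\<close> are unique;
  \<open>G\<close>, \<open>H\<close> and \<open>D\<close> are the spatial gradient, the spatial Hessian and the time derivative.\<close>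

definition C21_on :: "(real^'n) set \<Rightarrow> (real^'n \<Rightarrow> real \<Rightarrow> real) \<Rightarrow> bool" where
  "C21_on K w \<longleftrightarrow>
     (\<exists>(G :: real^'n \<Rightarrow> real \<Rightarrow> real^'n) (H :: real^'n \<Rightarrow> real \<Rightarrow> real^'n^'n) (D :: real^'n \<Rightarrow> real \<Rightarrow> real).
        (\<forall>x\<in>K. \<forall>t>0.
           ((\<lambda>z. w z t) has_derivative (\<lambda>h. G x t \<bullet> h)) (at x within K) \<and>
           ((\<lambda>z. G z t) has_derivative (\<lambda>h. H x t *v h)) (at x within K) \<and>
           ((\<lambda>s. w x s) has_real_derivative D x t) (at t)) \<and>
        continuous_on (K \<times> {0<..}) (\<lambda>(x, t). w x t) \<and>
        continuous_on (K \<times> {0<..}) (\<lambda>(x, t). G x t) \<and>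
        continuous_on (K \<times> {0<..}) (\<lambda>(x, t). H x t) \<and>
        continuous_on (K \<times> {0<..}) (\<lambda>(x, t). D x t))"

definition in_L2 :: "'a::euclidean_space set \<Rightarrow> ('a \<Rightarrow> real) \<Rightarrow> bool" where
  "in_L2 \<Omega> f \<longleftrightarrow> f \<in> borel_measurable (lebesgue_on \<Omega>) \<and> integrable (lebesgue_on \<Omega>) (\<lambda>x. (f x)\<^sup>2)"

definition L2_norm_on :: "'a::euclidean_space set \<Rightarrow> ('a \<Rightarrow> real) \<Rightarrow> real" where
  "L2_norm_on \<Omega> f = sqrt (\<integral>x. (f x)\<^sup>2 \<partial>(lebesgue_on \<Omega>))"

text \<open>In the equation \<open>deriv\<close> and \<open>laplacian\<close> are genuine derivatives: the pull-back of \<open>T\<close> is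
  required to be regular, \<open>\<phi> t\<close> is a smooth diffeomorphism, and the moving domain sweeps out a
  relatively open part of space-time, so values of \<open>T\<close> outside the closed moving domain play no role.\<close>

definition is_solution ::
  "(real^'n) set \<Rightarrow> (real \<Rightarrow> real^'n \<Rightarrow> real^'n) \<Rightarrow> (real^'n \<Rightarrow> real \<Rightarrow> real) \<Rightarrow>
   (real^'n \<Rightarrow> real) \<Rightarrow> (real^'n \<Rightarrow> real \<Rightarrow> real) \<Rightarrow> bool" where
  "is_solution \<Omega>0 \<phi> a T0 T \<longleftrightarrow>
     C21_on (closure \<Omega>0) (\<lambda>x t. T (\<phi> t x) t) \<and>
     (\<forall>t>0. \<forall>y\<in>\<phi> t ` \<Omega>0. deriv (\<lambda>s. T y s) t - laplacian (\<lambda>z. T z t) y + a y t * T y t = 0) \<and>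
     (\<forall>t>0. \<forall>y\<in>frontier (\<phi> t ` \<Omega>0). T y t = 0) \<and>
     (AE y in lebesgue_on \<Omega>0. T y 0 = T0 y) \<and>
     ((\<lambda>t. L2_norm_on \<Omega>0 (\<lambda>x. T (\<phi> t x) t - T0 x)) \<longlongrightarrow> 0) (at_right 0)"

end

theory Submission
  imports Defs
begin

text \<open>
Put \<open>A t = \<integral>\<^sub>0\<^sup>t \<alpha>\<close> and let \<open>u = exp A * T\<close> on the moving domain and \<open>u = 0\<close> outside. Then \<open>u\<close> is continuous, and
\<open>u\<^sub>t = \<Delta>u - (a - \<alpha>) u\<close> with \<open>a - \<alpha> \<ge> 0\<close> on the moving domain. If \<open>g\<close> is a nonnegative convex \<open>C\<^sup>2\<close> function vanishing on
\<open>(-\<infinity>, \<epsilon>]\<close>, then \<open>g u\<close> has compact support inside the moving domain, so that no boundary terms occur: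
\<open>d/dt \<integral> g u = \<integral> g'(u) u\<^sub>t \<le> \<Sum>\<^sub>i \<integral> \<partial>\<^sub>i (g'(u) \<partial>\<^sub>i u) = 0\<close>. Choosing \<open>g\<close> close to the positive part gives
\<open>\<integral> u\<^sup>+ (t) \<le> liminf \<integral> u\<^sup>+ (s)\<close> as \<open>s \<rightarrow> 0\<close>. Since the volume distortion of \<open>\<phi> s\<close> tends to 1 and the
pull-back of \<open>T\<close> converges to \<open>T0 \<ge> 0\<close> in \<open>L\<^sup>2\<close>, the right-hand side is at most \<open>\<integral> T0\<close>.
The regularity of \<open>T\<close> itself, as opposed to its pull-back, comes from the flow being \<open>C\<^sup>2\<close> in space, which is
proved by applying \<open>C\<^sup>1\<close> dependence on initial values to \<open>V\<close> and then to the field \<open>(x, h) \<mapsto> (V x, V' x h)\<close> of the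
tangent flow.
\<close>

section \<open>Flows of continuously differentiable vector fields\<close>

text \<open>The weight \<open>exp A\<close> turns the lower bound \<alpha> on \<open>a\<close> into
  a sign, but only where \<open>u\<close> is positive; the threshold \<epsilon> of the cut-off
  therefore also confines the argument to the set where \<open>(a - \<alpha>) u\<close> is
  nonnegative. The main obstacle is the initial time. Convergence there is known for the pull-back
  only, while the monotone integrals are taken in the moving frame. The two frames are compared
  through a differential inequality for integrals of \<open>C^1\<close> functions carried by the
  flow. The positive part is not \<open>C^1\<close>, so the comparison is made with \<open>g\<close>
  still in place. The cut-off is removed only at the fixed time \<open>t\<close>, where it costs a
  multiple of \<epsilon> times the volume of the domain. Working with positive parts loses nothing:
  at time \<open>t\<close> only \<open>u <= g u + 3 \<epsilon>\<close> is used, and at the initial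
  time \<open>T0\<close> agrees with its positive part almost everywhere. The weight is undone at
  the end by the factor \<open>exp (- A t)\<close>.\<close>

lemma gronwall_forward:
  fixes y :: "real \<Rightarrow> 'a::euclidean_space"
  assumes cont: "continuous_on {0..t} y"
    and der: "\<And>s. 0 < s \<Longrightarrow> s < t \<Longrightarrow> (y has_vector_derivative y' s) (at s)"
    and bd: "\<And>s. 0 < s \<Longrightarrow> s < t \<Longrightarrow> norm (y' s) \<le> L * norm (y s) + e"
    and "0 \<le> t" "0 \<le> e" "0 \<le> L"
  shows "(norm (y t))\<^sup>2 \<le> exp ((2*L+1)*t) * ((norm (y 0))\<^sup>2 + e\<^sup>2 * t)"
proof -
  \<comment> \<open>From \<open>2 (y \<bullet> y') \<le> 2 L |y|^2 + 2 |y| e\<close> and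
    \<open>2 |y| e \<le> |y|^2 + e^2\<close>. The squared norm is used because it is differentiable
    also where \<open>y\<close> vanishes; \<open>f\<close> below is then nonincreasing, as
    \<open>exp (- c * s) \<le> 1\<close>.\<close>
  define c where "c = 2*L+1"
  have c: "c \<ge> 0" using assms by (simp add: c_def)
  define f where "f s = (y s \<bullet> y s) * exp (- c * s) - e\<^sup>2 * s" for s
  have "f t \<le> f 0"
  proof (rule DERIV_nonpos_imp_decreasing_open[where f = f and a = 0 and b = t])
    show "continuous_on {0..t} f" unfolding f_def by (intro continuous_intros cont)
    fix s assume s: "0 < s" "s < t"
    have yd: "((\<lambda>s. y s \<bullet> y s) has_real_derivative 2 * (y s \<bullet> y' s)) (at s)"
    proof -
      have "((\<lambda>s. y s \<bullet> y s) has_derivative (\<lambda>h. y s \<bullet> (h *\<^sub>R y' s) + (h *\<^sub>R y' s) \<bullet> y s)) (at s)"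
        using der[OF s] unfolding has_vector_derivative_def
        by (intro has_derivative_inner)
      then show ?thesis
        unfolding has_field_derivative_def by (rule has_derivative_eq_rhs) (auto simp: inner_commute)
    qed
    let ?d = "2 * (y s \<bullet> y' s) * exp (- c * s) + (y s \<bullet> y s) * (exp (- c * s) * (- c)) - e\<^sup>2"
    have "(f has_real_derivative ?d) (at s)"
      unfolding f_def by (rule derivative_eq_intros yd refl | simp)+
    moreover have "?d \<le> 0"
    proof -
      have "y s \<bullet> y' s \<le> norm (y s) * norm (y' s)" by (rule norm_cauchy_schwarz)
      also have "\<dots> \<le> norm (y s) * (L * norm (y s) + e)"
        using bd[OF s] by (simp add: mult_left_mono)
      finally have 1: "2 * (y s \<bullet> y' s) \<le> 2 * L * (norm (y s))\<^sup>2 + 2 * (norm (y s) * e)"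
        by (simp add: power2_eq_square algebra_simps)
      have "2 * (norm (y s) * e) \<le> (norm (y s))\<^sup>2 + e\<^sup>2"
        using sum_squares_bound[of "norm (y s)" e] by simp
      with 1 have "2 * (y s \<bullet> y' s) - c * (y s \<bullet> y s) \<le> e\<^sup>2"
        by (simp add: c_def power2_norm_eq_inner algebra_simps)
      then have "(2 * (y s \<bullet> y' s) - c * (y s \<bullet> y s)) * exp (- c * s) \<le> e\<^sup>2 * 1"
        using s c by (intro mult_mono) auto
      then show ?thesis by (simp add: algebra_simps)
    qed
    ultimately show "\<exists>d. (f has_real_derivative d) (at s) \<and> d \<le> 0" by blast
  qed fact
  then have "(y t \<bullet> y t) * exp (- c * t) \<le> y 0 \<bullet> y 0 + e\<^sup>2 * t" by (simp add: f_def)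
  then have "exp (c*t) * ((y t \<bullet> y t) * exp (- c * t)) \<le> exp (c*t) * (y 0 \<bullet> y 0 + e\<^sup>2 * t)"
    by (intro mult_left_mono) auto
  moreover have "exp (c*t) * ((y t \<bullet> y t) * exp (- c * t)) = y t \<bullet> y t"
    by (simp add: exp_minus field_simps)
  ultimately have "y t \<bullet> y t \<le> exp (c*t) * (y 0 \<bullet> y 0 + e\<^sup>2 * t)" by linarith
  then show ?thesis by (simp add: c_def power2_norm_eq_inner)
qed

text \<open>Negative times follow by reversing time. The bound is brought into a form linear in the
  initial value and the residual \<open>e\<close>, the shape in which all later estimates use it;
  this is why the constant is enlarged until the right-hand side is a perfect square.\<close>

lemma gronwall:
  fixes y :: "real \<Rightarrow> 'a::euclidean_space"
  assumes cont: "continuous_on {-\<tau>..\<tau>} y"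
    and der: "\<And>s. \<bar>s\<bar> < \<tau> \<Longrightarrow> (y has_vector_derivative y' s) (at s)"
    and bd: "\<And>s. \<bar>s\<bar> < \<tau> \<Longrightarrow> norm (y' s) \<le> L * norm (y s) + e"
    and e: "0 \<le> e" and L: "0 \<le> L" and t: "\<bar>t\<bar> \<le> \<tau>"
  shows "norm (y t) \<le> exp ((2*L+1)*\<tau>) * (1 + \<tau>) * (norm (y 0) + e)"
proof -
  define E where "E = exp ((2*L+1)*\<tau>)"
  have \<tau>: "0 \<le> \<tau>" using t by linarith
  have E: "1 \<le> E" using L \<tau> by (simp add: E_def)
  have *: "(norm (y t))\<^sup>2 \<le> exp ((2*L+1)*\<bar>t\<bar>) * ((norm (y 0))\<^sup>2 + e\<^sup>2 * \<bar>t\<bar>)"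
  proof (cases "t \<ge> 0")
    case True
    have "(norm (y t))\<^sup>2 \<le> exp ((2*L+1)*t) * ((norm (y 0))\<^sup>2 + e\<^sup>2 * t)"
    proof (rule gronwall_forward)
      show "continuous_on {0..t} y" using t by (intro continuous_on_subset[OF cont]) auto
      show "(y has_vector_derivative y' s) (at s)" if "0 < s" "s < t" for s
        using that t by (intro der) auto
      show "norm (y' s) \<le> L * norm (y s) + e" if "0 < s" "s < t" for s
        using that t by (intro bd) auto
    qed (use True e L in auto)
    with True show ?thesis by simp
  next
    case False
    have "(norm (y (- (-t))))\<^sup>2 \<le> exp ((2*L+1)*(-t)) * ((norm (y (-0)))\<^sup>2 + e\<^sup>2 * (-t))"
    proof (rule gronwall_forward[where y = "\<lambda>s. y (-s)" and y' = "\<lambda>s. - y' (-s)"])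
      show "continuous_on {0..-t} (\<lambda>s. y (- s))"
        using t by (intro continuous_on_compose2[OF cont]) (auto intro!: continuous_intros)
      show "((\<lambda>s. y (-s)) has_vector_derivative - y' (-s)) (at s)" if "0 < s" "s < -t" for s
      proof -
        have "(y has_vector_derivative y' (-s)) (at (-s))" using that t by (intro der) auto
        then have "((y \<circ> uminus) has_vector_derivative (-1) *\<^sub>R y' (-s)) (at s)"
          by (intro vector_diff_chain_at) (auto intro!: derivative_eq_intros)
        then show ?thesis by (simp add: o_def)
      qed
      show "norm (- y' (-s)) \<le> L * norm (y (-s)) + e" if "0 < s" "s < -t" for s
        using that t bd[of "-s"] by auto
    qed (use False e L in auto)
    with False show ?thesis by simp
  qed
  have "(norm (y t))\<^sup>2 \<le> E * ((norm (y 0))\<^sup>2 + e\<^sup>2 * \<tau>)"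
    unfolding E_def using t L
    by (intro order_trans[OF *] mult_mono add_mono iffD2[OF exp_le_cancel_iff] mult_left_mono) auto
  also have "\<dots> \<le> E\<^sup>2 * ((1 + \<tau>)\<^sup>2 * (norm (y 0) + e)\<^sup>2)"
  proof (rule mult_mono)
    show "E \<le> E\<^sup>2" using E by (simp add: power2_eq_square)
    have "(norm (y 0))\<^sup>2 + e\<^sup>2 * \<tau> \<le> (1 + \<tau>) * ((norm (y 0))\<^sup>2 + e\<^sup>2)"
      using \<tau> by (simp add: algebra_simps)
    also have "\<dots> \<le> (1 + \<tau>)\<^sup>2 * (norm (y 0) + e)\<^sup>2"
    proof (rule mult_mono)
      show "1 + \<tau> \<le> (1 + \<tau>)\<^sup>2" using \<tau> by (simp add: power2_eq_square algebra_simps)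
      show "(norm (y 0))\<^sup>2 + e\<^sup>2 \<le> (norm (y 0) + e)\<^sup>2" using e by (simp add: power2_sum)
    qed (use e in auto)
    finally show "(norm (y 0))\<^sup>2 + e\<^sup>2 * \<tau> \<le> (1 + \<tau>)\<^sup>2 * (norm (y 0) + e)\<^sup>2" .
  qed (use \<tau> in auto)
  finally have "(norm (y t))\<^sup>2 \<le> (E * (1 + \<tau>) * (norm (y 0) + e))\<^sup>2"
    by (simp add: power_mult_distrib mult.assoc)
  then show ?thesis
    unfolding E_def[symmetric] using E \<tau> e by (elim power2_le_imp_le) auto
qed

text \<open>The state space is an arbitrary Euclidean space because the locale is interpreted a
  second time on \<open>'a \<times> 'a\<close>, for the field of the tangent flow. Taking
  \<open>V'\<close> with values in bounded linear maps makes its continuity one in operator norm, so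
  that compactness yields uniform bounds.\<close>

locale C1_flow =
  fixes V :: "'a::euclidean_space \<Rightarrow> 'a" and V' :: "'a \<Rightarrow> 'a \<Rightarrow>\<^sub>L 'a" and \<phi> :: "real \<Rightarrow> 'a \<Rightarrow> 'a"
  assumes V_deriv: "\<And>x. (V has_derivative blinfun_apply (V' x)) (at x)"
    and V'_cont: "continuous_on UNIV V'"
    and flow: "is_flow V \<phi>"
begin

lemma flow_0 [simp]: "\<phi> 0 x = x"
  using flow by (simp add: is_flow_def)

lemma flow_deriv: "((\<lambda>s. \<phi> s x) has_vector_derivative V (\<phi> t x)) (at t)"
  using flow by (simp add: is_flow_def)

lemma flow_cont_time: "continuous_on S (\<lambda>s. \<phi> s x)"
  by (intro continuous_at_imp_continuous_on ballI has_vector_derivative_continuous[OF flow_deriv])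

lemma V_cont: "continuous_on S V"
  by (meson V_deriv continuous_at_imp_continuous_on has_derivative_continuous)

lemma V'_bounded_cball: "\<exists>L\<ge>0. \<forall>x\<in>cball 0 R. norm (V' x) \<le> L"
proof -
  have "compact (V' ` cball 0 R)"
    by (intro compact_continuous_image continuous_on_subset[OF V'_cont]) auto
  then obtain L where "\<forall>x\<in>cball 0 R. norm (V' x) \<le> L"
    by (auto dest!: compact_imp_bounded simp: bounded_iff)
  then show ?thesis by (intro exI[of _ "max 0 L"]) auto
qed

lemma V_lipschitz_cball:
  "\<exists>L\<ge>0. \<forall>x\<in>cball 0 R. \<forall>y\<in>cball 0 R. norm (V x - V y) \<le> L * norm (x - y)"
proof -
  obtain L where L: "L \<ge> 0" "\<forall>x\<in>cball 0 R. norm (V' x) \<le> L"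
    using V'_bounded_cball by blast
  have "norm (V x - V y) \<le> L * norm (x - y)" if "x \<in> cball 0 R" "y \<in> cball 0 R" for x y
    by (rule differentiable_bound[where S = "cball 0 R" and f' = "\<lambda>x. blinfun_apply (V' x)"])
      (use L that in \<open>auto intro: V_deriv has_derivative_at_withinI simp: norm_blinfun.rep_eq[symmetric]\<close>)
  then show ?thesis using L by blast
qed

text \<open>Mean value inequality for \<open>\<lambda>z. V z - V' x z\<close> on the convex set
  \<open>cball 0 R \<inter> ball x d\<close>, where uniform continuity of \<open>V'\<close> on the
  ball keeps the derivative \<open>V' z - V' x\<close> below \<open>e\<close>.\<close>

lemma V_uniformly_differentiable:
  assumes "e > 0"
  shows "\<exists>d>0. \<forall>x\<in>cball 0 R. \<forall>y\<in>cball 0 R. norm (y - x) < d \<longrightarrow>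
    norm (V y - V x - V' x (y - x)) \<le> e * norm (y - x)"
proof -
  have "uniformly_continuous_on (cball 0 R) V'"
    by (intro compact_uniformly_continuous continuous_on_subset[OF V'_cont]) auto
  then obtain d where d: "d > 0" "\<And>x y. x \<in> cball 0 R \<Longrightarrow> y \<in> cball 0 R \<Longrightarrow> dist y x < d \<Longrightarrow> dist (V' y) (V' x) < e"
    unfolding uniformly_continuous_on_def using \<open>e > 0\<close> by metis
  have "norm (V y - V x - V' x (y - x)) \<le> e * norm (y - x)"
    if xy: "x \<in> cball 0 R" "y \<in> cball 0 R" "norm (y - x) < d" for x y
  proof -
    let ?S = "cball 0 R \<inter> ball x d"
    have "norm ((V y - V' x y) - (V x - V' x x)) \<le> e * norm (y - x)"
    proof (rule differentiable_bound[where S = ?S and f' = "\<lambda>z. blinfun_apply (V' z - V' x)"])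
      show "convex ?S" by (intro convex_Int) auto
      show "((\<lambda>z. V z - V' x z) has_derivative blinfun_apply (V' z - V' x)) (at z within ?S)" for z
        by (auto intro!: derivative_eq_intros has_derivative_at_withinI[OF V_deriv] simp: blinfun.diff_left)
      show "onorm (blinfun_apply (V' z - V' x)) \<le> e" if "z \<in> ?S" for z
        using d(2)[of x z] that xy by (auto simp: norm_blinfun.rep_eq[symmetric] dist_norm dist_commute norm_minus_commute)
    qed (use xy d in \<open>auto simp: dist_norm norm_minus_commute\<close>)
    then show ?thesis by (simp add: blinfun.diff_right algebra_simps)
  qed
  then show ?thesis using d(1) by blast
qed

lemma trajectory_bounded: "\<exists>R\<ge>0. \<forall>s\<in>{-\<tau>..\<tau>}. norm (\<phi> s x) \<le> R"
proof -
  have "compact ((\<lambda>s. \<phi> s x) ` {-\<tau>..\<tau>})"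
    by (intro compact_continuous_image flow_cont_time) auto
  then obtain R where "\<forall>s\<in>{-\<tau>..\<tau>}. norm (\<phi> s x) \<le> R"
    by (auto dest!: compact_imp_bounded simp: bounded_iff)
  then show ?thesis by (intro exI[of _ "max 0 R"]) auto
qed

section \<open>Lipschitz dependence on initial values, joint continuity and the group law\<close>

lemma flow_lipschitz_in_cball:
  assumes L: "L \<ge> 0" "\<forall>x\<in>cball 0 R. \<forall>y\<in>cball 0 R. norm (V x - V y) \<le> L * norm (x - y)"
    and "\<And>s. \<bar>s\<bar> < \<tau> \<Longrightarrow> \<phi> s x \<in> cball 0 R" "\<And>s. \<bar>s\<bar> < \<tau> \<Longrightarrow> \<phi> s y \<in> cball 0 R" "\<bar>t\<bar> \<le> \<tau>"
  shows "norm (\<phi> t x - \<phi> t y) \<le> exp ((2*L+1)*\<tau>) * (1 + \<tau>) * norm (x - y)"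
proof -
  have "norm (\<phi> t x - \<phi> t y) \<le> exp ((2*L+1)*\<tau>) * (1 + \<tau>) * (norm (\<phi> 0 x - \<phi> 0 y) + 0)"
    by (rule gronwall[where y' = "\<lambda>s. V (\<phi> s x) - V (\<phi> s y)"])
      (use assms in \<open>auto intro!: continuous_intros flow_cont_time has_vector_derivative_diff flow_deriv\<close>)
  then show ?thesis by simp
qed

text \<open>\<open>V\<close> is Lipschitz only on bounded sets, so Gronwall applies only to
  trajectories already known to stay in a ball. Nearby trajectories are first confined to a unit
  tube around that of \<open>x0\<close>; afterwards one Lipschitz constant serves all pairs of
  initial values near \<open>x0\<close>.\<close>

lemma flow_tube:
  assumes \<tau>: "\<tau> \<ge> 0"
  shows "\<exists>\<delta>>0. \<exists>R C. 0 \<le> C \<and> (\<forall>x\<in>cball x0 \<delta>. \<forall>s\<in>{-\<tau>..\<tau>}. \<phi> s x \<in> cball 0 R \<and>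
           (\<forall>y\<in>cball x0 \<delta>. norm (\<phi> s x - \<phi> s y) \<le> C * norm (x - y)))"
proof -
  obtain R0 where R0: "R0 \<ge> 0" "\<And>s. s\<in>{-\<tau>..\<tau>} \<Longrightarrow> norm (\<phi> s x0) \<le> R0"
    using trajectory_bounded by metis
  define R where "R = R0 + 1"
  obtain L where L: "L \<ge> 0" "\<forall>x\<in>cball 0 R. \<forall>y\<in>cball 0 R. norm (V x - V y) \<le> L * norm (x - y)"
    using V_lipschitz_cball by blast
  define C where "C = exp ((2*L+1)*\<tau>) * (1 + \<tau>)"
  have C: "C > 0" using \<tau> by (simp add: C_def add_pos_nonneg)
  \<comment> \<open>With this radius Gronwall gives distance at most
    \<open>C * \<delta> = 1/2\<close> at the exit time, contradicting an exit at distance 1.\<close>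
  define \<delta> where "\<delta> = 1 / (2 * C)"
  have close: "norm (\<phi> s x - \<phi> s x0) < 1" if x: "x \<in> cball x0 \<delta>" and s: "s \<in> {-\<tau>..\<tau>}" for x s
  proof (rule ccontr)
    \<comment> \<open>Gronwall up to the first exit time \<open>s1\<close> from the unit tube around the trajectory of \<open>x0\<close>\<close>
    assume neg: "\<not> ?thesis"
    let ?B = "{s\<in>{-\<tau>..\<tau>}. 1 \<le> norm (\<phi> s x - \<phi> s x0)}"
    have "closed ?B"
      by (intro continuous_on_closed_Collect_le continuous_intros flow_cont_time)
    then have "compact ?B"
      by (metis (no_types, lifting) compact_Icc compact_Int_closed Int_absorb1 mem_Collect_eq subsetI)
    moreover have "?B \<noteq> {}" using neg s by auto
    moreover have "continuous_on ?B abs" by (intro continuous_intros)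
    ultimately obtain s1 where s1: "s1 \<in> ?B" "\<And>s. s \<in> ?B \<Longrightarrow> \<bar>s1\<bar> \<le> \<bar>s\<bar>"
      using continuous_attains_inf[of ?B abs] by blast
    have s1\<tau>: "\<bar>s1\<bar> \<le> \<tau>" using s1(1) by auto
    have "norm (\<phi> s1 x - \<phi> s1 x0) \<le> exp ((2*L+1)*\<bar>s1\<bar>) * (1 + \<bar>s1\<bar>) * norm (x - x0)"
    proof (rule flow_lipschitz_in_cball[OF L])
      fix r assume r: "\<bar>r\<bar> < \<bar>s1\<bar>"
      then have "r \<in> {-\<tau>..\<tau>}" using s1\<tau> by auto
      moreover have "r \<notin> ?B" using s1(2)[of r] r by auto
      ultimately have "norm (\<phi> r x - \<phi> r x0) < 1" "norm (\<phi> r x0) \<le> R0" using R0(2) by auto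
      then show "\<phi> r x \<in> cball 0 R" "\<phi> r x0 \<in> cball 0 R"
        using norm_triangle_sub[of "\<phi> r x" "\<phi> r x0"] by (auto simp: R_def)
    qed simp
    also have "\<dots> \<le> C * norm (x - x0)"
      unfolding C_def using s1\<tau> L by (intro mult_right_mono mult_mono) (auto intro!: mult_left_mono)
    also have "\<dots> \<le> C * \<delta>" using x C by (simp add: dist_norm norm_minus_commute)
    also have "\<dots> < 1" using C by (simp add: \<delta>_def)
    finally show False using s1(1) by auto
  qed
  have inR: "\<phi> s x \<in> cball 0 R" if "x \<in> cball x0 \<delta>" "s \<in> {-\<tau>..\<tau>}" for x s
    using close[OF that] R0(2)[OF that(2)] norm_triangle_sub[of "\<phi> s x" "\<phi> s x0"] by (auto simp: R_def)
  have "norm (\<phi> s x - \<phi> s y) \<le> C * norm (x - y)"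
    if "x \<in> cball x0 \<delta>" "y \<in> cball x0 \<delta>" "s \<in> {-\<tau>..\<tau>}" for x y s
    unfolding C_def
  proof (rule flow_lipschitz_in_cball[OF L])
    show "\<phi> r x \<in> cball 0 R" "\<phi> r y \<in> cball 0 R" if "\<bar>r\<bar> < \<tau>" for r
      using \<open>x \<in> _\<close> \<open>y \<in> _\<close> that by (intro inR; simp add: abs_less_iff)+
  qed (use that in auto)
  then show ?thesis using C inR by (intro exI[of _ \<delta>] conjI exI[of _ R] exI[of _ C]) (auto simp: \<delta>_def)
qed

text \<open>Continuity in time at \<open>x0\<close> combines with a Lipschitz bound in space that is
  uniform over the time window of radius \<open>\<bar>t0\<bar> + 1\<close>, which contains all times
  near \<open>t0\<close>.\<close>

lemma flow_continuous: "continuous_on S (\<lambda>(t, x). \<phi> t x)"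
proof -
  have "isCont (\<lambda>(t, x). \<phi> t x) (t0, x0)" for t0 x0
  proof -
    obtain \<delta> R C where \<delta>: "\<delta> > 0" "0 \<le> C" and
      T: "\<And>x y s. x\<in>cball x0 \<delta> \<Longrightarrow> y\<in>cball x0 \<delta> \<Longrightarrow> s\<in>{-(\<bar>t0\<bar>+1)..\<bar>t0\<bar>+1} \<Longrightarrow> norm (\<phi> s x - \<phi> s y) \<le> C * norm (x - y)"
      using flow_tube[of "\<bar>t0\<bar>+1" x0] by (metis abs_ge_zero add_nonneg_nonneg zero_le_one)
    have ev: "\<forall>\<^sub>F p in at (t0, x0). norm (\<phi> (fst p) (snd p) - \<phi> (fst p) x0) \<le> C * norm (snd p - x0)"
    proof -
      have "\<forall>\<^sub>F p in at (t0, x0). dist p (t0, x0) < min \<delta> 1"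
        using \<delta> by (metis eventually_at min_less_iff_conj zero_less_one)
      then show ?thesis
      proof eventually_elim
        case (elim p)
        have "dist (snd p) x0 \<le> dist p (t0, x0)" "dist (fst p) t0 \<le> dist p (t0, x0)"
          using dist_snd_le[of p "(t0,x0)"] dist_fst_le[of p "(t0,x0)"] by auto
        with elim show ?case using \<delta> by (intro T) (auto simp: dist_commute dist_real_def)
      qed
    qed
    have 1: "((\<lambda>p. \<phi> (fst p) (snd p) - \<phi> (fst p) x0) \<longlongrightarrow> 0) (at (t0, x0))"
    proof (rule tendsto_0_le[OF _ , where K = 1])
      show "((\<lambda>p. C * norm (snd p - x0)) \<longlongrightarrow> 0) (at (t0, x0))"
        by (rule tendsto_eq_intros refl | simp)+
      show "\<forall>\<^sub>F p in at (t0, x0). norm (\<phi> (fst p) (snd p) - \<phi> (fst p) x0) \<le> norm (C * norm (snd p - x0)) * 1"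
        using ev by eventually_elim (use \<delta> in \<open>auto simp: abs_mult\<close>)
    qed
    have 2: "((\<lambda>p. \<phi> (fst p) x0) \<longlongrightarrow> \<phi> t0 x0) (at (t0, x0))"
    proof -
      have "isCont (\<lambda>s. \<phi> s x0) t0" using flow_cont_time[of UNIV x0] by (simp add: continuous_on_eq_continuous_at)
      moreover have "(fst \<longlongrightarrow> t0) (at (t0, x0))" by (rule tendsto_eq_intros refl | simp)+
      ultimately show ?thesis by (rule isCont_tendsto_compose)
    qed
    show ?thesis using tendsto_add[OF 1 2] by (simp add: isCont_def case_prod_unfold)
  qed
  then show ?thesis by (metis continuous_at_imp_continuous_on surj_pair)
qed

text \<open>As functions of \<open>s\<close> both sides solve the same autonomous equation and agree
  at \<open>s = 0\<close>. On a ball containing both trajectories \<open>V\<close> is Lipschitz, so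
  Gronwall with residual 0 makes them equal.\<close>

lemma flow_add: "\<phi> s (\<phi> t x) = \<phi> (s + t) x"
proof -
  define \<tau> where "\<tau> = \<bar>s\<bar> + \<bar>t\<bar>"
  obtain R1 where R1: "R1 \<ge> 0" "\<And>r. r\<in>{-\<tau>..\<tau>} \<Longrightarrow> norm (\<phi> r x) \<le> R1"
    using trajectory_bounded by metis
  obtain R2 where R2: "R2 \<ge> 0" "\<And>r. r\<in>{-\<tau>..\<tau>} \<Longrightarrow> norm (\<phi> r (\<phi> t x)) \<le> R2"
    using trajectory_bounded by metis
  let ?R = "max R1 R2"
  obtain L where L: "L \<ge> 0" "\<forall>x\<in>cball 0 ?R. \<forall>y\<in>cball 0 ?R. norm (V x - V y) \<le> L * norm (x - y)"
    using V_lipschitz_cball by blast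
  have d: "((\<lambda>r. \<phi> (r + t) x) has_vector_derivative V (\<phi> (r + t) x)) (at r)" for r
  proof -
    have "(((\<lambda>r. \<phi> r x) \<circ> (\<lambda>r. r + t)) has_vector_derivative 1 *\<^sub>R V (\<phi> (r + t) x)) (at r)"
      by (intro vector_diff_chain_at flow_deriv) (auto intro!: derivative_eq_intros)
    then show ?thesis by (simp add: o_def)
  qed
  have "norm (\<phi> s (\<phi> t x) - \<phi> (s + t) x) \<le> exp ((2*L+1)*\<bar>s\<bar>) * (1 + \<bar>s\<bar>) * (norm (\<phi> 0 (\<phi> t x) - \<phi> (0 + t) x) + 0)"
  proof (rule gronwall[where y' = "\<lambda>r. V (\<phi> r (\<phi> t x)) - V (\<phi> (r + t) x)" and y = "\<lambda>r. \<phi> r (\<phi> t x) - \<phi> (r + t) x" and L = L])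
    show "continuous_on {- \<bar>s\<bar>..\<bar>s\<bar>} (\<lambda>r. \<phi> r (\<phi> t x) - \<phi> (r + t) x)"
      by (intro continuous_intros flow_cont_time continuous_at_imp_continuous_on ballI has_vector_derivative_continuous[OF d])
    show "norm (V (\<phi> r (\<phi> t x)) - V (\<phi> (r + t) x)) \<le> L * norm (\<phi> r (\<phi> t x) - \<phi> (r + t) x) + 0"
      if "\<bar>r\<bar> < \<bar>s\<bar>" for r
    proof -
      have "norm (\<phi> r (\<phi> t x)) \<le> R2" "norm (\<phi> (r + t) x) \<le> R1"
        using that by (auto intro!: R1 R2 simp: \<tau>_def)
      then show ?thesis using L by auto
    qed
  qed (auto intro!: has_vector_derivative_diff flow_deriv d L)
  then show ?thesis by simp
qed

lemma flow_minus [simp]: "\<phi> (-t) (\<phi> t x) = x" "\<phi> t (\<phi> (-t) x) = x"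
  by (simp_all add: flow_add)

section \<open>The variational equation and the spatial derivative of the flow\<close>

lemma flow_difference_estimate:
  assumes "e > 0" "\<tau> \<ge> 0"
  shows "\<exists>d>0. \<forall>h. norm h < d \<longrightarrow> (\<forall>s\<in>{-\<tau>..\<tau>}.
    norm (V (\<phi> s (x + h)) - V (\<phi> s x) - V' (\<phi> s x) (\<phi> s (x + h) - \<phi> s x)) \<le> e * norm h)"
proof -
  obtain \<delta> R C where \<delta>: "\<delta> > 0" "0 \<le> C" and
    T: "\<And>y s. y\<in>cball x \<delta> \<Longrightarrow> s\<in>{-\<tau>..\<tau>} \<Longrightarrow> \<phi> s y \<in> cball 0 R"
       "\<And>y s. y\<in>cball x \<delta> \<Longrightarrow> s\<in>{-\<tau>..\<tau>} \<Longrightarrow> norm (\<phi> s y - \<phi> s x) \<le> C * norm (y - x)"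
    using flow_tube[OF assms(2), of x] by (metis centre_in_cball less_eq_real_def)
  obtain d where d: "d > 0" "\<And>y z. y\<in>cball 0 R \<Longrightarrow> z\<in>cball 0 R \<Longrightarrow> norm (z - y) < d \<Longrightarrow>
      norm (V z - V y - V' y (z - y)) \<le> e / (C + 1) * norm (z - y)"
    \<comment> \<open>The tolerance is divided by the Lipschitz constant of the flow because the
      linearisation error is measured against \<open>\<phi> s (x + h) - \<phi> s x\<close>, not
      \<open>h\<close>; \<open>C + 1\<close> keeps the denominator positive.\<close>
    using V_uniformly_differentiable[of "e / (C + 1)" R] assms \<delta> by (metis add_nonneg_pos divide_pos_pos zero_less_one)
  have "norm (V (\<phi> s (x + h)) - V (\<phi> s x) - V' (\<phi> s x) (\<phi> s (x + h) - \<phi> s x)) \<le> e * norm h"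
    if h: "norm h < min \<delta> (d / (C + 1))" and s: "s\<in>{-\<tau>..\<tau>}" for h s
  proof -
    have xh: "x + h \<in> cball x \<delta>" "x \<in> cball x \<delta>" using h \<delta> by (auto simp: dist_norm)
    have n: "norm (\<phi> s (x + h) - \<phi> s x) \<le> C * norm h" using T(2)[OF xh(1) s] by simp
    also have "\<dots> \<le> (C + 1) * norm h" by (simp add: algebra_simps)
    also have "\<dots> < d" using h \<delta> by (simp add: pos_less_divide_eq mult.commute)
    finally have "norm (V (\<phi> s (x + h)) - V (\<phi> s x) - V' (\<phi> s x) (\<phi> s (x + h) - \<phi> s x))
      \<le> e / (C + 1) * norm (\<phi> s (x + h) - \<phi> s x)"
      using T(1)[OF xh(1) s] T(1)[OF xh(2) s] by (intro d(2))
    also have "\<dots> \<le> e / (C + 1) * ((C + 1) * norm h)"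
      using n \<delta> assms by (intro mult_left_mono) (auto simp: algebra_simps intro: order_trans)
    also have "\<dots> = e * norm h" using \<delta> by (simp add: field_simps)
    finally show ?thesis .
  qed
  then show ?thesis using \<delta> d assms by (intro exI[of _ "min \<delta> (d / (C + 1))"]) auto
qed

text \<open>Stability of \<open>y' = V' (\<phi> s x) y\<close> under a residual \<open>e\<close>. A
  single \<open>E\<close> serves every approximate solution along the trajectory of
  \<open>x\<close>; convergence of the quotients, uniqueness, Frechet differentiability and
  continuity in the base point are all instances.\<close>

lemma variational_gronwall:
  assumes "\<tau> \<ge> 0"
  shows "\<exists>E>0. \<forall>y y' e. (\<forall>s. (y has_vector_derivative y' s) (at s)) \<longrightarrow> 0 \<le> e \<longrightarrow>
     (\<forall>s\<in>{-\<tau>..\<tau>}. norm (y' s - V' (\<phi> s x) (y s)) \<le> e) \<longrightarrow>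
     (\<forall>s\<in>{-\<tau>..\<tau>}. norm (y s) \<le> E * (norm (y 0) + e))"
proof -
  obtain R where R: "\<And>s. s\<in>{-\<tau>..\<tau>} \<Longrightarrow> norm (\<phi> s x) \<le> R"
    using trajectory_bounded by metis
  obtain L where L: "L \<ge> 0" "\<And>x. x\<in>cball 0 R \<Longrightarrow> norm (V' x) \<le> L"
    using V'_bounded_cball by metis
  have "norm (y t) \<le> exp ((2*L+1)*\<tau>) * (1 + \<tau>) * (norm (y 0) + e)"
    if y: "\<forall>s. (y has_vector_derivative y' s) (at s)" and e: "0 \<le> e"
      and bd: "\<forall>s\<in>{-\<tau>..\<tau>}. norm (y' s - V' (\<phi> s x) (y s)) \<le> e" and t: "t \<in> {-\<tau>..\<tau>}" for y y' e t
  proof (rule gronwall[where y' = y'])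
    show "continuous_on {- \<tau>..\<tau>} y"
      using y has_vector_derivative_continuous by (blast intro: continuous_at_imp_continuous_on)
    show "norm (y' s) \<le> L * norm (y s) + e" if "\<bar>s\<bar> < \<tau>" for s
    proof -
      have s: "s \<in> {-\<tau>..\<tau>}" using that by auto
      have "norm (y' s) \<le> norm (V' (\<phi> s x) (y s)) + norm (y' s - V' (\<phi> s x) (y s))"
        by (rule norm_triangle_sub)
      also have "norm (V' (\<phi> s x) (y s)) \<le> norm (V' (\<phi> s x)) * norm (y s)" by (rule norm_blinfun)
      also have "\<dots> \<le> L * norm (y s)" using L(2)[of "\<phi> s x"] R[OF s] by (intro mult_right_mono) auto
      finally show ?thesis using bd s by fastforce
    qed
  qed (use y e L t in auto)
  moreover have "exp ((2*L+1)*\<tau>) * (1 + \<tau>) > 0" using assms by (simp add: add_pos_nonneg)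
  ultimately show ?thesis by blast
qed

definition flow_quotient :: "'a \<Rightarrow> 'a \<Rightarrow> nat \<Rightarrow> real \<Rightarrow> 'a" where
  "flow_quotient x h n t = real (Suc n) *\<^sub>R (\<phi> t (x + inverse (real (Suc n)) *\<^sub>R h) - \<phi> t x)"

text \<open>The difference quotients of the flow satisfy the variational equation up to a vanishing error, so by
  Gronwall they form a Cauchy sequence; this yields the solution of the variational equation without an
  existence theorem.\<close>

definition tangent_flow :: "real \<Rightarrow> 'a \<Rightarrow> 'a \<Rightarrow> 'a" where
  "tangent_flow t x h = lim (\<lambda>n. flow_quotient x h n t)"

lemma flow_quotient_deriv:
  "((\<lambda>s. flow_quotient x h n s) has_vector_derivative
     real (Suc n) *\<^sub>R (V (\<phi> t (x + inverse (real (Suc n)) *\<^sub>R h)) - V (\<phi> t x))) (at t)"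
  unfolding flow_quotient_def
  by (intro bounded_linear.has_vector_derivative[OF bounded_linear_scaleR_right] has_vector_derivative_diff flow_deriv)

lemma flow_quotient_0 [simp]: "flow_quotient x h n 0 = h"
  by (simp add: flow_quotient_def)

text \<open>The factor \<open>Suc n\<close> cancels the length of the increment, so the
  \<open>o(|h|)\<close> linearisation error of the flow becomes a vanishing residual. The tolerance
  is divided by \<open>norm h + 1\<close> so that \<open>h = 0\<close> is covered.\<close>

lemma flow_quotient_variational:
  assumes "e > 0" "\<tau> \<ge> 0"
  shows "\<forall>\<^sub>F n in sequentially. \<forall>s\<in>{-\<tau>..\<tau>}.
    norm (real (Suc n) *\<^sub>R (V (\<phi> s (x + inverse (real (Suc n)) *\<^sub>R h)) - V (\<phi> s x))
      - V' (\<phi> s x) (flow_quotient x h n s)) \<le> e"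
proof -
  obtain d where d: "d > 0" "\<And>k s. norm k < d \<Longrightarrow> s\<in>{-\<tau>..\<tau>} \<Longrightarrow>
    norm (V (\<phi> s (x + k)) - V (\<phi> s x) - V' (\<phi> s x) (\<phi> s (x + k) - \<phi> s x)) \<le> e / (norm h + 1) * norm k"
    using flow_difference_estimate[of "e / (norm h + 1)" \<tau> x] assms
    by (metis add_nonneg_pos divide_pos_pos norm_ge_zero zero_less_one)
  have "(\<lambda>n. norm (inverse (real (Suc n)) *\<^sub>R h)) \<longlonglongrightarrow> norm (0 *\<^sub>R h)"
    by (intro tendsto_intros LIMSEQ_inverse_real_of_nat)
  then have "\<forall>\<^sub>F n in sequentially. norm (inverse (real (Suc n)) *\<^sub>R h) < d"
    using d(1) by (auto dest!: order_tendstoD(2))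
  then show ?thesis
  proof (eventually_elim, intro ballI)
    fix n s assume n: "norm (inverse (real (Suc n)) *\<^sub>R h) < d" and s: "s\<in>{-\<tau>..\<tau>}"
    let ?k = "inverse (real (Suc n)) *\<^sub>R h"
    have "norm (real (Suc n) *\<^sub>R (V (\<phi> s (x + ?k)) - V (\<phi> s x)) - V' (\<phi> s x) (flow_quotient x h n s))
      = real (Suc n) * norm (V (\<phi> s (x + ?k)) - V (\<phi> s x) - V' (\<phi> s x) (\<phi> s (x + ?k) - \<phi> s x))"
      unfolding flow_quotient_def blinfun.scaleR_right scaleR_diff_right[symmetric]
      by (simp del: of_nat_Suc)
    also have "\<dots> \<le> real (Suc n) * (e / (norm h + 1) * norm ?k)"
      by (intro mult_left_mono d n s) auto
    also have "\<dots> = e * (norm h / (norm h + 1))" by (simp add: divide_inverse del: of_nat_Suc)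
    also have "\<dots> \<le> e * 1" using assms by (intro mult_left_mono) (auto simp: divide_le_eq_1 add_nonneg_pos)
    finally show "norm (real (Suc n) *\<^sub>R (V (\<phi> s (x + ?k)) - V (\<phi> s x)) - V' (\<phi> s x) (flow_quotient x h n s)) \<le> e"
      by simp
  qed
qed

text \<open>All quotients start at \<open>h\<close>, so the difference of two of them starts at 0
  and solves the variational equation up to the sum of two small residuals.\<close>

lemma flow_quotient_Cauchy:
  assumes "e > 0" "\<tau> \<ge> 0"
  shows "\<exists>N. \<forall>m\<ge>N. \<forall>n\<ge>N. \<forall>s\<in>{-\<tau>..\<tau>}. norm (flow_quotient x h m s - flow_quotient x h n s) \<le> e"
proof -
  obtain E where E: "E > 0" "\<And>y y' e t. (\<And>s. (y has_vector_derivative y' s) (at s)) \<Longrightarrow> 0 \<le> e \<Longrightarrow>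
     (\<And>s. s\<in>{-\<tau>..\<tau>} \<Longrightarrow> norm (y' s - V' (\<phi> s x) (y s)) \<le> e) \<Longrightarrow> t\<in>{-\<tau>..\<tau>} \<Longrightarrow> norm (y t) \<le> E * (norm (y 0) + e)"
    using variational_gronwall[OF assms(2), of x] by metis
  let ?r = "\<lambda>n s. real (Suc n) *\<^sub>R (V (\<phi> s (x + inverse (real (Suc n)) *\<^sub>R h)) - V (\<phi> s x))"
  obtain N where N: "\<And>n s. n \<ge> N \<Longrightarrow> s\<in>{-\<tau>..\<tau>} \<Longrightarrow> norm (?r n s - V' (\<phi> s x) (flow_quotient x h n s)) \<le> e / (2 * E)"
    using flow_quotient_variational[of "e / (2 * E)" \<tau> x h] assms E(1)
    unfolding eventually_sequentially by (metis divide_pos_pos mult_pos_pos zero_less_numeral)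
  have "norm (flow_quotient x h m t - flow_quotient x h n t) \<le> e"
    if mn: "m \<ge> N" "n \<ge> N" and t: "t\<in>{-\<tau>..\<tau>}" for m n t
  proof -
    have "norm (flow_quotient x h m t - flow_quotient x h n t)
      \<le> E * (norm (flow_quotient x h m 0 - flow_quotient x h n 0) + e / E)"
    proof (rule E(2)[where y' = "\<lambda>s. ?r m s - ?r n s" and y = "\<lambda>s. flow_quotient x h m s - flow_quotient x h n s"])
      fix s assume s: "s\<in>{-\<tau>..\<tau>}"
      have "norm ((?r m s - ?r n s) - V' (\<phi> s x) (flow_quotient x h m s - flow_quotient x h n s))
        = norm ((?r m s - V' (\<phi> s x) (flow_quotient x h m s)) - (?r n s - V' (\<phi> s x) (flow_quotient x h n s)))"
        by (simp only: blinfun.diff_right) (simp only: algebra_simps)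
      also have "\<dots> \<le> e / (2 * E) + e / (2 * E)"
        by (rule order_trans[OF norm_triangle_ineq4 add_mono[OF N[OF mn(1) s] N[OF mn(2) s]]])
      finally show "norm ((?r m s - ?r n s) - V' (\<phi> s x) (flow_quotient x h m s - flow_quotient x h n s)) \<le> e / E"
        by simp
    qed (use t assms E in \<open>auto intro!: has_vector_derivative_diff flow_quotient_deriv simp del: of_nat_Suc\<close>)
    then show ?thesis using E by simp
  qed
  then show ?thesis by blast
qed

lemma flow_quotient_tendsto: "(\<lambda>n. flow_quotient x h n t) \<longlonglongrightarrow> tangent_flow t x h"
proof -
  have "Cauchy (\<lambda>n. flow_quotient x h n t)"
  proof (rule metric_CauchyI)
    fix e :: real assume "e > 0"
    then obtain N where N: "\<And>m n. m\<ge>N \<Longrightarrow> n\<ge>N \<Longrightarrow> norm (flow_quotient x h m t - flow_quotient x h n t) \<le> e / 2"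
      using flow_quotient_Cauchy[of "e/2" "\<bar>t\<bar>" x h]
      by (metis abs_ge_minus_self abs_ge_self abs_ge_zero atLeastAtMost_iff half_gt_zero minus_le_iff)
    show "\<exists>M. \<forall>m\<ge>M. \<forall>n\<ge>M. dist (flow_quotient x h m t) (flow_quotient x h n t) < e"
      using \<open>e > 0\<close> by (intro exI[of _ N]) (auto simp: dist_norm intro!: le_less_trans[OF N])
  qed
  then show ?thesis unfolding tangent_flow_def by (simp add: Cauchy_convergent convergent_LIMSEQ_iff[symmetric])
qed

lemma flow_quotient_uniform:
  assumes "e > 0" "\<tau> \<ge> 0"
  shows "\<forall>\<^sub>F n in sequentially. \<forall>s\<in>{-\<tau>..\<tau>}. norm (flow_quotient x h n s - tangent_flow s x h) \<le> e"
proof -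
  obtain N where N: "\<And>m n s. m\<ge>N \<Longrightarrow> n\<ge>N \<Longrightarrow> s\<in>{-\<tau>..\<tau>} \<Longrightarrow> norm (flow_quotient x h n s - flow_quotient x h m s) \<le> e"
    using flow_quotient_Cauchy[OF assms, of x h] by blast
  have "norm (flow_quotient x h n s - tangent_flow s x h) \<le> e" if "n \<ge> N" "s\<in>{-\<tau>..\<tau>}" for n s
  proof (rule Lim_norm_ubound[OF sequentially_bot])
    show "(\<lambda>m. flow_quotient x h n s - flow_quotient x h m s) \<longlonglongrightarrow> flow_quotient x h n s - tangent_flow s x h"
      by (intro tendsto_intros flow_quotient_tendsto)
    show "\<forall>\<^sub>F m in sequentially. norm (flow_quotient x h n s - flow_quotient x h m s) \<le> e"
      using N that by (auto simp: eventually_sequentially)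
  qed
  then show ?thesis unfolding eventually_sequentially by blast
qed

lemma tangent_flow_0 [simp]: "tangent_flow 0 x h = h"
  using flow_quotient_tendsto[of x h 0] by (simp add: LIMSEQ_const_iff)

lemma tangent_flow_deriv:
  "((\<lambda>s. tangent_flow s x h) has_vector_derivative V' (\<phi> t x) (tangent_flow t x h)) (at t)"
proof -
  \<comment> \<open>The open interval of this radius contains both \<open>t\<close> and 0.
    Differentiating the limit requires uniform convergence of the derivatives there and convergence
    of the functions at one point, for which 0 is taken.\<close>
  define \<tau> where "\<tau> = \<bar>t\<bar> + 1"
  let ?S = "{-\<tau><..<\<tau>}"
  let ?r = "\<lambda>n s. real (Suc n) *\<^sub>R (V (\<phi> s (x + inverse (real (Suc n)) *\<^sub>R h)) - V (\<phi> s x))"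
  obtain R where R: "\<And>s. s\<in>{-\<tau>..\<tau>} \<Longrightarrow> norm (\<phi> s x) \<le> R"
    using trajectory_bounded by metis
  obtain L where L: "L \<ge> 0" "\<And>x. x\<in>cball 0 R \<Longrightarrow> norm (V' x) \<le> L"
    using V'_bounded_cball by metis
  have "\<exists>g. \<forall>s\<in>?S. (\<lambda>n. flow_quotient x h n s) \<longlonglongrightarrow> g s \<and>
      (g has_derivative (\<lambda>k. k *\<^sub>R V' (\<phi> s x) (tangent_flow s x h))) (at s within ?S)"
  proof (rule has_derivative_sequence[where f' = "\<lambda>n s k. k *\<^sub>R ?r n s" and f = "flow_quotient x h" and ?x0.0 = 0 and l = "tangent_flow 0 x h"])
    show "((\<lambda>s. flow_quotient x h n s) has_derivative (\<lambda>k. k *\<^sub>R ?r n s)) (at s within ?S)" for n s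
      using flow_quotient_deriv[of x h n s] unfolding has_vector_derivative_def by (rule has_derivative_at_withinI)
    fix e :: real assume "e > 0"
    \<comment> \<open>Half of \<open>e\<close> goes to the residual of the quotient. The other half
      goes to its distance from the limit, which is multiplied by the bound \<open>L\<close> of
      \<open>V'\<close> along the trajectory.\<close>
    have "e / (2 * (L + 1)) > 0" using \<open>e > 0\<close> L by simp
    from flow_quotient_uniform[OF this, of \<tau> x h] flow_quotient_variational[of "e / 2" \<tau> x h] \<open>e > 0\<close>
    have "\<forall>\<^sub>F n in sequentially. (\<forall>s\<in>{-\<tau>..\<tau>}. norm (flow_quotient x h n s - tangent_flow s x h) \<le> e / (2 * (L + 1)))
       \<and> (\<forall>s\<in>{-\<tau>..\<tau>}. norm (?r n s - V' (\<phi> s x) (flow_quotient x h n s)) \<le> e / 2)"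
      by (intro eventually_conj) (auto simp: \<tau>_def)
    then show "\<forall>\<^sub>F n in sequentially. \<forall>s\<in>?S. \<forall>k. norm (k *\<^sub>R ?r n s - k *\<^sub>R V' (\<phi> s x) (tangent_flow s x h)) \<le> e * norm k"
    proof eventually_elim
      case A: (elim n)
      show ?case
      proof (intro ballI allI)
        fix s k assume s: "s \<in> ?S"
        have s': "s \<in> {-\<tau>..\<tau>}" using s by auto
        have "norm (V' (\<phi> s x) (flow_quotient x h n s - tangent_flow s x h)) \<le> L * (e / (2 * (L + 1)))"
          using A s' L(1) L(2)[of "\<phi> s x"] R[OF s'] by (intro order_trans[OF norm_blinfun] mult_mono) auto
        also have "\<dots> \<le> e / 2" using \<open>e > 0\<close> L by (simp add: field_simps)
        finally have "norm (?r n s - V' (\<phi> s x) (flow_quotient x h n s)) + norm (V' (\<phi> s x) (flow_quotient x h n s - tangent_flow s x h)) \<le> e"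
          using A s' by fastforce
        moreover have "norm (?r n s - V' (\<phi> s x) (tangent_flow s x h)) \<le>
           norm (?r n s - V' (\<phi> s x) (flow_quotient x h n s)) + norm (V' (\<phi> s x) (flow_quotient x h n s - tangent_flow s x h))"
          unfolding blinfun.diff_right by (metis (no_types) norm_triangle_ineq diff_add_cancel add_diff_eq)
        ultimately have "norm (?r n s - V' (\<phi> s x) (tangent_flow s x h)) \<le> e" by linarith
        then show "norm (k *\<^sub>R ?r n s - k *\<^sub>R V' (\<phi> s x) (tangent_flow s x h)) \<le> e * norm k"
          unfolding scaleR_diff_right[symmetric] norm_scaleR
          by (metis abs_ge_zero mult.commute mult_right_mono real_norm_def)
      qed
    qed
  next
    show "0 \<in> ?S" by (auto simp: \<tau>_def)
    show "(\<lambda>n. flow_quotient x h n 0) \<longlonglongrightarrow> tangent_flow 0 x h" by (rule flow_quotient_tendsto)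
  qed simp
  then obtain g where g: "\<And>s. s \<in> ?S \<Longrightarrow> (\<lambda>n. flow_quotient x h n s) \<longlonglongrightarrow> g s"
     "\<And>s. s \<in> ?S \<Longrightarrow> (g has_derivative (\<lambda>k. k *\<^sub>R V' (\<phi> s x) (tangent_flow s x h))) (at s within ?S)" by blast
  have t: "t \<in> ?S" by (auto simp: \<tau>_def)
  have eq: "tangent_flow s x h = g s" if "s \<in> ?S" for s
    using LIMSEQ_unique g(1)[OF that] flow_quotient_tendsto by blast
  have "((\<lambda>s. tangent_flow s x h) has_derivative (\<lambda>k. k *\<^sub>R V' (\<phi> t x) (tangent_flow t x h))) (at t within ?S)"
    by (rule has_derivative_transform[OF t _ g(2)[OF t]]) (rule eq)
  then show ?thesis unfolding has_vector_derivative_def using at_within_open[OF t open_greaterThanLessThan] by simp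
qed

lemma variational_unique:
  assumes "\<And>s. (y has_vector_derivative V' (\<phi> s x) (y s)) (at s)" "y 0 = 0"
  shows "y t = 0"
proof -
  obtain E where E: "E > 0" "\<And>y y' e s. (\<And>s. (y has_vector_derivative y' s) (at s)) \<Longrightarrow> 0 \<le> e \<Longrightarrow>
     (\<And>s. s\<in>{-\<bar>t\<bar>..\<bar>t\<bar>} \<Longrightarrow> norm (y' s - V' (\<phi> s x) (y s)) \<le> e) \<Longrightarrow> s\<in>{-\<bar>t\<bar>..\<bar>t\<bar>} \<Longrightarrow> norm (y s) \<le> E * (norm (y 0) + e)"
    using variational_gronwall[of "\<bar>t\<bar>" x] by (metis abs_ge_zero)
  have "norm (y t) \<le> E * (norm (y 0) + 0)" by (rule E(2)) (use assms in auto)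
  then show ?thesis using assms by simp
qed

lemma tangent_flow_linear: "linear (tangent_flow t x)"
proof (rule linearI)
  fix h k
  have "tangent_flow t x (h + k) - (tangent_flow t x h + tangent_flow t x k) = 0"
    by (rule variational_unique[where x = x and y = "\<lambda>s. tangent_flow s x (h + k) - (tangent_flow s x h + tangent_flow s x k)"])
      (auto simp: blinfun.diff_right blinfun.add_right intro!: has_vector_derivative_diff has_vector_derivative_add tangent_flow_deriv)
  then show "tangent_flow t x (h + k) = tangent_flow t x h + tangent_flow t x k" by simp
next
  fix r h
  have "tangent_flow t x (r *\<^sub>R h) - r *\<^sub>R tangent_flow t x h = 0"
    by (rule variational_unique[where x = x and y = "\<lambda>s. tangent_flow s x (r *\<^sub>R h) - r *\<^sub>R tangent_flow s x h"])
      (auto simp: blinfun.diff_right blinfun.scaleR_right intro!: has_vector_derivative_diff tangent_flow_deriv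
          bounded_linear.has_vector_derivative[OF bounded_linear_scaleR_right])
  then show "tangent_flow t x (r *\<^sub>R h) = r *\<^sub>R tangent_flow t x h" by simp
qed

text \<open>The quotients only give limits along one sequence of step lengths in each direction. For
  the full derivative, the error \<open>\<phi> s z - \<phi> s x - tangent_flow s x (z - x)\<close>
  is itself an approximate solution of the variational equation: it starts at 0 and its residual is
  \<open>o(|z - x|)\<close>.\<close>

lemma flow_has_derivative: "(\<phi> t has_derivative tangent_flow t x) (at x)"
  unfolding has_derivative_at_alt
proof (intro conjI allI impI)
  show "bounded_linear (tangent_flow t x)"
    by (rule linear_conv_bounded_linear[THEN iffD1, OF tangent_flow_linear])
  fix e :: real assume "e > 0"
  obtain E where E: "E > 0" "\<And>y y' e s. (\<And>s. (y has_vector_derivative y' s) (at s)) \<Longrightarrow> 0 \<le> e \<Longrightarrow>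
     (\<And>s. s\<in>{-\<bar>t\<bar>..\<bar>t\<bar>} \<Longrightarrow> norm (y' s - V' (\<phi> s x) (y s)) \<le> e) \<Longrightarrow> s\<in>{-\<bar>t\<bar>..\<bar>t\<bar>} \<Longrightarrow> norm (y s) \<le> E * (norm (y 0) + e)"
    using variational_gronwall[of "\<bar>t\<bar>" x] by (metis abs_ge_zero)
  obtain d where d: "d > 0" "\<And>h s. norm h < d \<Longrightarrow> s\<in>{-\<bar>t\<bar>..\<bar>t\<bar>} \<Longrightarrow>
    norm (V (\<phi> s (x + h)) - V (\<phi> s x) - V' (\<phi> s x) (\<phi> s (x + h) - \<phi> s x)) \<le> e / E * norm h"
    using flow_difference_estimate[of "e / E" "\<bar>t\<bar>" x] E \<open>e > 0\<close> by (metis abs_ge_zero divide_pos_pos)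
  have "norm (\<phi> t z - \<phi> t x - tangent_flow t x (z - x)) \<le> e * norm (z - x)" if z: "norm (z - x) < d" for z
  proof -
    have "norm (\<phi> t z - \<phi> t x - tangent_flow t x (z - x)) \<le>
       E * (norm (\<phi> 0 z - \<phi> 0 x - tangent_flow 0 x (z - x)) + e / E * norm (z - x))"
    proof (rule E(2)[where y' = "\<lambda>s. V (\<phi> s z) - V (\<phi> s x) - V' (\<phi> s x) (tangent_flow s x (z - x))"
         and y = "\<lambda>s. \<phi> s z - \<phi> s x - tangent_flow s x (z - x)"])
      show "norm (V (\<phi> s z) - V (\<phi> s x) - V' (\<phi> s x) (tangent_flow s x (z - x)) - V' (\<phi> s x) (\<phi> s z - \<phi> s x - tangent_flow s x (z - x)))
         \<le> e / E * norm (z - x)" if "s \<in> {-\<bar>t\<bar>..\<bar>t\<bar>}" for s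
      proof -
        have "V (\<phi> s z) - V (\<phi> s x) - V' (\<phi> s x) (tangent_flow s x (z - x)) - V' (\<phi> s x) (\<phi> s z - \<phi> s x - tangent_flow s x (z - x))
          = V (\<phi> s (x + (z - x))) - V (\<phi> s x) - V' (\<phi> s x) (\<phi> s (x + (z - x)) - \<phi> s x)"
          by (simp add: blinfun.diff_right)
        then show ?thesis using d(2)[OF z that] by (simp only:)
      qed
    qed (use \<open>e > 0\<close> E in \<open>auto intro!: has_vector_derivative_diff flow_deriv tangent_flow_deriv\<close>)
    then show ?thesis using E by simp
  qed
  then show "\<exists>d>0. \<forall>z. norm (z - x) < d \<longrightarrow> norm (\<phi> t z - \<phi> t x - tangent_flow t x (z - x)) \<le> e * norm (z - x)"
    using d(1) by blast
qed

text \<open>The limit inherits the Lipschitz constant of the flow from the difference quotients.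
  Halving the radius leaves room for the increments, so that both end points lie in the ball of
  \<open>flow_tube\<close>.\<close>

lemma tangent_flow_bound:
  assumes "\<tau> \<ge> 0"
  shows "\<exists>\<delta>>0. \<exists>C\<ge>0. \<forall>x\<in>cball x0 \<delta>. \<forall>s\<in>{-\<tau>..\<tau>}. \<forall>h. norm (tangent_flow s x h) \<le> C * norm h"
proof -
  obtain \<delta> R C where \<delta>: "\<delta> > 0" "0 \<le> C" and
    T: "\<And>y z s. y\<in>cball x0 \<delta> \<Longrightarrow> z\<in>cball x0 \<delta> \<Longrightarrow> s\<in>{-\<tau>..\<tau>} \<Longrightarrow> norm (\<phi> s z - \<phi> s y) \<le> C * norm (z - y)"
    using flow_tube[OF assms, of x0] by metis
  have "norm (tangent_flow s x h) \<le> C * norm h" if x: "x \<in> cball x0 (\<delta> / 2)" and s: "s \<in> {-\<tau>..\<tau>}" for s x h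
  proof (rule Lim_norm_ubound[OF sequentially_bot flow_quotient_tendsto])
    have "(\<lambda>n. norm (inverse (real (Suc n)) *\<^sub>R h)) \<longlonglongrightarrow> norm (0 *\<^sub>R h)"
      by (intro tendsto_intros LIMSEQ_inverse_real_of_nat)
    from order_tendstoD(2)[OF this, of "\<delta> / 2"]
    have "\<forall>\<^sub>F n in sequentially. norm (inverse (real (Suc n)) *\<^sub>R h) < \<delta> / 2"
      using \<delta>(1) by simp
    then show "\<forall>\<^sub>F n in sequentially. norm (flow_quotient x h n s) \<le> C * norm h"
    proof eventually_elim
      case (elim n)
      let ?k = "inverse (real (Suc n)) *\<^sub>R h"
      have "dist x0 (x + ?k) \<le> dist x0 x + norm ?k" using dist_triangle[of x0 "x + ?k" x] by (simp add: dist_norm)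
      then have "x + ?k \<in> cball x0 \<delta>" "x \<in> cball x0 \<delta>" using x elim \<delta> by auto
      from T[OF this(2,1) s] have "norm (\<phi> s (x + ?k) - \<phi> s x) \<le> C * norm ?k" by simp
      then have "real (Suc n) * norm (\<phi> s (x + ?k) - \<phi> s x) \<le> real (Suc n) * (C * norm ?k)"
        by (intro mult_left_mono) auto
      also have "\<dots> = C * norm h" by (simp del: of_nat_Suc)
      finally show ?case unfolding flow_quotient_def by (simp del: of_nat_Suc)
    qed
  qed
  then show ?thesis using \<delta> by (intro exI[of _ "\<delta>/2"] conjI exI[of _ C]) auto
qed

text \<open>The difference of the tangent flows at \<open>x\<close> and \<open>x0\<close> solves the
  variational equation along \<open>x0\<close> with residual
  \<open>(V' (\<phi> s x) - V' (\<phi> s x0)) (tangent_flow s x h)\<close>. This is small by uniform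
  continuity of \<open>V'\<close> and the uniform bound on the tangent flow.\<close>

lemma tangent_flow_continuous: "continuous_on S (\<lambda>x. tangent_flow t x h)"
proof -
  have "isCont (\<lambda>x. tangent_flow t x h) x0" for x0
  proof -
    let ?T = "{-\<bar>t\<bar>..\<bar>t\<bar>}"
    obtain E where E: "E > 0" "\<And>y y' e s. (\<And>s. (y has_vector_derivative y' s) (at s)) \<Longrightarrow> 0 \<le> e \<Longrightarrow>
     (\<And>s. s\<in>?T \<Longrightarrow> norm (y' s - V' (\<phi> s x0) (y s)) \<le> e) \<Longrightarrow> s\<in>?T \<Longrightarrow> norm (y s) \<le> E * (norm (y 0) + e)"
      using variational_gronwall[of "\<bar>t\<bar>" x0] by (metis abs_ge_zero)
    obtain \<delta>1 C where \<delta>1: "\<delta>1 > 0" "0 \<le> C" "\<And>x s. x\<in>cball x0 \<delta>1 \<Longrightarrow> s\<in>?T \<Longrightarrow> norm (tangent_flow s x h) \<le> C * norm h"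
      using tangent_flow_bound[of "\<bar>t\<bar>" x0] by (metis abs_ge_zero)
    obtain \<delta>2 R C2 where \<delta>2: "\<delta>2 > 0" "0 \<le> C2" and
      T: "\<And>x s. x\<in>cball x0 \<delta>2 \<Longrightarrow> s\<in>?T \<Longrightarrow> \<phi> s x \<in> cball 0 R"
         "\<And>x s. x\<in>cball x0 \<delta>2 \<Longrightarrow> s\<in>?T \<Longrightarrow> norm (\<phi> s x - \<phi> s x0) \<le> C2 * norm (x - x0)"
      using flow_tube[of "\<bar>t\<bar>" x0] by (metis abs_ge_zero centre_in_cball less_eq_real_def)
    have uc: "uniformly_continuous_on (cball 0 R) V'"
      by (intro compact_uniformly_continuous continuous_on_subset[OF V'_cont]) auto
    show ?thesis unfolding continuous_at_eps_delta
    proof (intro allI impI)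
      fix e :: real assume "e > 0"
      \<comment> \<open>Makes \<open>E\<close> times the residual \<open>e1 * (C * norm h)\<close>
        at most \<open>e / 2\<close>; the added 1 keeps the denominator positive when
        \<open>C * norm h\<close> vanishes.\<close>
      define e1 where "e1 = e / (2 * E * (C * norm h + 1))"
      have p: "C * norm h + 1 > 0" using \<delta>1 by (simp add: add_nonneg_pos)
      then have e1: "e1 > 0" using \<open>e > 0\<close> E by (simp add: e1_def)
      then obtain d where d: "d > 0" "\<And>x y. x \<in> cball 0 R \<Longrightarrow> y \<in> cball 0 R \<Longrightarrow> dist y x < d \<Longrightarrow> dist (V' y) (V' x) < e1"
        using uc unfolding uniformly_continuous_on_def by metis
      define \<delta> where "\<delta> = min (min \<delta>1 \<delta>2) (d / (C2 + 1))"
      have "dist (tangent_flow t x h) (tangent_flow t x0 h) < e" if x: "dist x x0 < \<delta>" for x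
      proof -
        have xc: "x \<in> cball x0 \<delta>1" "x \<in> cball x0 \<delta>2" "x0 \<in> cball x0 \<delta>2"
          using x \<delta>2 by (auto simp: \<delta>_def dist_commute)
        have "norm (tangent_flow t x h - tangent_flow t x0 h) \<le> E * (norm (tangent_flow 0 x h - tangent_flow 0 x0 h) + e1 * (C * norm h))"
        proof (rule E(2)[where y' = "\<lambda>s. V' (\<phi> s x) (tangent_flow s x h) - V' (\<phi> s x0) (tangent_flow s x0 h)"
             and y = "\<lambda>s. tangent_flow s x h - tangent_flow s x0 h"])
          fix s assume s: "s \<in> ?T"
          have "norm (\<phi> s x - \<phi> s x0) \<le> C2 * norm (x - x0)" by (rule T(2)[OF xc(2) s])
          also have "\<dots> \<le> (C2 + 1) * norm (x - x0)" by (simp add: algebra_simps)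
          also have "\<dots> < d" using x \<delta>2 by (simp add: pos_less_divide_eq mult.commute \<delta>_def dist_norm)
          finally have "norm (V' (\<phi> s x) - V' (\<phi> s x0)) \<le> e1"
            using d(2)[OF T(1)[OF xc(3) s] T(1)[OF xc(2) s]] by (simp add: dist_norm)
          then have "norm (V' (\<phi> s x) - V' (\<phi> s x0)) * norm (tangent_flow s x h) \<le> e1 * (C * norm h)"
            using \<delta>1(3)[OF xc(1) s] e1 by (intro mult_mono) auto
          with norm_blinfun[of "V' (\<phi> s x) - V' (\<phi> s x0)" "tangent_flow s x h"]
          have "norm ((V' (\<phi> s x) - V' (\<phi> s x0)) (tangent_flow s x h)) \<le> e1 * (C * norm h)" by linarith
          then show "norm (V' (\<phi> s x) (tangent_flow s x h) - V' (\<phi> s x0) (tangent_flow s x0 h)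
             - V' (\<phi> s x0) (tangent_flow s x h - tangent_flow s x0 h)) \<le> e1 * (C * norm h)"
            by (simp add: blinfun.diff_right blinfun.diff_left)
        qed (use e1 \<delta>1 in \<open>auto intro!: has_vector_derivative_diff tangent_flow_deriv\<close>)
        also have "\<dots> \<le> E * (e1 * (C * norm h + 1))" using E e1 by simp
        also have "\<dots> = e / 2" using E p by (simp add: e1_def)
        also have "\<dots> < e" using \<open>e > 0\<close> by simp
        finally show ?thesis by (simp add: dist_norm)
      qed
      moreover have "\<delta> > 0" using \<delta>1 \<delta>2 d by (simp add: \<delta>_def)
      ultimately show "\<exists>\<delta>>0. \<forall>x. dist x x0 < \<delta> \<longrightarrow> dist (tangent_flow t x h) (tangent_flow t x0 h) < e" by blast
    qed
  qed
  then show ?thesis by (intro continuous_at_imp_continuous_on) auto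
qed

text \<open>Differentiate \<open>\<phi> t (\<phi> s x) = \<phi> s (\<phi> t x)\<close> in \<open>s\<close> at \<open>0\<close>.\<close>

lemma tangent_flow_field: "tangent_flow t x (V x) = V (\<phi> t x)"
proof -
  have "((\<phi> t \<circ> (\<lambda>s. \<phi> s x)) has_vector_derivative tangent_flow t (\<phi> 0 x) (V (\<phi> 0 x))) (at 0)"
    using vector_derivative_diff_chain_within[of "\<lambda>s. \<phi> s x" "V (\<phi> 0 x)" 0 UNIV "\<phi> t" "tangent_flow t (\<phi> 0 x)"]
      flow_deriv[of x 0] flow_has_derivative[of t "\<phi> 0 x"] by (auto intro: has_derivative_at_withinI)
  moreover have "\<phi> t \<circ> (\<lambda>s. \<phi> s x) = (\<lambda>s. \<phi> s (\<phi> t x))" by (auto simp: flow_add add.commute)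
  ultimately have "((\<lambda>s. \<phi> s (\<phi> t x)) has_vector_derivative tangent_flow t x (V x)) (at 0)" by simp
  from vector_derivative_unique_at[OF this flow_deriv] show ?thesis by simp
qed

end

section \<open>Twice differentiable dependence on initial values\<close>

text \<open>In finite dimension, continuity of the derivative in each basis direction, which is what
  \<open>Ck_on\<close> provides, is continuity in operator norm.\<close>

lemma Ck_on_Suc_0_C1:
  fixes f :: "'a::euclidean_space \<Rightarrow> 'b::euclidean_space"
  assumes "Ck_on (Suc 0) UNIV f"
  shows "\<exists>f'. (\<forall>x. (f has_derivative blinfun_apply (f' x)) (at x)) \<and> continuous_on UNIV f' \<and>
    (\<forall>x. blinfun_apply (f' x) = frechet_derivative f (at x))"
proof -
  define f' where "f' x = Blinfun (frechet_derivative f (at x))" for x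
  have d: "(f has_derivative frechet_derivative f (at x)) (at x)" for x
    using assms frechet_derivative_works[of f "at x"] by (simp add: differentiable_on_def)
  then have eq: "blinfun_apply (f' x) = frechet_derivative f (at x)" for x
    unfolding f'_def by (intro bounded_linear_Blinfun_apply has_derivative_bounded_linear)
  moreover have "continuous_on UNIV f'"
    using assms by (intro continuous_on_blinfun_componentwise) (simp add: eq)
  ultimately show ?thesis using d by (intro exI[of _ f']) simp
qed

lemma Ck_on_frechet_derivative:
  "Ck_on (Suc k) S f \<Longrightarrow> i \<in> Basis \<Longrightarrow> Ck_on k S (\<lambda>x. frechet_derivative f (at x within S) i)"
  by simp

lemma blinfun_apply_Basis_sum:
  "blinfun_apply (f :: 'a::euclidean_space \<Rightarrow>\<^sub>L 'b::real_normed_vector) h = (\<Sum>i\<in>Basis. (h \<bullet> i) *\<^sub>R blinfun_apply f i)"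
proof -
  have "f h = f (\<Sum>i\<in>Basis. (h \<bullet> i) *\<^sub>R i)" by (simp add: euclidean_representation)
  then show ?thesis by (simp only: blinfun.sum_right blinfun.scaleR_right)
qed

context C1_flow
begin

text \<open>Expanding \<open>V' x h\<close> in the coordinates of \<open>h\<close> writes the
  tangent field as a finite sum of products. Its derivative in \<open>(x, h)\<close> then involves
  only derivatives of \<open>\<lambda>x. V' x i\<close> for basis vectors \<open>i\<close>, the form
  in which second order smoothness is available.\<close>

lemma tangent_C1_flow:
  assumes D: "\<And>i x. i \<in> Basis \<Longrightarrow> ((\<lambda>x. V' x i) has_derivative blinfun_apply (D i x)) (at x)"
    and D_cont: "\<And>i. i \<in> Basis \<Longrightarrow> continuous_on UNIV (D i)"
  shows "\<exists>TV'. C1_flow (\<lambda>(x, h). (V x, V' x h)) TV' (\<lambda>t (x, h). (\<phi> t x, tangent_flow t x h))"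
proof -
  let ?TV = "\<lambda>(x, h). (V x, blinfun_apply (V' x) h)"
  define L where "L p q = (V' (fst p) (fst q),
     \<Sum>i\<in>Basis. (snd p \<bullet> i) *\<^sub>R D i (fst p) (fst q) + (snd q \<bullet> i) *\<^sub>R V' (fst p) i)" for p q :: "'a \<times> 'a"
  have TV: "?TV = (\<lambda>p. (V (fst p), \<Sum>i\<in>Basis. (snd p \<bullet> i) *\<^sub>R V' (fst p) i))"
    unfolding fun_eq_iff split_beta using blinfun_apply_Basis_sum by metis
  have der: "(?TV has_derivative L p) (at p)" for p
  proof -
    have fst: "(fst has_derivative fst) (at p)" and snd: "(snd has_derivative snd) (at p)"
      by (rule bounded_linear_imp_has_derivative bounded_linear_fst bounded_linear_snd)+
    have 1: "((\<lambda>p. V (fst p)) has_derivative (\<lambda>q. V' (fst p) (fst q))) (at p)"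
      by (rule has_derivative_compose[OF fst V_deriv])
    have 2: "((\<lambda>p. V' (fst p) i) has_derivative (\<lambda>q. D i (fst p) (fst q))) (at p)" if "i \<in> Basis" for i
      by (rule has_derivative_compose[OF fst D[OF that]])
    have 3: "((\<lambda>p. snd p \<bullet> i) has_derivative (\<lambda>q. snd q \<bullet> i)) (at p)" for i
      by (rule has_derivative_inner_left[OF snd])
    show ?thesis unfolding TV L_def
      by (rule has_derivative_Pair[OF 1 has_derivative_sum[OF has_derivative_scaleR[OF 3 2]]])
  qed
  define TV' where "TV' p = Blinfun (L p)" for p
  have eq: "blinfun_apply (TV' p) = L p" for p
    unfolding TV'_def by (intro bounded_linear_Blinfun_apply has_derivative_bounded_linear[OF der])
  have cont: "continuous_on UNIV TV'"
  proof (rule continuous_on_blinfun_componentwise)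
    fix b :: "'a \<times> 'a"
    have c: "continuous_on UNIV (\<lambda>p::'a\<times>'a. V' (fst p))" "i \<in> Basis \<Longrightarrow> continuous_on UNIV (\<lambda>p::'a\<times>'a. D i (fst p))" for i
      by (auto intro!: continuous_on_compose2[OF V'_cont] continuous_on_compose2[OF D_cont] continuous_intros)
    show "continuous_on UNIV (\<lambda>x. blinfun_apply (TV' x) b)"
      unfolding eq L_def by (intro continuous_intros c)
  qed
  have "is_flow ?TV (\<lambda>t (x, h). (\<phi> t x, tangent_flow t x h))"
    unfolding is_flow_def
  proof (intro allI conjI)
    fix p :: "'a \<times> 'a" and t
    show "(\<lambda>(x, h). (\<phi> 0 x, tangent_flow 0 x h)) p = p" by (cases p) simp
    have "((\<lambda>s. (\<phi> s (fst p), tangent_flow s (fst p) (snd p))) has_vector_derivative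
       (V (\<phi> t (fst p)), V' (\<phi> t (fst p)) (tangent_flow t (fst p) (snd p)))) (at t)"
      by (intro has_vector_derivative_Pair flow_deriv tangent_flow_deriv)
    then show "((\<lambda>s. (\<lambda>(x, h). (\<phi> s x, tangent_flow s x h)) p) has_vector_derivative
       ?TV ((\<lambda>(x, h). (\<phi> t x, tangent_flow t x h)) p)) (at t)"
      by (cases p) simp
  qed
  then have "C1_flow ?TV TV' (\<lambda>t (x, h). (\<phi> t x, tangent_flow t x h))"
    by (intro C1_flow.intro cont) (simp_all only: eq der)
  then show ?thesis by blast
qed

end

text \<open>Second order regularity in the form the heat equation uses: each column of the
  derivative of the flow is differentiable, and its derivative is continuous in every fixed
  direction.\<close>

locale C2_flow = C1_flow +
  assumes tangent_flow_C1: "\<And>t i. \<exists>W. \<forall>x. ((\<lambda>x. tangent_flow t x i) has_derivative W x) (at x) \<and> (\<forall>k. continuous_on UNIV (\<lambda>x. W x k))"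

lemma smooth_field_C2_flow:
  assumes V: "smooth_on UNIV V" and flow: "is_flow V \<phi>"
  shows "\<exists>V'. C2_flow V V' \<phi>"
proof -
  have "Ck_on (Suc 0) UNIV V" using V unfolding smooth_on_def by blast
  then obtain V' where V': "\<And>x. (V has_derivative blinfun_apply (V' x)) (at x)" "continuous_on UNIV V'"
    "\<And>x. blinfun_apply (V' x) = frechet_derivative V (at x)"
    using Ck_on_Suc_0_C1 by blast
  interpret C1_flow V V' \<phi> by unfold_locales (use V' flow in auto)
  have "Ck_on (Suc 0) UNIV (\<lambda>x. V' x i)" if "i \<in> Basis" for i
  proof -
    have "Ck_on (Suc (Suc 0)) UNIV V" using V unfolding smooth_on_def by blast
    from Ck_on_frechet_derivative[OF this that] show ?thesis by (simp only: V'(3))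
  qed
  then have "\<forall>i\<in>Basis. \<exists>D. (\<forall>x. ((\<lambda>x. V' x i) has_derivative blinfun_apply (D x)) (at x)) \<and> continuous_on UNIV D"
    using Ck_on_Suc_0_C1 by blast
  then obtain D where D: "\<forall>i\<in>Basis. (\<forall>x. ((\<lambda>x. V' x i) has_derivative blinfun_apply (D i x)) (at x)) \<and> continuous_on UNIV (D i)"
    by (rule bchoice[THEN exE])
  obtain TV' where "C1_flow (\<lambda>(x, h). (V x, V' x h)) TV' (\<lambda>t (x, h). (\<phi> t x, tangent_flow t x h))"
    using tangent_C1_flow[of D] D by blast
  then interpret T: C1_flow "\<lambda>(x, h). (V x, V' x h)" TV' "\<lambda>t (x, h). (\<phi> t x, tangent_flow t x h)" .
  have "C2_flow V V' \<phi>"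
  proof
    fix t i
    \<comment> \<open>\<open>tangent_flow t x i\<close> is the second component of the flow of the
      tangent field at \<open>(x, i)\<close>; increments \<open>(k, 0)\<close> move the base point
      and keep the direction \<open>i\<close> fixed.\<close>
    have "((\<lambda>x. tangent_flow t x i) has_derivative (\<lambda>k. snd (T.tangent_flow t (x, i) (k, 0)))) (at x)" for x
    proof -
      have "((\<lambda>x. (x, i)) has_derivative (\<lambda>k. (k, 0))) (at x)"
        by (intro has_derivative_Pair has_derivative_ident has_derivative_const)
      from has_derivative_snd[OF has_derivative_compose[OF this T.flow_has_derivative[of t "(x, i)"]]]
      show ?thesis by simp
    qed
    moreover have "continuous_on UNIV (\<lambda>x. snd (T.tangent_flow t (x, i) (k, 0)))" for k
      by (intro continuous_on_snd continuous_on_compose2[OF T.tangent_flow_continuous[of UNIV t "(k, 0)"]] continuous_intros) auto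
    ultimately show "\<exists>W. \<forall>x. ((\<lambda>x. tangent_flow t x i) has_derivative W x) (at x) \<and> (\<forall>k. continuous_on UNIV (\<lambda>x. W x k))"
      by (intro exI[of _ "\<lambda>x k. snd (T.tangent_flow t (x, i) (k, 0))"]) simp
  qed
  then show ?thesis by blast
qed

section \<open>Integrals of compactly supported functions\<close>

lemma compact_continuous_norm_bound:
  assumes "compact S" "continuous_on S f"
  obtains B where "\<And>x. x \<in> S \<Longrightarrow> norm (f x) \<le> B"
  using compact_imp_bounded[OF compact_continuous_image[OF assms(2,1)]] by (auto simp: bounded_iff)

lemma integrable_continuous_bounded_support:
  fixes F :: "'a::euclidean_space \<Rightarrow> real"
  assumes "continuous_on UNIV F" "\<And>y. y \<notin> cball 0 R \<Longrightarrow> F y = 0"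
  shows "integrable lborel F"
proof -
  have "integrable lborel (\<lambda>x. indicator (cball 0 R) x *\<^sub>R F x)"
    by (intro borel_integrable_compact continuous_on_subset[OF assms(1)]) auto
  also have "(\<lambda>x. indicator (cball 0 R) x *\<^sub>R F x) = F"
    using assms(2) by (auto simp: indicator_def fun_eq_iff)
  finally show ?thesis .
qed

text \<open>Bridge between two integrals: differentiation under the integral sign is carried out
  over a box, translation invariance and dominated convergence over the whole space.\<close>

lemma integral_cbox_bounded_support:
  fixes F :: "'a::euclidean_space \<Rightarrow> real"
  assumes "continuous_on UNIV F" "\<And>y. y \<notin> cball 0 R \<Longrightarrow> F y = 0" "cball 0 R \<subseteq> cbox a b"
  shows "integral (cbox a b) F = integral\<^sup>L lborel F"
proof -
  have "(F has_integral (integral\<^sup>L lborel F)) UNIV"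
    by (intro has_integral_integral_lborel integrable_continuous_bounded_support[OF assms(1,2)])
  moreover have "F = (\<lambda>x. if x \<in> cbox a b then F x else 0)"
  proof
    show "F x = (if x \<in> cbox a b then F x else 0)" for x
    proof (cases "x \<in> cball 0 R")
      case True
      with assms(3) have "x \<in> cbox a b" by (rule subsetD)
      then show ?thesis by (simp only: if_True)
    next
      case False
      then have "F x = 0" by (rule assms(2))
      then show ?thesis by (simp only: if_cancel)
    qed
  qed
  ultimately have "((\<lambda>x. if x \<in> cbox a b then F x else 0) has_integral (integral\<^sup>L lborel F)) UNIV"
    by (simp only:)
  then show ?thesis by (simp only: has_integral_restrict_UNIV integral_unique)
qed

lemma eventually_line_in_open:
  fixes y :: "'a::real_normed_vector"
  assumes "open S" "y \<in> S"
  shows "\<forall>\<^sub>F r in nhds (0::real). y + r *\<^sub>R i \<in> S"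
proof -
  have "((\<lambda>r::real. y + r *\<^sub>R i) \<longlongrightarrow> y + 0 *\<^sub>R i) (nhds 0)"
    by (intro tendsto_intros filterlim_ident)
  then show ?thesis using assms by (intro topological_tendstoD) auto
qed

lemma has_derivative_directional:
  fixes f :: "'a::real_normed_vector \<Rightarrow> real"
  assumes "(f has_derivative f') (at y)"
  shows "((\<lambda>r. f (y + r *\<^sub>R i)) has_real_derivative f' i) (at 0)"
proof -
  have "((\<lambda>r. y + r *\<^sub>R i) has_derivative (\<lambda>r. r *\<^sub>R i)) (at (0::real))"
    by (auto intro!: derivative_eq_intros)
  moreover have "(f has_derivative f') (at (y + 0 *\<^sub>R i))" using assms by simp
  ultimately have "((\<lambda>r. f (y + r *\<^sub>R i)) has_derivative (\<lambda>r. f' (r *\<^sub>R i))) (at 0)"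
    by (rule has_derivative_compose)
  also have "(\<lambda>r. f' (r *\<^sub>R i)) = (*) (f' i)"
    using linear_cmul[OF has_derivative_linear[OF assms]] by (simp add: fun_eq_iff)
  finally show ?thesis by (simp add: has_field_derivative_def)
qed

lemma directional_derivative_along:
  fixes F :: "'a::real_normed_vector \<Rightarrow> real"
  assumes "\<And>y. ((\<lambda>r. F (y + r *\<^sub>R i)) has_real_derivative F' y) (at 0)"
  shows "((\<lambda>r. F (y + r *\<^sub>R i)) has_real_derivative F' (y + s *\<^sub>R i)) (at s)"
proof -
  have "((\<lambda>r. F ((y + s *\<^sub>R i) + (r - s) *\<^sub>R i)) has_real_derivative F' (y + s *\<^sub>R i) * 1) (at s)"
  proof (rule DERIV_chain2[where g = "\<lambda>r. r - s"])
    show "((\<lambda>r. F (y + s *\<^sub>R i + r *\<^sub>R i)) has_real_derivative F' (y + s *\<^sub>R i)) (at (s - s))"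
      using assms by simp
  qed (auto intro!: derivative_eq_intros)
  moreover have "F ((y + s *\<^sub>R i) + (r - s) *\<^sub>R i) = F (y + r *\<^sub>R i)" for r
    by (simp add: algebra_simps)
  ultimately show ?thesis by simp
qed

text \<open>The inner \<open>deriv\<close> has to be identified on a neighbourhood of 0 before the
  outer one can be evaluated; openness of \<open>S\<close> keeps short segments through
  \<open>y\<close> inside.\<close>

lemma laplacian_eq:
  assumes "open S" "y \<in> S"
    and T1: "\<And>i y. y \<in> S \<Longrightarrow> ((\<lambda>r. f (y + r *\<^sub>R i)) has_real_derivative T1 i y) (at 0)"
    and T2: "\<And>i y. y \<in> S \<Longrightarrow> ((\<lambda>r. T1 i (y + r *\<^sub>R i)) has_real_derivative T2 i y) (at 0)"
  shows "laplacian f (y :: 'a::euclidean_space) = (\<Sum>i\<in>Basis. T2 i y)"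
  unfolding laplacian_def
proof (rule sum.cong[OF refl])
  fix i :: 'a
  have "\<forall>\<^sub>F s in nhds 0. deriv (\<lambda>r. f (y + r *\<^sub>R i)) s = T1 i (y + s *\<^sub>R i)"
    using eventually_line_in_open[OF assms(1,2), of i]
  proof eventually_elim
    case (elim s)
    have "((\<lambda>r. f ((y + s *\<^sub>R i) + r *\<^sub>R i)) has_real_derivative T1 i (y + s *\<^sub>R i)) (at (s - s))"
      using T1[OF elim] by simp
    moreover have "((\<lambda>r. r - s) has_real_derivative 1) (at s)" by (auto intro!: derivative_eq_intros)
    ultimately have "((\<lambda>r. f ((y + s *\<^sub>R i) + (r - s) *\<^sub>R i)) has_real_derivative T1 i (y + s *\<^sub>R i) * 1) (at s)"
      by (rule DERIV_chain2)
    then have "((\<lambda>r. f (y + r *\<^sub>R i)) has_real_derivative T1 i (y + s *\<^sub>R i)) (at s)"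
      by (simp add: algebra_simps)
    then show ?case by (rule DERIV_imp_deriv)
  qed
  then have "deriv (deriv (\<lambda>r. f (y + r *\<^sub>R i))) 0 = deriv (\<lambda>s. T1 i (y + s *\<^sub>R i)) 0"
    by (rule deriv_cong_ev) simp
  also have "\<dots> = T2 i y" by (rule DERIV_imp_deriv[OF T2[OF assms(2)]])
  finally show "(deriv ^^ 2) (\<lambda>r. f (y + r *\<^sub>R i)) 0 = T2 i y" by (simp add: numeral_2_eq_2)
qed

text \<open>The integrals of the difference quotients vanish by translation invariance.\<close>

lemma integral_directional_derivative:
  fixes F F' :: "'a::euclidean_space \<Rightarrow> real"
  assumes der: "\<And>y. ((\<lambda>r. F (y + r *\<^sub>R i)) has_real_derivative F' y) (at 0)"
    and F: "continuous_on UNIV F" and F': "continuous_on UNIV F'"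
    and supp: "\<And>y. y \<notin> cball 0 R \<Longrightarrow> F y = 0"
  shows "integral\<^sup>L lborel F' = 0" "\<And>y. y \<notin> cball 0 R \<Longrightarrow> F' y = 0"
proof -
  show F'0: "F' y = 0" if "y \<notin> cball 0 R" for y
  proof -
    have "\<forall>\<^sub>F r in nhds 0. y + r *\<^sub>R i \<in> - cball 0 R"
      using that by (intro eventually_line_in_open open_Compl closed_cball) auto
    then have "\<forall>\<^sub>F r in nhds 0. F (y + r *\<^sub>R i) = 0" by eventually_elim (use supp in auto)
    with der[of y] have "((\<lambda>r. 0) has_real_derivative F' y) (at 0)"
      by (subst DERIV_cong_ev[OF refl _ refl, symmetric]) auto
    then show ?thesis using DERIV_unique DERIV_const by blast
  qed
  obtain B0 where B0: "\<And>x. x \<in> cball 0 R \<Longrightarrow> norm (F' x) \<le> B0"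
    using compact_continuous_norm_bound[OF compact_cball continuous_on_subset[OF F' subset_UNIV]] by metis
  define B where "B = max B0 0"
  have B: "\<bar>F' x\<bar> \<le> B" for x using B0[of x] F'0[of x] by (cases "x \<in> cball 0 R") (auto simp: B_def)
  define q where "q n y = real (Suc n) * (F (y + inverse (real (Suc n)) *\<^sub>R i) - F y)" for n y
  \<comment> \<open>The steps have length at most \<open>norm i\<close>, so every quotient is
    supported in the ball enlarged by \<open>norm i\<close>. The mean value theorem bounds it by the
    supremum of \<open>F'\<close>, which gives an integrable majorant.\<close>
  have q_bound: "\<bar>q n y\<bar> \<le> B * indicator (cball 0 (R + norm i)) y" for n y
  proof (cases "y \<in> cball 0 (R + norm i)")
    case True
    let ?r = "inverse (real (Suc n))"
    have "\<bar>F (y + ?r *\<^sub>R i) - F (y + 0 *\<^sub>R i)\<bar> \<le> B * \<bar>?r - 0\<bar>"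
      using field_differentiable_bound[of UNIV "\<lambda>r. F (y + r *\<^sub>R i)" "\<lambda>s. F' (y + s *\<^sub>R i)" B ?r 0]
        directional_derivative_along[OF der] B by (auto simp del: of_nat_Suc)
    then have "real (Suc n) * \<bar>F (y + ?r *\<^sub>R i) - F y\<bar> \<le> real (Suc n) * (B * ?r)"
      by (intro mult_left_mono) auto
    also have "\<dots> = B" by (simp del: of_nat_Suc)
    finally show ?thesis using True by (simp add: q_def abs_mult del: of_nat_Suc)
  next
    case False
    let ?k = "inverse (real (Suc n)) *\<^sub>R i"
    have "norm ?k \<le> norm i"
      by (simp add: mult_left_le_one_le inverse_le_1_iff)
    moreover have "norm y - norm ?k \<le> norm (y + ?k)" by (rule norm_diff_ineq)
    moreover have "R + norm i < norm y" using False by simp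
    ultimately have "R < norm (y + ?k)" "R < norm y" using norm_ge_zero[of i] by linarith+
    then have "y + ?k \<notin> cball 0 R" "y \<notin> cball 0 R" by (simp_all only: mem_cball_0 not_le)
    then show ?thesis using False supp by (simp add: q_def del: of_nat_Suc)
  qed
  have intF: "integrable lborel F" by (rule integrable_continuous_bounded_support[OF F supp])
  have shift: "integrable lborel (\<lambda>y. F (y + c))" "(\<integral>y. F (y + c) \<partial>lborel) = integral\<^sup>L lborel F" for c
  proof -
    have m: "F \<in> borel_measurable borel" using F by (rule borel_measurable_continuous_onI)
    have "integrable (distr lborel borel ((+) c)) F" using intF by (simp add: lborel_distr_plus)
    then show "integrable lborel (\<lambda>y. F (y + c))"
      using m by (subst (asm) integrable_distr_eq) (auto simp: add.commute)
    have "integral\<^sup>L (distr lborel borel ((+) c)) F = (\<integral>y. F (y + c) \<partial>lborel)"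
      using m by (subst integral_distr) (auto simp: add.commute)
    then show "(\<integral>y. F (y + c) \<partial>lborel) = integral\<^sup>L lborel F" by (simp add: lborel_distr_plus)
  qed
  have q0: "integral\<^sup>L lborel (q n) = 0" for n
    unfolding q_def using shift[of "inverse (real (Suc n)) *\<^sub>R i"] intF by (simp del: of_nat_Suc)
  have "(\<lambda>n. integral\<^sup>L lborel (q n)) \<longlonglongrightarrow> integral\<^sup>L lborel F'"
  proof (rule integral_dominated_convergence[where w = "\<lambda>y. B * indicator (cball 0 (R + norm i)) y"])
    show "F' \<in> borel_measurable lborel" using borel_measurable_continuous_onI[OF F'] by simp
    show "q n \<in> borel_measurable lborel" for n
    proof -
      have "continuous_on UNIV (q n)"
        unfolding q_def by (intro continuous_intros continuous_on_compose2[OF F]) auto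
      then show ?thesis using borel_measurable_continuous_onI by simp
    qed
    show "integrable lborel (\<lambda>y. B * indicator (cball 0 (R + norm i)) y)"
      by (rule integrable_mult_right, rule integrable_real_indicator, simp, rule emeasure_lborel_cball_finite)
    show "AE y in lborel. (\<lambda>n. q n y) \<longlonglongrightarrow> F' y"
    proof (rule AE_I2)
      fix y
      have "((\<lambda>r. (F (y + (0 + r) *\<^sub>R i) - F (y + 0 *\<^sub>R i)) / r) \<longlongrightarrow> F' y) (at 0)"
        using der[of y] unfolding DERIV_def .
      moreover have "filterlim (\<lambda>n. inverse (real (Suc n))) (at 0) sequentially"
        unfolding filterlim_at using LIMSEQ_inverse_real_of_nat by auto
      ultimately have "((\<lambda>n. (F (y + (0 + inverse (real (Suc n))) *\<^sub>R i) - F (y + 0 *\<^sub>R i)) / inverse (real (Suc n))) \<longlongrightarrow> F' y) sequentially"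
        by (rule filterlim_compose)
      then show "(\<lambda>n. q n y) \<longlonglongrightarrow> F' y"
        by (simp add: q_def divide_inverse mult.commute del: of_nat_Suc)
    qed
    show "AE y in lborel. norm (q n y) \<le> B * indicator (cball 0 (R + norm i)) y" for n
      using q_bound by simp
  qed
  then show "integral\<^sup>L lborel F' = 0" by (simp add: q0 LIMSEQ_const_iff)
qed


section \<open>Volume distortion of the flow\<close>

lemma (in C1_flow) flow_cball_bounded:
  "\<exists>R'. \<forall>s\<in>{0..\<tau>}. \<forall>x\<in>cball 0 R. \<phi> s x \<in> cball 0 R'"
proof -
  obtain R' where "\<And>p. p \<in> {0..\<tau>} \<times> cball 0 R \<Longrightarrow> norm ((\<lambda>(s, x). \<phi> s x) p) \<le> R'"
    by (rule compact_continuous_norm_bound[OF compact_Times[OF compact_Icc compact_cball] flow_continuous]) blast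
  then show ?thesis by (intro exI[of _ R']) force
qed

lemma (in C1_flow) flow_backward_continuous: "continuous_on S (\<lambda>(r, y). \<phi> (- r) y)"
proof -
  have "continuous_on S (\<lambda>p. (\<lambda>(t, x). \<phi> t x) (- fst p, snd p))"
    by (intro continuous_on_compose2[OF flow_continuous[of UNIV]] continuous_intros) auto
  then show ?thesis by (simp add: split_beta)
qed

lemma (in C1_flow) flow_backward_deriv:
  "((\<lambda>r. \<phi> (- r) y) has_vector_derivative - V (\<phi> (- r) y)) (at r)"
proof -
  have "(((\<lambda>s. \<phi> s y) \<circ> uminus) has_vector_derivative (-1) *\<^sub>R V (\<phi> (- r) y)) (at r)"
    by (intro vector_diff_chain_at flow_deriv) (auto intro!: derivative_eq_intros)
  then show ?thesis by (simp add: o_def)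
qed

lemma exponential_decay_comparison:
  fixes J :: "real \<Rightarrow> real"
  assumes J: "\<And>r. (J has_real_derivative J' r) (at r)"
    and le: "\<And>r. 0 \<le> r \<Longrightarrow> r \<le> s \<Longrightarrow> J' r \<le> B * J r" and "0 \<le> s"
  shows "J s \<le> exp (B * s) * J 0"
proof -
  define k where "k r = exp (- B * r) * J r" for r
  have k: "(k has_real_derivative exp (- B * r) * (J' r - B * J r)) (at r)" for r
  proof -
    have "(k has_real_derivative exp (- B * r) * J' r + (exp (- B * r) * (- B)) * J r) (at r)"
      unfolding k_def by (rule derivative_eq_intros J refl | simp)+
    then show ?thesis by (simp add: algebra_simps)
  qed
  have "k s \<le> k 0"
  proof (rule DERIV_nonpos_imp_nonincreasing[where f = k])
    show "\<exists>d. (k has_real_derivative d) (at r) \<and> d \<le> 0" if "0 \<le> r" "r \<le> s" for r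
      using k le[OF that] by (intro exI[of _ "exp (- B * r) * (J' r - B * J r)"]) (auto intro!: mult_nonneg_nonpos)
  qed fact
  then have "exp (B * s) * (exp (- B * s) * J s) \<le> exp (B * s) * J 0"
    by (intro mult_left_mono) (auto simp: k_def)
  then show ?thesis by (simp add: exp_minus mult.assoc[symmetric])
qed

text \<open>A bound for the Jacobian of the flow in integrated form. The function \<open>v r y = f (\<phi> (-r) y)\<close>
  solves the transport equation, so that the derivative of its integral is the integral of \<open>v div V\<close>.\<close>

lemma (in C1_flow) flow_push_forward_integral:
  "\<exists>B\<ge>0. \<forall>(f :: 'a \<Rightarrow> real) f'. (\<forall>x. (f has_derivative f' x) (at x)) \<longrightarrow> (\<forall>h. continuous_on UNIV (\<lambda>x. f' x h)) \<longrightarrow>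
     (\<forall>x. 0 \<le> f x) \<longrightarrow> (\<forall>x. x \<notin> cball 0 R \<longrightarrow> f x = 0) \<longrightarrow>
     (\<forall>s\<in>{0..1}. (\<integral>y. f (\<phi> (- s) y) \<partial>lborel) \<le> exp (B * s) * integral\<^sup>L lborel f)"
proof -
  \<comment> \<open>All functions \<open>f (\<phi> (- s) y)\<close> with \<open>s\<close> in
    \<open>{0..1}\<close> are supported in this ball, so one box and one bound of the divergence
    serve them all. The resulting \<open>B\<close> depends on \<open>R\<close> but not on
    \<open>f\<close>, and it will be applied to a different \<open>f\<close> for each
    \<open>s\<close>.\<close>
  obtain R' where R': "\<And>s x. s \<in> {0..1} \<Longrightarrow> x \<in> cball 0 R \<Longrightarrow> \<phi> s x \<in> cball 0 R'"
    using flow_cball_bounded by metis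
  obtain c d :: 'a where cd: "cball 0 R' \<subseteq> cbox c d"
    using bounded_subset_cbox_symmetric[OF bounded_cball] by metis
  \<comment> \<open>The divergence of \<open>V\<close>.\<close>
  define dv where "dv y = (\<Sum>i\<in>Basis. V' y i \<bullet> i)" for y
  have dv_cont: "continuous_on S dv" for S
    unfolding dv_def by (intro continuous_intros continuous_on_subset[OF V'_cont]) auto
  obtain B0 where B0: "\<And>x. x \<in> cball 0 R' \<Longrightarrow> norm (dv x) \<le> B0"
    using compact_continuous_norm_bound[OF compact_cball dv_cont] by metis
  define B where "B = max B0 0"
  have B: "B \<ge> 0" "\<And>x. x \<in> cball 0 R' \<Longrightarrow> dv x \<le> B" using B0 by (auto simp: B_def abs_le_iff le_max_iff_disj)
  have "(\<integral>y. f (\<phi> (- s) y) \<partial>lborel) \<le> exp (B * s) * integral\<^sup>L lborel f"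
    if f: "\<forall>x. (f has_derivative f' x) (at x)" and f': "\<forall>h. continuous_on UNIV (\<lambda>x. f' x h)"
      and f0: "\<forall>x. 0 \<le> f x" and supp: "\<forall>x. x \<notin> cball 0 R \<longrightarrow> f x = 0" and s: "s \<in> {0..1}"
    for f :: "'a \<Rightarrow> real" and f' s
  proof -
    have f_cont: "continuous_on S f" for S
      using f by (meson continuous_at_imp_continuous_on has_derivative_continuous)
    have lin: "linear (f' x)" for x using f has_derivative_linear by blast
    have f'_sum: "f' x h = (\<Sum>i\<in>Basis. (h \<bullet> i) * f' x i)" for x h
      using linear_sum[OF lin, of x "\<lambda>i. (h \<bullet> i) *\<^sub>R i" Basis] lin[THEN linear_cmul]
      by (simp add: euclidean_representation)
    \<comment> \<open>Composed with \<open>\<phi> (- r)\<close>, this is the time derivative of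
      \<open>f (\<phi> (- r) y)\<close>.\<close>
    define dr where "dr x = - f' x (V x)" for x
    have dr_cont: "continuous_on UNIV dr"
      unfolding dr_def by (subst f'_sum) (intro continuous_intros V_cont f'[rule_format])
    have v_cont: "continuous_on UNIV (\<lambda>y. f (\<phi> (- r) y))" for r
      using f_cont[of UNIV] flow_has_derivative[of "-r"]
      by (intro continuous_on_compose2[OF f_cont[of UNIV]])
        (auto intro!: continuous_at_imp_continuous_on has_derivative_continuous)
    have v_supp: "f (\<phi> (- r) y) = 0" if "r \<in> {0..1}" "y \<notin> cball 0 R'" for r y
      using supp[rule_format, of "\<phi> (- r) y"] R'[OF that(1), of "\<phi> (- r) y"] that by auto
    define J where "J r = integral (cbox c d) (\<lambda>y. f (\<phi> (- r) y))" for r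
    define J' where "J' r = integral (cbox c d) (\<lambda>y. dr (\<phi> (- r) y))" for r
    have J: "(J has_real_derivative J' r) (at r)" for r
      unfolding J_def J'_def
    proof (rule leibniz_rule_field_derivative[where U = UNIV])
      show "((\<lambda>r. f (\<phi> (- r) y)) has_real_derivative dr (\<phi> (- r) y)) (at r)" for r y
      proof -
        have "((f \<circ> (\<lambda>r. \<phi> (- r) y)) has_vector_derivative f' (\<phi> (- r) y) (- V (\<phi> (- r) y))) (at r)"
          by (rule vector_derivative_diff_chain_within[OF flow_backward_deriv has_derivative_at_withinI[OF f[rule_format]]])
        then show ?thesis
          by (simp add: o_def dr_def linear_neg[OF lin] has_real_derivative_iff_has_vector_derivative)
      qed
      show "(\<lambda>y. f (\<phi> (- r) y)) integrable_on cbox c d" for r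
        by (intro integrable_continuous continuous_on_subset[OF v_cont]) auto
      show "continuous_on (UNIV \<times> cbox c d) (\<lambda>(r, y). dr (\<phi> (- r) y))"
        using continuous_on_compose2[OF dr_cont flow_backward_continuous] by (simp add: split_beta)
    qed auto
    have "J' r \<le> B * J r" if r: "0 \<le> r" "r \<le> s" for r
    proof -
      have r1: "r \<in> {0..1}" using r s by auto
      let ?\<psi> = "\<phi> (- r)"
      define F where "F i y = f (?\<psi> y) * (V y \<bullet> i)" for i y
      define F' where "F' i y = f' (?\<psi> y) (tangent_flow (- r) y i) * (V y \<bullet> i) + f (?\<psi> y) * (V' y i \<bullet> i)" for i y
      have F: "((\<lambda>q. F i (y + q *\<^sub>R i)) has_real_derivative F' i y) (at 0)" for i y
      proof -
        have 1: "((\<lambda>q. f (?\<psi> (y + q *\<^sub>R i))) has_real_derivative f' (?\<psi> y) (tangent_flow (- r) y i)) (at 0)"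
          by (rule has_derivative_directional[OF has_derivative_compose[OF flow_has_derivative f[rule_format]]])
        have 2: "((\<lambda>q. V (y + q *\<^sub>R i) \<bullet> i) has_real_derivative V' y i \<bullet> i) (at 0)"
          by (rule has_derivative_directional[OF has_derivative_inner_left[OF V_deriv]])
        show ?thesis unfolding F_def F'_def using DERIV_mult[OF 1 2] by (simp add: algebra_simps)
      qed
      have \<psi>_cont: "continuous_on UNIV ?\<psi>"
        using flow_has_derivative by (auto intro!: continuous_at_imp_continuous_on has_derivative_continuous)
      have F'_cont: "continuous_on UNIV (F' i)" for i
      proof -
        have "continuous_on UNIV (\<lambda>y. f' (?\<psi> y) (tangent_flow (- r) y i))"
          by (subst f'_sum) (intro continuous_intros tangent_flow_continuous continuous_on_compose2[OF f'[rule_format] \<psi>_cont] subset_UNIV)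
        then show ?thesis unfolding F'_def
          by (intro continuous_intros V_cont v_cont V'_cont)
      qed
      have F_cont: "continuous_on UNIV (F i)" for i
        unfolding F_def by (intro continuous_intros v_cont V_cont)
      have F_supp: "F i y = 0" if "y \<notin> cball 0 R'" for i y using v_supp[OF r1 that] by (simp add: F_def)
      have D: "integral\<^sup>L lborel (F' i) = 0" "y \<notin> cball 0 R' \<Longrightarrow> F' i y = 0" for i y
        using integral_directional_derivative[where R = R', OF F F_cont F'_cont] F_supp by blast+
      \<comment> \<open>With \<open>v = f (\<phi> (- r) y)\<close> this is
        \<open>v_r = v div V - div (v V)\<close>. The identity \<open>tangent_flow_field\<close>
        moves \<open>V\<close> from the point \<open>\<phi> (- r) y\<close> back to
        \<open>y\<close>, turning the time derivative into \<open>- V \<bullet> grad v\<close>. The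
        divergence integrates to 0.\<close>
      have key: "dr (?\<psi> y) = f (?\<psi> y) * dv y - (\<Sum>i\<in>Basis. F' i y)" for y
      proof -
        have "dr (?\<psi> y) = - f' (?\<psi> y) (tangent_flow (- r) y (V y))" by (simp add: dr_def tangent_flow_field)
        also have "tangent_flow (- r) y (V y) = (\<Sum>i\<in>Basis. (V y \<bullet> i) *\<^sub>R tangent_flow (- r) y i)"
          using linear_sum[OF tangent_flow_linear, of "-r" y "\<lambda>i. (V y \<bullet> i) *\<^sub>R i" Basis] linear_cmul[OF tangent_flow_linear, of "-r" y]
          by (simp add: euclidean_representation)
        also have "f' (?\<psi> y) \<dots> = (\<Sum>i\<in>Basis. (V y \<bullet> i) * f' (?\<psi> y) (tangent_flow (- r) y i))"
          by (simp add: linear_sum[OF lin] linear_cmul[OF lin])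
        finally show ?thesis
          by (simp add: F'_def dv_def sum.distrib sum_distrib_left mult.commute)
      qed
      have vdv_cont: "continuous_on UNIV (\<lambda>y. f (?\<psi> y) * dv y)" by (intro continuous_intros v_cont dv_cont)
      have dr_cont': "continuous_on UNIV (\<lambda>y. dr (?\<psi> y))" by (rule continuous_on_compose2[OF dr_cont \<psi>_cont]) auto
      have intF': "integrable lborel (F' i)" for i
        using D(2) by (rule integrable_continuous_bounded_support[OF F'_cont])
      have intvdv: "integrable lborel (\<lambda>y. f (?\<psi> y) * dv y)"
        by (rule integrable_continuous_bounded_support[OF vdv_cont, of R']) (simp add: v_supp[OF r1])
      have intv: "integrable lborel (\<lambda>y. f (?\<psi> y))"
        by (rule integrable_continuous_bounded_support[OF v_cont, of R']) (rule v_supp[OF r1])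
      have "J' r = (\<integral>y. dr (?\<psi> y) \<partial>lborel)"
        unfolding J'_def
      proof (rule integral_cbox_bounded_support[OF dr_cont' _ cd])
        fix y :: 'a assume y: "y \<notin> cball 0 R'"
        have "f (?\<psi> y) = 0" by (rule v_supp[OF r1 y])
        moreover have "(\<Sum>i\<in>Basis. F' i y) = 0" by (intro sum.neutral ballI D(2) y)
        ultimately show "dr (?\<psi> y) = 0" unfolding key by simp
      qed
      also have "\<dots> = (\<integral>y. f (?\<psi> y) * dv y \<partial>lborel)"
        unfolding key using intvdv intF' D(1) by (simp add: Bochner_Integration.integral_diff Bochner_Integration.integral_sum)
      also have "\<dots> \<le> (\<integral>y. B * f (?\<psi> y) \<partial>lborel)"
      proof (rule integral_mono[OF intvdv])
        show "f (?\<psi> y) * dv y \<le> B * f (?\<psi> y)" for y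
          using B(2)[of y] f0[rule_format, of "?\<psi> y"] v_supp[OF r1, of y]
          by (cases "y \<in> cball 0 R'") (auto simp: mult.commute[of B] intro: mult_left_mono)
      qed (use intv in simp)
      also have "\<dots> = B * J r"
        unfolding J_def using integral_cbox_bounded_support[OF v_cont v_supp[OF r1] cd] by simp
      finally show ?thesis .
    qed
    from exponential_decay_comparison[OF J this] have "J s \<le> exp (B * s) * J 0" using s by auto
    then show ?thesis
      unfolding J_def using integral_cbox_bounded_support[OF v_cont v_supp[OF s] cd]
        integral_cbox_bounded_support[OF v_cont v_supp[of 0] cd] by simp
  qed
  with B(1) show ?thesis by blast
qed

section \<open>Smooth cut-offs of the positive part and their second derivatives\<close>

lemma DERIV_zero_extension:
  fixes h h' :: "real \<Rightarrow> real"
  assumes h: "\<And>s. (h has_real_derivative h' s) (at s)" and z: "h c = 0" "h' c = 0"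
  shows "((\<lambda>s. if s \<le> c then 0 else h s) has_real_derivative (if s \<le> c then 0 else h' s)) (at s)"
proof (cases s c rule: linorder_cases)
  case less
  have "\<forall>\<^sub>F x in nhds s. x < c" using less by (rule order_tendstoD[OF filterlim_ident])
  then have "\<forall>\<^sub>F x in nhds s. (if x \<le> c then 0 else h x) = 0" by eventually_elim simp
  then show ?thesis using less by (subst DERIV_cong_ev[OF refl _ refl]) auto
next
  case greater
  have "\<forall>\<^sub>F x in nhds s. x > c" using greater by (rule order_tendstoD[OF filterlim_ident])
  then have "\<forall>\<^sub>F x in nhds s. (if x \<le> c then 0 else h x) = h x" by eventually_elim simp
  then show ?thesis using greater h[of s] by (subst DERIV_cong_ev[OF refl _ refl]) auto
next
  case equal
  \<comment> \<open>At the junction the quotients of the extension are dominated by those of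
    \<open>h\<close>, which tend to \<open>h' c = 0\<close>.\<close>
  have "((\<lambda>r. (h (c + r) - h c) / r) \<longlongrightarrow> 0) (at 0)" using h[of c] z by (simp add: DERIV_def)
  then have "((\<lambda>r. \<bar>(h (c + r) - h c) / r\<bar>) \<longlongrightarrow> 0) (at 0)" by (rule tendsto_rabs_zero)
  then have "((\<lambda>r. ((if c + r \<le> c then 0 else h (c + r)) - 0) / r) \<longlongrightarrow> 0) (at 0)"
    by (rule Lim_null_comparison[rotated]) (auto simp: z intro!: always_eventually divide_nonneg_nonpos)
  then show ?thesis using equal by (simp add: DERIV_def)
qed

text \<open>The witness is \<open>g s = p - e arctan (p / e)\<close> with \<open>p = max (s - e) 0\<close>.\<close>

lemma smooth_positive_part:
  fixes e :: real
  assumes e: "e > 0"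
  obtains g g1 g2 :: "real \<Rightarrow> real" where
    "\<And>s. (g has_real_derivative g1 s) (at s)" "\<And>s. (g1 has_real_derivative g2 s) (at s)" "continuous_on UNIV g2"
    "\<And>s. s \<le> e \<Longrightarrow> g s = 0" "\<And>s. s \<le> e \<Longrightarrow> g1 s = 0" "\<And>s. s \<le> e \<Longrightarrow> g2 s = 0"
    "\<And>s. 0 \<le> g s" "\<And>s. 0 \<le> g1 s" "\<And>s. 0 \<le> g2 s" "\<And>s. g s \<le> max s 0" "\<And>s. s \<le> g s + 3 * e"
proof -
  define h where "h s = (s - e) - e * arctan ((s - e) / e)" for s
  define h1 where "h1 s = 1 - e\<^sup>2 / ((s - e)\<^sup>2 + e\<^sup>2)" for s
  define h2 where "h2 s = 2 * e\<^sup>2 * (s - e) / ((s - e)\<^sup>2 + e\<^sup>2)\<^sup>2" for s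
  have pos: "(s - e)\<^sup>2 + e\<^sup>2 > 0" for s using e by (simp add: add_nonneg_pos)
  have h: "(h has_real_derivative h1 s) (at s)" for s
  proof -
    have eq: "inverse (1 + ((s - e) / e)\<^sup>2) = e\<^sup>2 / ((s - e)\<^sup>2 + e\<^sup>2)"
      using e pos[of s] by (simp add: field_simps)
    have "(h has_real_derivative 1 - e * (inverse (1 + ((s - e) / e)\<^sup>2) * (1 / e))) (at s)"
    proof -
      have "((\<lambda>s. (s - e) / e) has_real_derivative 1 / e) (at s)"
        using e by (auto intro!: derivative_eq_intros)
      note 2 = DERIV_cmult[OF DERIV_chain2[OF DERIV_arctan this], of e]
      have "((\<lambda>s. s - e) has_real_derivative 1) (at s)" by (auto intro!: derivative_eq_intros)
      from DERIV_diff[OF this 2] show ?thesis unfolding h_def .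
    qed
    then show ?thesis unfolding h1_def eq using e by simp
  qed
  have h1: "(h1 has_real_derivative h2 s) (at s)" for s
    unfolding h1_def h2_def using pos[of s]
    by (auto intro!: derivative_eq_intros simp: power2_eq_square)
  define g where "g s = (if s \<le> e then 0 else h s)" for s
  define g1 where "g1 s = (if s \<le> e then 0 else h1 s)" for s
  define g2 where "g2 s = (if s \<le> e then 0 else h2 s)" for s
  have ge: "(g has_real_derivative g1 s) (at s)" "(g1 has_real_derivative g2 s) (at s)" for s
  proof -
    have z: "h e = 0" "h1 e = 0" "h2 e = 0" using e by (simp_all add: h_def h1_def h2_def)
    show "(g has_real_derivative g1 s) (at s)" "(g1 has_real_derivative g2 s) (at s)"
      unfolding g_def g1_def g2_def
      by (rule DERIV_zero_extension[OF h z(1,2)] DERIV_zero_extension[OF h1 z(2,3)])+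
  qed
  \<comment> \<open>Writing \<open>g2\<close> with \<open>max (s - e) 0\<close> makes its continuity
    across \<open>e\<close> evident.\<close>
  have "continuous_on UNIV (\<lambda>s. 2 * e\<^sup>2 * max (s - e) 0 / ((s - e)\<^sup>2 + e\<^sup>2)\<^sup>2)"
    using pos by (intro continuous_intros) (auto simp: less_imp_neq[symmetric])
  also have "(\<lambda>s. 2 * e\<^sup>2 * max (s - e) 0 / ((s - e)\<^sup>2 + e\<^sup>2)\<^sup>2) = g2"
    by (auto simp: g2_def h2_def fun_eq_iff max_def)
  finally have g2c: "continuous_on UNIV g2" .
  \<comment> \<open>The bound 2 comes from \<open>pi / 2 < 2\<close>. It yields the constant
    \<open>3 * e\<close> below: one \<open>e\<close> from the shift of the argument, two from the
    term \<open>e arctan\<close>.\<close>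
  have atan: "0 \<le> arctan x" "arctan x \<le> x" "arctan x \<le> 2" if "x \<ge> 0" for x
    using that arctan_le_self[of x] arctan_ubound[of x] pi_less_4 by (auto simp: zero_le_arctan_iff)
  show thesis
  proof (rule that[OF ge g2c])
    show "0 \<le> g1 s" for s using pos[of s] by (auto simp: g1_def h1_def divide_le_eq_1)
    show "0 \<le> g2 s" for s by (auto simp: g2_def h2_def)
    show "0 \<le> g s" for s
    proof (cases "s \<le> e")
      case False
      then have "e * arctan ((s - e) / e) \<le> e * ((s - e) / e)" using e by (intro mult_left_mono atan) auto
      then show ?thesis using False e by (simp add: g_def h_def)
    qed (simp add: g_def)
    show "g s \<le> max s 0" for s
    proof (cases "s \<le> e")
      case False
      then have "0 \<le> e * arctan ((s - e) / e)" using e by (intro mult_nonneg_nonneg atan) auto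
      then have "h s \<le> s" unfolding h_def using e by linarith
      then show ?thesis using False by (simp add: g_def)
    qed (simp add: g_def)
    show "s \<le> g s + 3 * e" for s
    proof (cases "s \<le> e")
      case False
      then have "e * arctan ((s - e) / e) \<le> e * 2" using e by (intro mult_left_mono atan) auto
      then show ?thesis using False e by (simp add: g_def h_def)
    qed (use e in \<open>simp add: g_def\<close>)
  qed (auto simp: g_def g1_def g2_def)
qed

text \<open>Meant for functions with a factor \<open>g1 (v y)\<close>: \<open>A\<close> is the open
  set where \<open>v\<close> is regular and \<open>B\<close> the open set where
  \<open>v < e\<close>, on which that factor vanishes.\<close>

lemma continuous_on_extend_zero:
  fixes q :: "'a::topological_space \<Rightarrow> 'b::real_normed_vector"
  assumes "open A" "open B" "continuous_on A q" "\<And>y. y \<in> A \<Longrightarrow> y \<in> B \<Longrightarrow> q y = 0"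
  shows "continuous_on (A \<union> B) (\<lambda>y. if y \<in> A then q y else 0)"
proof (rule continuous_on_open_Un[OF assms(1,2)])
  show "continuous_on A (\<lambda>y. if y \<in> A then q y else 0)"
    using assms(3) by (rule continuous_on_eq) simp
  show "continuous_on B (\<lambda>y. if y \<in> A then q y else 0)"
    using continuous_on_const[of B 0] by (rule continuous_on_eq) (use assms(4) in auto)
qed

text \<open>The case \<open>F = g1(v) \<partial>\<^sub>i v\<close> of \<open>integral_directional_derivative\<close>, for \<open>v\<close> that is regular only where it does not vanish.\<close>

lemma integral_cutoff_second_derivative:
  fixes v v1 v2 :: "'a::euclidean_space \<Rightarrow> real"
  assumes \<Omega>: "open \<Omega>" "\<Omega> \<subseteq> cball 0 R" and e: "e > 0"
    and v: "continuous_on UNIV v" "\<And>y. y \<notin> \<Omega> \<Longrightarrow> v y = 0"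
    and v1: "\<And>y. y \<in> \<Omega> \<Longrightarrow> ((\<lambda>r. v (y + r *\<^sub>R i)) has_real_derivative v1 y) (at 0)" "continuous_on \<Omega> v1"
    and v2: "\<And>y. y \<in> \<Omega> \<Longrightarrow> ((\<lambda>r. v1 (y + r *\<^sub>R i)) has_real_derivative v2 y) (at 0)" "continuous_on \<Omega> v2"
    and g: "\<And>s. (g1 has_real_derivative g2 s) (at s)" "continuous_on UNIV g2"
      "\<And>s. s \<le> e \<Longrightarrow> g1 s = 0" "\<And>s. s \<le> e \<Longrightarrow> g2 s = 0"
  defines "F' \<equiv> \<lambda>y. if y \<in> \<Omega> then g2 (v y) * (v1 y)\<^sup>2 + g1 (v y) * v2 y else 0"
  shows "continuous_on UNIV F'" "integral\<^sup>L lborel F' = 0" "\<And>y. y \<notin> cball 0 R \<Longrightarrow> F' y = 0"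
proof -
  \<comment> \<open>Since \<open>v\<close> vanishes off \<open>\<Omega>\<close>, the open sets
    \<open>\<Omega>\<close> and \<open>?B\<close> cover the space. Continuity and differentiability
    can thus be checked on each, without any regularity of \<open>v\<close> at the boundary.\<close>
  let ?B = "{y. v y < e}"
  have B: "open ?B" using v(1) by (intro open_Collect_less) auto
  have cover: "\<Omega> \<union> ?B = UNIV" using v(2) e by force
  have g1c: "continuous_on UNIV g1"
    using g(1) DERIV_isCont by (blast intro: continuous_at_imp_continuous_on)
  have vc: "continuous_on \<Omega> v" by (rule continuous_on_subset[OF v(1)]) simp
  have g1v: "continuous_on \<Omega> (\<lambda>y. g1 (v y))" "continuous_on \<Omega> (\<lambda>y. g2 (v y))"
    by (intro continuous_on_compose2[OF g1c vc] continuous_on_compose2[OF g(2) vc] subset_UNIV)+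
  have "continuous_on (\<Omega> \<union> ?B) F'"
    unfolding F'_def by (intro continuous_on_extend_zero \<Omega> B continuous_intros g1v v1 v2) (auto simp: g)
  then show F'c: "continuous_on UNIV F'" by (simp add: cover)
  define F where "F y = (if y \<in> \<Omega> then g1 (v y) * v1 y else 0)" for y
  have "continuous_on (\<Omega> \<union> ?B) F"
    unfolding F_def by (intro continuous_on_extend_zero \<Omega> B continuous_intros g1v v1) (auto simp: g)
  then have Fc: "continuous_on UNIV F" by (simp add: cover)
  have der: "((\<lambda>r. F (y + r *\<^sub>R i)) has_real_derivative F' y) (at 0)" for y
  proof (cases "y \<in> \<Omega>")
    case True
    have "((\<lambda>r. g1 (v (y + r *\<^sub>R i))) has_real_derivative g2 (v (y + 0 *\<^sub>R i)) * v1 y) (at 0)"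
      by (rule DERIV_chain2[OF g(1) v1(1)[OF True]])
    from DERIV_mult[OF this v2(1)[OF True]]
    have "((\<lambda>r. g1 (v (y + r *\<^sub>R i)) * v1 (y + r *\<^sub>R i)) has_real_derivative F' y) (at 0)"
      using True by (simp add: F'_def power2_eq_square algebra_simps)
    moreover have "\<forall>\<^sub>F r in nhds 0. F (y + r *\<^sub>R i) = g1 (v (y + r *\<^sub>R i)) * v1 (y + r *\<^sub>R i)"
      using eventually_line_in_open[OF \<Omega>(1) True, of i] by eventually_elim (simp add: F_def)
    ultimately show ?thesis by (subst DERIV_cong_ev[OF refl _ refl])
  next
    case False
    then have y: "y \<in> ?B" using cover by auto
    have "\<forall>\<^sub>F r in nhds 0. F (y + r *\<^sub>R i) = 0"
      using eventually_line_in_open[OF B y, of i] by eventually_elim (simp add: F_def g)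
    then show ?thesis using False by (subst DERIV_cong_ev[OF refl _ refl]) (auto simp: F'_def)
  qed
  have "F y = 0" if "y \<notin> cball 0 R" for y using that \<Omega> by (auto simp: F_def)
  from integral_directional_derivative[OF der Fc F'c this]
  show "integral\<^sup>L lborel F' = 0" "\<And>y. y \<notin> cball 0 R \<Longrightarrow> F' y = 0" by auto
qed

section \<open>From square integrable convergence to integrals of positive parts\<close>

lemma (in finite_measure) integrable_of_square_integrable:
  fixes f :: "'a \<Rightarrow> real"
  assumes "f \<in> borel_measurable M" "integrable M (\<lambda>x. (f x)\<^sup>2)"
  shows "integrable M f"
proof (rule Bochner_Integration.integrable_bound)
  show "integrable M (\<lambda>x. 1 + (f x)\<^sup>2)" using assms by simp
  have "\<bar>r\<bar> \<le> 1 + r\<^sup>2" for r :: real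
  proof -
    have "2 * \<bar>r\<bar> \<le> 1 + r\<^sup>2" using sum_squares_bound[of 1 "\<bar>r\<bar>"] by simp
    then show ?thesis using abs_ge_zero[of r] by linarith
  qed
  then show "AE x in M. norm (f x) \<le> norm (1 + (f x)\<^sup>2)" by (auto simp: abs_of_nonneg)
qed fact

text \<open>Pointwise \<open>max r 0 \<le> s + \<bar>r - s\<bar>\<close> for
  \<open>s \<ge> 0\<close>, and \<open>\<bar>r - s\<bar> \<le> (c + (r - s)^2 / c) / 2\<close>.
  Integrating this weighted inequality of means plays the part of Cauchy-Schwarz; \<open>c\<close>
  is a positive majorant of the distance because it is divided by.\<close>

lemma (in finite_measure) integral_positive_part_L2:
  fixes f h :: "'a \<Rightarrow> real"
  assumes f: "f \<in> borel_measurable M" "integrable M (\<lambda>x. (f x)\<^sup>2)"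
    and h: "h \<in> borel_measurable M" "integrable M (\<lambda>x. (h x)\<^sup>2)" "AE x in M. 0 \<le> h x"
    and c: "c > 0" "sqrt (\<integral>x. (f x - h x)\<^sup>2 \<partial>M) \<le> c"
  shows "(\<integral>x. max (f x) 0 \<partial>M) \<le> (\<integral>x. h x \<partial>M) + c * (measure M (space M) + 1) / 2"
proof -
  have int: "integrable M f" "integrable M h"
    by (rule integrable_of_square_integrable[OF f] integrable_of_square_integrable[OF h(1,2)])+
  have d2: "integrable M (\<lambda>x. (f x - h x)\<^sup>2)"
  proof (rule Bochner_Integration.integrable_bound)
    show "integrable M (\<lambda>x. 2 * (f x)\<^sup>2 + 2 * (h x)\<^sup>2)" using f h by simp
    have "(r - s)\<^sup>2 \<le> 2 * r\<^sup>2 + 2 * s\<^sup>2" for r s :: real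
      using zero_le_power2[of "r + s"] by (simp add: power2_sum power2_diff)
    then show "AE x in M. norm ((f x - h x)\<^sup>2) \<le> norm (2 * (f x)\<^sup>2 + 2 * (h x)\<^sup>2)"
      by (auto simp: abs_of_nonneg)
  qed (use f h in simp)
  have pw: "max r 0 \<le> s + (c + (r - s)\<^sup>2 / c) / 2" if "0 \<le> s" for r s :: real
  proof -
    have "2 * (r - s) * c \<le> (r - s)\<^sup>2 + c\<^sup>2" using sum_squares_bound[of "r - s" c] by simp
    then have "2 * (r - s) \<le> c + (r - s)\<^sup>2 / c"
      using c(1) by (simp add: field_simps power2_eq_square)
    moreover have "0 \<le> c + (r - s)\<^sup>2 / c" using c(1) by (intro add_nonneg_nonneg divide_nonneg_pos) auto
    ultimately show ?thesis using that by (intro max.boundedI) argo+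
  qed
  have "(\<integral>x. max (f x) 0 \<partial>M) \<le> (\<integral>x. h x + (c + (f x - h x)\<^sup>2 / c) / 2 \<partial>M)"
  proof (rule integral_mono_AE)
    show "integrable M (\<lambda>x. max (f x) 0)" using int by (intro integrable_max) auto
    show "integrable M (\<lambda>x. h x + (c + (f x - h x)\<^sup>2 / c) / 2)" using int d2 by simp
    show "AE x in M. max (f x) 0 \<le> h x + (c + (f x - h x)\<^sup>2 / c) / 2"
      using h(3) by eventually_elim (rule pw)
  qed
  also have "\<dots> = (\<integral>x. h x \<partial>M) + (c * measure M (space M) + (\<integral>x. (f x - h x)\<^sup>2 \<partial>M) / c) / 2"
    using int d2 by (simp add: mult.commute)
  also have "(\<integral>x. (f x - h x)\<^sup>2 \<partial>M) / c \<le> c"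
  proof -
    have "(\<integral>x. (f x - h x)\<^sup>2 \<partial>M) = (sqrt (\<integral>x. (f x - h x)\<^sup>2 \<partial>M))\<^sup>2" by simp
    also have "\<dots> \<le> c\<^sup>2" using c by (intro power_mono) auto
    finally show ?thesis using c(1) by (simp add: divide_le_eq power2_eq_square)
  qed
  finally show ?thesis by (simp add: algebra_simps)
qed

lemma integral_lebesgue_on_support:
  fixes f :: "'a::euclidean_space \<Rightarrow> real"
  assumes "continuous_on UNIV f" "\<And>x. x \<notin> S \<Longrightarrow> f x = 0" "S \<in> sets lebesgue"
  shows "integral\<^sup>L (lebesgue_on S) f = integral\<^sup>L lborel f"
proof -
  have "integral\<^sup>L (lebesgue_on S) f = (\<integral>x. indicator S x *\<^sub>R f x \<partial>lebesgue)"
    using assms(3) by (subst integral_restrict_space) auto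
  also have "(\<lambda>x. indicator S x *\<^sub>R f x) = f"
    using assms(2) by (auto simp: fun_eq_iff indicator_def)
  also have "integral\<^sup>L lebesgue f = integral\<^sup>L lborel f"
    using borel_measurable_continuous_onI[OF assms(1)] by (intro integral_completion) simp
  finally show ?thesis .
qed

section \<open>The heat equation on the moving domain\<close>

text \<open>The derivatives of the pull-back are parameters, so that the derivatives of
  \<open>T\<close> on the moving domain can be defined by explicit formulas in \<open>G\<close>,
  \<open>H\<close> and \<open>D\<close>.\<close>

locale heat_moving_domain = C2_flow V V' \<phi>
  for V :: "real^'n \<Rightarrow> real^'n" and V' and \<phi> :: "real \<Rightarrow> real^'n \<Rightarrow> real^'n" +
  fixes \<Omega>0 :: "(real^'n) set" and a T :: "real^'n \<Rightarrow> real \<Rightarrow> real" and \<alpha> :: "real \<Rightarrow> real"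
    and G :: "real^'n \<Rightarrow> real \<Rightarrow> real^'n" and H :: "real^'n \<Rightarrow> real \<Rightarrow> real^'n^'n"
    and D :: "real^'n \<Rightarrow> real \<Rightarrow> real"
  assumes domain_bounded: "bounded \<Omega>0" and domain_open: "open \<Omega>0"
    and T_gradient: "\<And>x t. x \<in> closure \<Omega>0 \<Longrightarrow> t > 0 \<Longrightarrow>
      ((\<lambda>z. T (\<phi> t z) t) has_derivative (\<lambda>h. G x t \<bullet> h)) (at x within closure \<Omega>0)"
    and T_hessian: "\<And>x t. x \<in> closure \<Omega>0 \<Longrightarrow> t > 0 \<Longrightarrow>
      ((\<lambda>z. G z t) has_derivative (\<lambda>h. H x t *v h)) (at x within closure \<Omega>0)"
    and T_time: "\<And>x t. x \<in> closure \<Omega>0 \<Longrightarrow> t > 0 \<Longrightarrow> ((\<lambda>s. T (\<phi> s x) s) has_real_derivative D x t) (at t)"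
    and T_cont: "continuous_on (closure \<Omega>0 \<times> {0<..}) (\<lambda>(x, t). T (\<phi> t x) t)"
    and G_cont: "continuous_on (closure \<Omega>0 \<times> {0<..}) (\<lambda>(x, t). G x t)"
    and H_cont: "continuous_on (closure \<Omega>0 \<times> {0<..}) (\<lambda>(x, t). H x t)"
    and D_cont: "continuous_on (closure \<Omega>0 \<times> {0<..}) (\<lambda>(x, t). D x t)"
    and heat: "\<And>t y. t > 0 \<Longrightarrow> y \<in> \<phi> t ` \<Omega>0 \<Longrightarrow>
      deriv (\<lambda>s. T y s) t - laplacian (\<lambda>z. T z t) y + a y t * T y t = 0"
    and dirichlet: "\<And>t y. t > 0 \<Longrightarrow> y \<in> frontier (\<phi> t ` \<Omega>0) \<Longrightarrow> T y t = 0"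
    and \<alpha>_cont: "continuous_on {0..} \<alpha>"
    and \<alpha>_le: "\<And>t y. t \<ge> 0 \<Longrightarrow> y \<in> \<phi> t ` \<Omega>0 \<Longrightarrow> \<alpha> t \<le> a y t"
begin

lemma mem_flow_image: "y \<in> \<phi> t ` S \<longleftrightarrow> \<phi> (-t) y \<in> S"
  by (metis flow_minus image_iff)

lemma flow_cont_space: "continuous_on S (\<phi> t)"
  by (intro continuous_at_imp_continuous_on ballI has_derivative_continuous[OF flow_has_derivative])

lemma open_flow_image: "open S \<Longrightarrow> open (\<phi> t ` S)"
proof -
  assume "open S"
  moreover have "\<phi> t ` S = \<phi> (-t) -` S" using mem_flow_image by auto
  ultimately show ?thesis using open_vimage flow_cont_space by metis
qed

text \<open>By continuity \<open>\<phi> t x\<close> lies in the closure of the image domain, and by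
  injectivity not in the image itself, which is open; hence it lies on the frontier, where the
  boundary condition holds.\<close>

lemma pullback_boundary:
  assumes "t > 0" "x \<in> closure \<Omega>0" "x \<notin> \<Omega>0"
  shows "T (\<phi> t x) t = 0"
proof (rule dirichlet[OF assms(1)])
  have "\<phi> t ` closure \<Omega>0 \<subseteq> closure (\<phi> t ` \<Omega>0)"
    by (intro image_closure_subset flow_cont_space) (auto simp: closure_subset)
  moreover have "\<phi> t x \<notin> \<phi> t ` \<Omega>0" using assms(3) by (simp add: mem_flow_image)
  ultimately show "\<phi> t x \<in> frontier (\<phi> t ` \<Omega>0)"
    using assms(2) open_flow_image[OF domain_open] by (auto simp: frontier_def interior_open)
qed

section \<open>The weighted solution extended by zero, and its regularity\<close>

definition A :: "real \<Rightarrow> real" where "A t = integral {0..t} \<alpha>"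

lemma A_deriv: "t > 0 \<Longrightarrow> (A has_real_derivative \<alpha> t) (at t)"
proof -
  assume t: "t > 0"
  have "((\<lambda>x. integral {0..x} \<alpha>) has_real_derivative \<alpha> t) (at t within {0..t+1})"
    using t by (intro integral_has_real_derivative continuous_on_subset[OF \<alpha>_cont]) auto
  moreover have "at t within {0..t+1} = at t" using t by (intro at_within_interior) auto
  ultimately show ?thesis unfolding A_def[abs_def] by simp
qed

lemma A_cont: "continuous_on {0<..} A"
  using A_deriv DERIV_isCont by (auto intro!: continuous_at_imp_continuous_on)

lemma A_tendsto_0: "(A \<longlongrightarrow> 0) (at_right 0)"
proof -
  have "((\<lambda>x. integral {0..x} \<alpha>) has_real_derivative \<alpha> 0) (at 0 within {0..1})"
    by (intro integral_has_real_derivative continuous_on_subset[OF \<alpha>_cont]) auto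
  then have "continuous (at 0 within {0..1}) A" unfolding A_def[abs_def] by (rule DERIV_continuous)
  then have "(A \<longlongrightarrow> A 0) (at 0 within {0..1})" by (simp add: continuous_within)
  moreover have "at 0 within {0..1} = at_right (0::real)" by (rule at_within_Icc_at_right) simp
  ultimately show ?thesis by (simp add: A_def)
qed

text \<open>The weighted solution in the fixed frame. Continuity of the extension by zero is proved
  here, where the boundary does not move, and then carried over to \<open>u\<close> by the
  flow.\<close>

definition w :: "real \<Rightarrow> real^'n \<Rightarrow> real" where
  "w t x = (if x \<in> \<Omega>0 then exp (A t) * T (\<phi> t x) t else 0)"

definition u :: "real \<Rightarrow> real^'n \<Rightarrow> real" where
  "u t y = w t (\<phi> (-t) y)"

lemma u_in: "\<phi> (-t) y \<in> \<Omega>0 \<Longrightarrow> u t y = exp (A t) * T y t"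
  by (simp add: u_def w_def)

text \<open>Pasting over two relatively closed pieces, the closure of the domain and the complement
  of the domain, which overlap exactly on the boundary, where the pull-back of \<open>T\<close>
  vanishes.\<close>

lemma w_cont: "continuous_on ({0<..} \<times> UNIV) (\<lambda>(t, x). w t x)"
proof -
  let ?S = "{0<..} \<times> closure \<Omega>0" and ?C = "{0<..} \<times> (- \<Omega>0)"
  have U: "?S \<union> ?C = {0<..} \<times> UNIV" using closure_subset by blast
  have "continuous_on ?S (\<lambda>p. (\<lambda>(x, t). T (\<phi> t x) t) (snd p, fst p))"
    by (intro continuous_on_compose2[OF T_cont] continuous_intros) auto
  then have c: "continuous_on ?S (\<lambda>p. exp (A (fst p)) * T (\<phi> (fst p) (snd p)) (fst p))"
    by (intro continuous_intros continuous_on_compose2[OF A_cont]) auto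
  have "continuous_on (?S \<union> ?C) (\<lambda>p. if snd p \<in> \<Omega>0 then exp (A (fst p)) * T (\<phi> (fst p) (snd p)) (fst p) else 0)"
  proof (rule continuous_on_cases_local[OF _ _ c])
    show "closedin (top_of_set (?S \<union> ?C)) ?S"
      unfolding U closedin_closed by (intro exI[of _ "UNIV \<times> closure \<Omega>0"]) (auto intro!: closed_Times)
    show "closedin (top_of_set (?S \<union> ?C)) ?C"
      unfolding U closedin_closed by (intro exI[of _ "UNIV \<times> (- \<Omega>0)"]) (auto intro!: closed_Times domain_open)
    fix p :: "real \<times> (real^'n)" assume "p \<in> ?S \<and> snd p \<notin> \<Omega>0 \<or> p \<in> ?C \<and> snd p \<in> \<Omega>0"
    then show "exp (A (fst p)) * T (\<phi> (fst p) (snd p)) (fst p) = 0"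
      using pullback_boundary[of "fst p" "snd p"] by auto
  qed auto
  then show ?thesis unfolding U by (simp add: w_def split_beta)
qed

lemma u_cont: "continuous_on ({0<..} \<times> UNIV) (\<lambda>(t, y). u t y)"
proof -
  have "continuous_on ({0<..} \<times> UNIV) (\<lambda>p. (fst p, (\<lambda>(r, y). \<phi> (- r) y) p))"
    by (intro continuous_intros flow_backward_continuous)
  then have "continuous_on ({0<..} \<times> UNIV) (\<lambda>p. (\<lambda>(t, x). w t x) (fst p, (\<lambda>(r, y). \<phi> (- r) y) p))"
    by (rule continuous_on_compose2[OF w_cont]) auto
  then show ?thesis by (simp add: u_def split_beta)
qed

lemma u_cont_space: "t > 0 \<Longrightarrow> continuous_on UNIV (u t)"
proof -
  assume "t > 0"
  then have "continuous_on UNIV (\<lambda>y. (\<lambda>(t, y). u t y) (t, y))"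
    by (intro continuous_on_compose2[OF u_cont] continuous_intros) auto
  then show ?thesis by simp
qed

definition moving :: "(real \<times> (real^'n)) set" where
  "moving = {(t, y). t > 0 \<and> \<phi> (-t) y \<in> \<Omega>0}"

text \<open>Openness in space-time means that a fixed \<open>y\<close> inside the domain at time
  \<open>t\<close> stays inside for nearby times, so that time derivatives at fixed \<open>y\<close>
  can be computed there.\<close>

lemma open_moving: "open moving"
proof -
  have "moving = ({0<..} \<times> UNIV) \<inter> (\<lambda>(r, y). \<phi> (- r) y) -` \<Omega>0" by (auto simp: moving_def)
  moreover have "open ({0<..} \<times> UNIV :: (real \<times> (real^'n)) set)" by (intro open_Times) auto
  ultimately show ?thesis
    using open_vimage[OF domain_open flow_backward_continuous] by (simp only: open_Int)
qed

lemma at_within_closure_domain: "x \<in> \<Omega>0 \<Longrightarrow> at x within closure \<Omega>0 = at x"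
  using domain_open closure_subset by (intro at_within_open_subset[of _ \<Omega>0]) auto

lemma T_gradient_in: "x \<in> \<Omega>0 \<Longrightarrow> t > 0 \<Longrightarrow> ((\<lambda>z. T (\<phi> t z) t) has_derivative (\<lambda>h. G x t \<bullet> h)) (at x)"
  using T_gradient[of x t] at_within_closure_domain closure_subset by auto

lemma T_hessian_in: "x \<in> \<Omega>0 \<Longrightarrow> t > 0 \<Longrightarrow> ((\<lambda>z. G z t) has_derivative (\<lambda>h. H x t *v h)) (at x)"
  using T_hessian[of x t] at_within_closure_domain closure_subset by auto

text \<open>The time derivative of \<open>T\<close> at a fixed point \<open>y\<close>. The
  pulled-back point \<open>\<phi> (- t) y\<close> moves with velocity
  \<open>- V (\<phi> (- t) y)\<close>, which accounts for the second term.\<close>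

definition Tt :: "real \<Rightarrow> real^'n \<Rightarrow> real" where
  "Tt t y = D (\<phi> (-t) y) t - G (\<phi> (-t) y) t \<bullet> V (\<phi> (-t) y)"

text \<open>A partial derivative in \<open>x\<close> at the point, together with a jointly
  continuous partial derivative in \<open>t\<close>, gives the joint derivative; the chain rule
  along \<open>(\<phi> (- s) y, s)\<close> relies on it.\<close>

lemma pullback_has_derivative:
  assumes "x \<in> \<Omega>0" "t > 0"
  shows "((\<lambda>(x, t). T (\<phi> t x) t) has_derivative (\<lambda>(h, k). G x t \<bullet> h + D x t * k)) (at (x, t))"
proof -
  have "((\<lambda>(x, t). T (\<phi> t x) t) has_derivative (\<lambda>(h, k). G x t \<bullet> h + blinfun_mult_right (D x t) k)) (at (x, t) within \<Omega>0 \<times> {0<..})"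
  proof (rule has_derivative_partialsI)
    show "((\<lambda>x. T (\<phi> t x) t) has_derivative (\<lambda>h. G x t \<bullet> h)) (at x within \<Omega>0)"
      by (rule has_derivative_at_withinI[OF T_gradient_in[OF assms]])
    show "((\<lambda>s. T (\<phi> s z) s) has_derivative blinfun_apply (blinfun_mult_right (D z s))) (at s within {0<..})"
      if "z \<in> \<Omega>0" "s \<in> {0<..}" for z s
    proof -
      have "z \<in> closure \<Omega>0" "0 < s" using that closure_subset by auto
      from T_time[OF this] show ?thesis
        unfolding has_field_derivative_def blinfun_mult_right.rep_eq by (rule has_derivative_at_withinI)
    qed
    have "continuous_on (\<Omega>0 \<times> {0<..}) (\<lambda>(x, t). D x t)"
      by (rule continuous_on_subset[OF D_cont]) (use closure_subset in auto)
    then have "continuous_on (\<Omega>0 \<times> {0<..}) (\<lambda>p. blinfun_mult_right ((\<lambda>(x, t). D x t) p))"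
      by (rule bounded_linear.continuous_on[OF bounded_linear_blinfun_mult_right])
    also have "(\<lambda>p. blinfun_mult_right ((\<lambda>(x, t). D x t) p)) = (\<lambda>(x, y). blinfun_mult_right (D x y))"
      by auto
    finally show "continuous (at (x, t) within \<Omega>0 \<times> {0<..}) (\<lambda>(x, y). blinfun_mult_right (D x y))"
      using assms unfolding continuous_on_eq_continuous_within by blast
  qed (use assms in auto)
  moreover have "at (x, t) within \<Omega>0 \<times> {0<..} = at (x, t)"
    using assms domain_open by (intro at_within_open open_Times) auto
  ultimately show ?thesis by simp
qed

lemma T_time_deriv:
  assumes "(t, y) \<in> moving"
  shows "((\<lambda>s. T y s) has_real_derivative Tt t y) (at t)"
proof -
  let ?x = "\<phi> (-t) y"
  have x: "?x \<in> \<Omega>0" "t > 0" using assms by (auto simp: moving_def)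
  have "((\<lambda>s. (\<phi> (-s) y, s)) has_derivative (\<lambda>k. (k *\<^sub>R (- V ?x), k))) (at t)"
    using flow_backward_deriv[of y t] unfolding has_vector_derivative_def
    by (intro has_derivative_Pair has_derivative_ident)
  from has_derivative_compose[OF this pullback_has_derivative[OF x]]
  have "((\<lambda>s. T y s) has_derivative (\<lambda>k. G ?x t \<bullet> (k *\<^sub>R (- V ?x)) + D ?x t * k)) (at t)" by simp
  then show ?thesis unfolding has_field_derivative_def Tt_def
    by (rule has_derivative_eq_rhs) (auto simp: algebra_simps)
qed

lemma moving_cont:
  assumes "continuous_on (closure \<Omega>0 \<times> {0<..}) (\<lambda>(x, t). f x t)"
  shows "continuous_on moving (\<lambda>(t, y). f (\<phi> (-t) y) t)"
proof -
  have "continuous_on moving (\<lambda>p. ((\<lambda>(r, y). \<phi> (- r) y) p, fst p))"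
    by (intro continuous_intros flow_backward_continuous)
  from continuous_on_compose2[OF assms this] show ?thesis
    using closure_subset by (fastforce simp: moving_def split_beta)
qed

lemma Tt_cont: "continuous_on moving (\<lambda>(t, y). Tt t y)"
proof -
  have "continuous_on moving (\<lambda>p. V ((\<lambda>(r, y). \<phi> (- r) y) p))"
    by (rule continuous_on_compose2[OF V_cont[of UNIV] flow_backward_continuous]) auto
  then show ?thesis
    using moving_cont[OF D_cont] moving_cont[OF G_cont]
    by (auto simp: Tt_def split_beta intro!: continuous_intros)
qed

lemma T_moving_cont: "continuous_on moving (\<lambda>(t, y). T y t)"
  using moving_cont[OF T_cont] by simp

lemma T_space_deriv:
  assumes t: "t > 0"
  obtains T1 T2 :: "real^'n \<Rightarrow> real^'n \<Rightarrow> real" where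
    "\<And>i y. y \<in> \<phi> t ` \<Omega>0 \<Longrightarrow> ((\<lambda>r. T (y + r *\<^sub>R i) t) has_real_derivative T1 i y) (at 0)"
    "\<And>i y. y \<in> \<phi> t ` \<Omega>0 \<Longrightarrow> ((\<lambda>r. T1 i (y + r *\<^sub>R i)) has_real_derivative T2 i y) (at 0)"
    "\<And>i. continuous_on (\<phi> t ` \<Omega>0) (T1 i)" "\<And>i. continuous_on (\<phi> t ` \<Omega>0) (T2 i)"
proof -
  let ?\<psi> = "\<phi> (-t)"
  have "\<forall>i. \<exists>W. \<forall>x. ((\<lambda>x. tangent_flow (-t) x i) has_derivative W x) (at x) \<and> (\<forall>k. continuous_on UNIV (\<lambda>x. W x k))"
    using tangent_flow_C1 by blast
  then obtain W where "\<forall>i. \<forall>x. ((\<lambda>x. tangent_flow (-t) x i) has_derivative W i x) (at x) \<and> (\<forall>k. continuous_on UNIV (\<lambda>x. W i x k))"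
    using choice by metis
  then have W: "((\<lambda>x. tangent_flow (-t) x i) has_derivative W i x) (at x)" "continuous_on UNIV (\<lambda>x. W i x k)" for i x k
    by blast+
  define T1 where "T1 i y = G (?\<psi> y) t \<bullet> tangent_flow (-t) y i" for i y
  \<comment> \<open>Chain rule for the pull-back composed with \<open>\<phi> (- t)\<close>, twice in
    direction \<open>i\<close>: the first term carries the second derivative of the flow, the second
    the Hessian of the pull-back.\<close>
  define T2 where "T2 i y = G (?\<psi> y) t \<bullet> W i y i + (H (?\<psi> y) t *v tangent_flow (-t) y i) \<bullet> tangent_flow (-t) y i" for i y
  show thesis
  proof (rule that[of T1 T2])
    fix i y assume "y \<in> \<phi> t ` \<Omega>0"
    then have x: "?\<psi> y \<in> \<Omega>0" by (simp add: mem_flow_image)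
    have "((\<lambda>z. T (\<phi> t (?\<psi> z)) t) has_derivative (\<lambda>h. G (?\<psi> y) t \<bullet> tangent_flow (-t) y h)) (at y)"
      by (rule has_derivative_compose[OF flow_has_derivative T_gradient_in[OF x t]])
    from has_derivative_directional[OF this]
    show "((\<lambda>r. T (y + r *\<^sub>R i) t) has_real_derivative T1 i y) (at 0)" by (simp add: T1_def)
    have "((\<lambda>z. G (?\<psi> z) t) has_derivative (\<lambda>h. H (?\<psi> y) t *v tangent_flow (-t) y h)) (at y)"
      by (rule has_derivative_compose[OF flow_has_derivative T_hessian_in[OF x t]])
    from has_derivative_directional[OF has_derivative_inner[OF this W(1)]]
    show "((\<lambda>r. T1 i (y + r *\<^sub>R i)) has_real_derivative T2 i y) (at 0)" by (simp add: T1_def T2_def)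
  next
    fix i
    let ?S = "\<phi> t ` \<Omega>0"
    have sub: "(\<lambda>y. (t, y)) ` ?S \<subseteq> moving" using t by (auto simp: moving_def)
    have "continuous_on ?S (\<lambda>y. (\<lambda>(t, y). G (\<phi> (-t) y) t) (t, y))"
      by (rule continuous_on_compose2[OF moving_cont[OF G_cont] _ sub]) (intro continuous_intros)
    then have G: "continuous_on ?S (\<lambda>y. G (?\<psi> y) t)" by simp
    have "continuous_on ?S (\<lambda>y. (\<lambda>(t, y). H (\<phi> (-t) y) t) (t, y))"
      by (rule continuous_on_compose2[OF moving_cont[OF H_cont] _ sub]) (intro continuous_intros)
    then have H: "continuous_on ?S (\<lambda>y. H (?\<psi> y) t)" by simp
    show "continuous_on ?S (T1 i)" unfolding T1_def by (intro continuous_intros G tangent_flow_continuous)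
    have "continuous_on ?S (\<lambda>y. H (?\<psi> y) t *v tangent_flow (-t) y i)"
      unfolding matrix_vector_mult_def
      by (intro continuous_intros H tangent_flow_continuous)
    then show "continuous_on ?S (T2 i)"
      unfolding T2_def by (intro continuous_intros G tangent_flow_continuous continuous_on_subset[OF W(2)]) auto
  qed
qed

section \<open>Monotonicity of the cut-off integrals and the limit at the initial time\<close>

lemma moving_bounded: "\<exists>R. \<forall>r\<in>{0..t}. \<phi> r ` \<Omega>0 \<subseteq> cball 0 R"
proof -
  obtain R0 where "\<And>x. x \<in> \<Omega>0 \<Longrightarrow> norm x \<le> R0"
    using domain_bounded unfolding bounded_iff by blast
  then have R0: "\<Omega>0 \<subseteq> cball 0 R0" by (intro subsetI) (simp only: mem_cball_0)
  obtain R where R: "\<forall>s\<in>{0..t}. \<forall>x\<in>cball 0 R0. \<phi> s x \<in> cball 0 R"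
    using flow_cball_bounded[of t R0] ..
  show ?thesis
  proof (intro exI ballI image_subsetI)
    show "\<phi> r x \<in> cball 0 R" if "r \<in> {0..t}" "x \<in> \<Omega>0" for r x
      using R R0 that by blast
  qed
qed

text \<open>All domains up to time \<open>t\<close> lie in one fixed box, and \<open>g u\<close>
  vanishes near the moving boundary. The integral over that box can therefore be differentiated in
  time without a flux term from the motion of the domain.\<close>

lemma cutoff_integral_mono:
  fixes g g1 g2 :: "real \<Rightarrow> real"
  assumes e: "e > 0" and st: "0 < s" "s \<le> t"
    and g: "\<And>s. (g has_real_derivative g1 s) (at s)" "\<And>s. (g1 has_real_derivative g2 s) (at s)" "continuous_on UNIV g2"
    "\<And>s. s \<le> e \<Longrightarrow> g s = 0" "\<And>s. s \<le> e \<Longrightarrow> g1 s = 0" "\<And>s. s \<le> e \<Longrightarrow> g2 s = 0"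
    "\<And>s. 0 \<le> g1 s" "\<And>s. 0 \<le> g2 s"
  shows "(\<integral>y. g (u t y) \<partial>lborel) \<le> (\<integral>y. g (u s y) \<partial>lborel)"
proof -
  obtain R where R: "\<And>r. r\<in>{0..t} \<Longrightarrow> \<phi> r ` \<Omega>0 \<subseteq> cball 0 R" using moving_bounded by metis
  obtain c d :: "real^'n" where cd: "cball 0 R \<subseteq> cbox c d"
    using bounded_subset_cbox_symmetric[OF bounded_cball] by metis
  have g_cont: "continuous_on UNIV g" and g1_cont: "continuous_on UNIV g1"
    using g(1,2) DERIV_isCont by (blast intro: continuous_at_imp_continuous_on)+
  have gu_cont: "continuous_on UNIV (\<lambda>y. g (u r y))" if "r > 0" for r
    by (rule continuous_on_compose2[OF g_cont u_cont_space[OF that]]) auto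
  have gu_supp: "g (u r y) = 0" if "r \<in> {0..t}" "y \<notin> cball 0 R" for r y
    using R[OF that(1)] that(2) e g(4)[of 0] by (auto simp: u_def w_def mem_flow_image[symmetric])
  let ?B = "{p. p \<in> {0<..} \<times> UNIV \<and> (\<lambda>(t, y). u t y) p \<in> {..<e}}"
  have B: "open ?B"
    using continuous_open_preimage[OF u_cont _ open_lessThan[of e]] by (simp add: open_Times vimage_def Int_def)
  have cover: "moving \<union> ?B = {0<..} \<times> UNIV"
    using e by (auto simp: moving_def u_def w_def split: if_splits)
  \<comment> \<open>The time derivative of \<open>g u\<close> inside the moving domain: the factor
    in parentheses is \<open>u_t\<close>, with the \<alpha>-term coming from the derivative of
    \<open>exp A\<close>.\<close>
  define q where "q p = g1 (u (fst p) (snd p)) * (exp (A (fst p)) * (Tt (fst p) (snd p) + \<alpha> (fst p) * T (snd p) (fst p)))" for p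
  define gt where "gt p = (if p \<in> moving then q p else 0)" for p
  have mfst: "continuous_on moving (\<lambda>p. \<alpha> (fst p))" "continuous_on moving (\<lambda>p. A (fst p))"
    by (intro continuous_on_compose2[OF \<alpha>_cont] continuous_on_compose2[OF A_cont] continuous_intros; auto simp: moving_def)+
  have um: "continuous_on moving (\<lambda>p. g1 (u (fst p) (snd p)))"
    using continuous_on_compose2[OF g1_cont continuous_on_subset[OF u_cont, of moving]] by (auto simp: moving_def split_beta)
  have q_cont: "continuous_on moving q"
    unfolding q_def using Tt_cont T_moving_cont mfst um by (auto simp: split_beta intro!: continuous_intros)
  have "continuous_on (moving \<union> ?B) gt"
    unfolding gt_def by (rule continuous_on_extend_zero[OF open_moving B q_cont]) (auto simp: q_def g(5))
  then have gt_cont: "continuous_on ({0<..} \<times> UNIV) gt" by (simp only: cover)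
  have time_near: "\<forall>\<^sub>F r' in nhds r. (r', y) \<in> S" if "open S" "(r, y) \<in> S" for S :: "(real \<times> (real^'n)) set" and r y
  proof -
    have "((\<lambda>r'. (r', y)) \<longlongrightarrow> (r, y)) (nhds r)" by (intro tendsto_intros filterlim_ident)
    then show ?thesis using that by (rule topological_tendstoD)
  qed
  have time: "((\<lambda>r. g (u r y)) has_real_derivative gt (r, y)) (at r)" if r: "r > 0" for r y
  proof (cases "(r, y) \<in> moving")
    case True
    have "((\<lambda>r. exp (A r) * T y r) has_real_derivative exp (A r) * Tt r y + exp (A r) * \<alpha> r * T y r) (at r)"
      by (rule DERIV_mult'[OF DERIV_fun_exp[OF A_deriv[OF r]] T_time_deriv[OF True]])
    from DERIV_chain2[OF g(1) this]
    have "((\<lambda>r. g (exp (A r) * T y r)) has_real_derivative gt (r, y)) (at r)"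
      using True u_in[of r y] by (simp add: gt_def q_def algebra_simps moving_def)
    moreover have "\<forall>\<^sub>F r' in nhds r. g (u r' y) = g (exp (A r') * T y r')"
      using time_near[OF open_moving True] by eventually_elim (simp add: u_in moving_def)
    ultimately show ?thesis by (subst DERIV_cong_ev[OF refl _ refl])
  next
    case False
    then have "(r, y) \<in> ?B" using cover r by blast
    from time_near[OF B this] have "\<forall>\<^sub>F r' in nhds r. g (u r' y) = 0"
      by eventually_elim (simp add: g(4))
    then show ?thesis using False by (subst DERIV_cong_ev[OF refl _ refl]) (auto simp: gt_def)
  qed
  define J where "J r = integral (cbox c d) (\<lambda>y. g (u r y))" for r
  define J' where "J' r = integral (cbox c d) (\<lambda>y. gt (r, y))" for r
  have J: "(J has_real_derivative J' r) (at r)" if r: "r > 0" for r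
  proof -
    have "(J has_real_derivative J' r) (at r within {0<..})"
      unfolding J_def[abs_def] J'_def
    proof (rule leibniz_rule_field_derivative)
      show "((\<lambda>r. g (u r y)) has_real_derivative gt (r, y)) (at r within {0<..})" if "r \<in> {0<..}" for r y
        using time that by (auto intro: has_field_derivative_at_within)
      show "(\<lambda>y. g (u r y)) integrable_on cbox c d" if "r \<in> {0<..}" for r
        using that by (intro integrable_continuous continuous_on_subset[OF gu_cont]) auto
      show "continuous_on ({0<..} \<times> cbox c d) (\<lambda>(r, y). gt (r, y))"
        by (simp, rule continuous_on_subset[OF gt_cont]) auto
    qed (use r in auto)
    then show ?thesis using r by (simp add: at_within_open[of r "{0<..}"])
  qed
  have J'_nonpos: "J' r \<le> 0" if r: "0 < r" "r \<le> t" for r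
  proof -
    have r': "r \<in> {0..t}" using r by auto
    let ?\<Omega> = "\<phi> r ` \<Omega>0"
    obtain T1 T2 where T1: "\<And>i y. y \<in> ?\<Omega> \<Longrightarrow> ((\<lambda>s. T (y + s *\<^sub>R i) r) has_real_derivative T1 i y) (at 0)"
      and T2: "\<And>i y. y \<in> ?\<Omega> \<Longrightarrow> ((\<lambda>s. T1 i (y + s *\<^sub>R i)) has_real_derivative T2 i y) (at 0)"
      and T12_cont: "\<And>i. continuous_on ?\<Omega> (T1 i)" "\<And>i. continuous_on ?\<Omega> (T2 i)"
      using T_space_deriv[OF r(1)] by metis
    define F' where "F' i y = (if y \<in> ?\<Omega> then g2 (u r y) * (exp (A r) * T1 i y)\<^sup>2 + g1 (u r y) * (exp (A r) * T2 i y) else 0)" for i y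
    have F': "continuous_on UNIV (F' i)" "integral\<^sup>L lborel (F' i) = 0" "y \<notin> cball 0 R \<Longrightarrow> F' i y = 0" for i y
    proof -
      have 0: "u r y = 0" if "y \<notin> ?\<Omega>" for y using that by (simp add: u_def w_def mem_flow_image)
      have 1: "((\<lambda>s. u r (y + s *\<^sub>R i)) has_real_derivative exp (A r) * T1 i y) (at 0)" if y: "y \<in> ?\<Omega>" for y
      proof -
        have "\<forall>\<^sub>F s in nhds 0. u r (y + s *\<^sub>R i) = exp (A r) * T (y + s *\<^sub>R i) r"
          using eventually_line_in_open[OF open_flow_image[OF domain_open] y, of i]
          by eventually_elim (simp add: u_in mem_flow_image)
        then show ?thesis using DERIV_cmult[OF T1[OF y]] by (subst DERIV_cong_ev[OF refl _ refl])
      qed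
      note * = integral_cutoff_second_derivative[OF open_flow_image[OF domain_open] R[OF r'] e u_cont_space[OF r(1)] 0 1
          continuous_on_mult_left[OF T12_cont(1)] DERIV_cmult[OF T2] continuous_on_mult_left[OF T12_cont(2)] g(2,3,5,6)]
      show "continuous_on UNIV (F' i)" "integral\<^sup>L lborel (F' i) = 0" "y \<notin> cball 0 R \<Longrightarrow> F' i y = 0"
        unfolding F'_def using * by blast+
    qed
    have le: "gt (r, y) \<le> (\<Sum>i\<in>Basis. F' i y)" for y
    proof (cases "y \<in> ?\<Omega>")
      case False
      then show ?thesis using r by (simp add: gt_def F'_def moving_def mem_flow_image)
    next
      case True
      then have m: "(r, y) \<in> moving" using r by (simp add: moving_def mem_flow_image)
      have Tt: "Tt r y = (\<Sum>i\<in>Basis. T2 i y) - a y r * T y r"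
        using heat[OF r(1) True] DERIV_imp_deriv[OF T_time_deriv[OF m]]
          laplacian_eq[OF open_flow_image[OF domain_open] True T1 T2] by simp
      have "gt (r, y) = g1 (u r y) * (exp (A r) * (\<Sum>i\<in>Basis. T2 i y)) - g1 (u r y) * ((a y r - \<alpha> r) * (exp (A r) * T y r))"
        using m by (simp add: gt_def q_def Tt algebra_simps)
      \<comment> \<open>The dropped term is \<open>g1 u * (a - \<alpha>) * u\<close>. For
        \<open>u \<le> e\<close> the factor \<open>g1 u\<close> is 0; otherwise \<open>u > 0\<close>
        and all three factors are nonnegative.\<close>
      also have "\<dots> \<le> g1 (u r y) * (exp (A r) * (\<Sum>i\<in>Basis. T2 i y))"
      proof (cases "u r y \<le> e")
        case True
        then show ?thesis by (simp add: g(5))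
      next
        case False
        moreover have "exp (A r) * T y r = u r y" using u_in[of r y] m by (simp add: moving_def)
        ultimately show ?thesis
          using e \<alpha>_le[of r y] True r g(7) by (auto intro!: mult_nonneg_nonneg)
      qed
      also have "\<dots> = (\<Sum>i\<in>Basis. g1 (u r y) * (exp (A r) * T2 i y))"
        by (simp add: sum_distrib_left)
      \<comment> \<open>Convexity of \<open>g\<close>: the added terms
        \<open>g2 u * (exp A * T1)^2\<close> are nonnegative and complete each summand to an exact
        derivative.\<close>
      also have "\<dots> \<le> (\<Sum>i\<in>Basis. F' i y)"
        using True g(8) by (intro sum_mono) (simp add: F'_def)
      finally show ?thesis .
    qed
    have sumF_cont: "continuous_on UNIV (\<lambda>y. \<Sum>i\<in>Basis. F' i y)" by (intro continuous_intros F')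
    have "J' r \<le> integral (cbox c d) (\<lambda>y. \<Sum>i\<in>Basis. F' i y)"
      unfolding J'_def
    proof (rule integral_le[OF _ _ le])
      show "(\<lambda>y. gt (r, y)) integrable_on cbox c d"
        by (intro integrable_continuous continuous_on_compose2[OF gt_cont] continuous_intros) (use r in auto)
      show "(\<lambda>y. \<Sum>i\<in>Basis. F' i y) integrable_on cbox c d"
        by (intro integrable_continuous continuous_on_subset[OF sumF_cont]) auto
    qed
    also have "\<dots> = (\<integral>y. (\<Sum>i\<in>Basis. F' i y) \<partial>lborel)"
      by (rule integral_cbox_bounded_support[OF sumF_cont _ cd]) (intro sum.neutral ballI F')
    also have "\<dots> = (\<Sum>i\<in>Basis. integral\<^sup>L lborel (F' i))"
      by (intro Bochner_Integration.integral_sum integrable_continuous_bounded_support[where R = R] F')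
    also have "\<dots> = 0" by (simp add: F')
    finally show ?thesis .
  qed
  have "J t \<le> J s"
  proof (rule DERIV_nonpos_imp_nonincreasing[where f = J])
    show "\<exists>d. (J has_real_derivative d) (at r) \<and> d \<le> 0" if "s \<le> r" "r \<le> t" for r
      using J[of r] J'_nonpos[of r] st that by (intro exI[of _ "J' r"]) auto
  qed (use st in auto)
  moreover have "J r = (\<integral>y. g (u r y) \<partial>lborel)" if "0 < r" "r \<le> t" for r
    unfolding J_def using that by (intro integral_cbox_bounded_support[OF gu_cont gu_supp cd]) auto
  ultimately show ?thesis using st by simp
qed

lemma w_cont_space: "t > 0 \<Longrightarrow> continuous_on UNIV (w t)"
proof -
  assume "t > 0"
  then have "continuous_on UNIV (\<lambda>x. (\<lambda>(t, x). w t x) (t, x))"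
    by (intro continuous_on_compose2[OF w_cont] continuous_intros) auto
  then show ?thesis by simp
qed

text \<open>\<open>w s\<close> is merely continuous across the boundary, but \<open>g\<close>
  vanishes where \<open>w s < e\<close>. The composite is therefore \<open>C^1\<close> on the whole
  space, as \<open>flow_push_forward_integral\<close> requires.\<close>

lemma cutoff_pullback_C1:
  fixes g g1 :: "real \<Rightarrow> real"
  assumes e: "e > 0" and s: "s > 0"
    and g: "\<And>s. (g has_real_derivative g1 s) (at s)" "continuous_on UNIV g1"
    "\<And>s. s \<le> e \<Longrightarrow> g s = 0" "\<And>s. s \<le> e \<Longrightarrow> g1 s = 0"
  obtains f' where "\<And>x. ((\<lambda>x. g (w s x)) has_derivative f' x) (at x)" "\<And>h. continuous_on UNIV (\<lambda>x. f' x h)"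
proof -
  define f' where "f' x h = (if x \<in> \<Omega>0 then g1 (w s x) * (exp (A s) * (G x s \<bullet> h)) else 0)" for x h
  let ?B = "{x. w s x < e}"
  have B: "open ?B" using w_cont_space[OF s] by (intro open_Collect_less) auto
  have cover: "\<Omega>0 \<union> ?B = UNIV" using e by (auto simp: w_def)
  show thesis
  proof (rule that[of f'])
    fix h
    have "(\<lambda>x. (x, s)) ` \<Omega>0 \<subseteq> closure \<Omega>0 \<times> {0<..}" using s closure_subset by auto
    then have "continuous_on \<Omega>0 (\<lambda>x. (\<lambda>(x, t). G x t) (x, s))"
      by (intro continuous_on_compose2[OF G_cont] continuous_intros)
    then have G: "continuous_on \<Omega>0 (\<lambda>x. G x s)" by simp
    have "continuous_on \<Omega>0 (\<lambda>x. g1 (w s x))"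
      by (rule continuous_on_compose2[OF g(2) continuous_on_subset[OF w_cont_space[OF s]]]) auto
    then have "continuous_on (\<Omega>0 \<union> ?B) (\<lambda>x. f' x h)"
      unfolding f'_def by (intro continuous_on_extend_zero domain_open B continuous_intros G) (auto simp: g(4))
    then show "continuous_on UNIV (\<lambda>x. f' x h)" by (simp only: cover)
  next
    fix x
    show "((\<lambda>x. g (w s x)) has_derivative f' x) (at x)"
    proof (cases "x \<in> \<Omega>0")
      case True
      have "((\<lambda>x. exp (A s) * T (\<phi> s x) s) has_derivative (\<lambda>h. exp (A s) * (G x s \<bullet> h))) (at x)"
        by (intro has_derivative_mult_right T_gradient_in True s)
      from has_derivative_compose[OF this g(1)[unfolded has_field_derivative_def]]
      have "((\<lambda>x. g (exp (A s) * T (\<phi> s x) s)) has_derivative f' x) (at x)"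
        using True by (simp add: f'_def[abs_def] w_def)
      then show ?thesis
        by (rule has_derivative_transform_within_open[OF _ domain_open True]) (simp add: w_def)
    next
      case False
      then have x: "x \<in> ?B" using cover by auto
      have "f' x = (\<lambda>h. 0)" using False by (simp add: f'_def[abs_def])
      then have "((\<lambda>x. 0) has_derivative f' x) (at x)" by simp
      then show ?thesis
        by (rule has_derivative_transform_within_open[OF _ B x]) (simp add: g(3))
    qed
  qed
qed

lemma cutoff_integral_initial:
  fixes g g1 g2 :: "real \<Rightarrow> real"
  assumes e: "e > 0" and t: "t > 0"
    and g: "\<And>s. (g has_real_derivative g1 s) (at s)" "\<And>s. (g1 has_real_derivative g2 s) (at s)" "continuous_on UNIV g2"
    "\<And>s. s \<le> e \<Longrightarrow> g s = 0" "\<And>s. s \<le> e \<Longrightarrow> g1 s = 0" "\<And>s. s \<le> e \<Longrightarrow> g2 s = 0"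
    "\<And>s. 0 \<le> g s" "\<And>s. 0 \<le> g1 s" "\<And>s. 0 \<le> g2 s" "\<And>s. g s \<le> max s 0"
    and T0: "in_L2 \<Omega>0 T0" "AE x in lebesgue_on \<Omega>0. 0 \<le> T0 x"
    and lim: "((\<lambda>t. L2_norm_on \<Omega>0 (\<lambda>x. T (\<phi> t x) t - T0 x)) \<longlongrightarrow> 0) (at_right 0)"
  shows "(\<integral>y. g (u t y) \<partial>lborel) \<le> (\<integral>x. T0 x \<partial>lebesgue_on \<Omega>0)"
proof -
  have \<Omega>: "\<Omega>0 \<in> lmeasurable" using domain_bounded domain_open by (rule lmeasurable_open)
  interpret M: finite_measure "lebesgue_on \<Omega>0" by (rule finite_measure_lebesgue_on[OF \<Omega>])
  define N where "N s = L2_norm_on \<Omega>0 (\<lambda>x. T (\<phi> s x) s - T0 x)" for s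
  define m where "m = measure (lebesgue_on \<Omega>0) (space (lebesgue_on \<Omega>0))"
  let ?I0 = "\<integral>x. T0 x \<partial>lebesgue_on \<Omega>0"
  obtain R0 where "\<And>x. x \<in> \<Omega>0 \<Longrightarrow> norm x \<le> R0"
    using domain_bounded unfolding bounded_iff by blast
  then have R0: "\<Omega>0 \<subseteq> cball 0 R0" by (intro subsetI) (simp only: mem_cball_0)
  obtain B where B: "\<And>(f :: real^'n \<Rightarrow> real) f' s. \<lbrakk>\<And>x. (f has_derivative f' x) (at x); \<And>h. continuous_on UNIV (\<lambda>x. f' x h);
     \<And>x. 0 \<le> f x; \<And>x. x \<notin> cball 0 R0 \<Longrightarrow> f x = 0; s \<in> {0..1}\<rbrakk> \<Longrightarrow>
     (\<integral>y. f (\<phi> (- s) y) \<partial>lborel) \<le> exp (B * s) * integral\<^sup>L lborel f"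
    using flow_push_forward_integral[of R0] by blast
  have g_cont: "continuous_on UNIV g" and g1_cont: "continuous_on UNIV g1"
    using g(1,2) DERIV_isCont by (blast intro: continuous_at_imp_continuous_on)+
  \<comment> \<open>\<open>exp (B * s)\<close> is the volume distortion, \<open>exp (A s)\<close>
    the weight, and \<open>N s + s\<close> a majorant of the distance to \<open>T0\<close> that
    stays positive when \<open>N s = 0\<close>. The restriction \<open>s < 1\<close> is the range of
    the push-forward bound, \<open>s < t\<close> that of monotonicity.\<close>
  have bound: "(\<integral>y. g (u t y) \<partial>lborel) \<le> exp (B * s) * (exp (A s) * (?I0 + (N s + s) * (m + 1) / 2))"
    if s: "0 < s" "s < min 1 t" for s
  proof -
    have s1: "s \<in> {0..1}" using s by auto
    let ?f = "\<lambda>x. g (w s x)"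
    have f_cont: "continuous_on UNIV ?f" by (rule continuous_on_compose2[OF g_cont w_cont_space[OF s(1)]]) auto
    have f_supp: "?f x = 0" if "x \<notin> \<Omega>0" for x using that e g(4)[of 0] by (simp add: w_def)
    obtain f' where f': "\<And>x. (?f has_derivative f' x) (at x)" "\<And>h. continuous_on UNIV (\<lambda>x. f' x h)"
      using cutoff_pullback_C1[OF e s(1) g(1) g1_cont g(4,5)] by metis
    have f_le: "integral\<^sup>L (lebesgue_on \<Omega>0) ?f \<le> (\<integral>x. exp (A s) * max (T (\<phi> s x) s) 0 \<partial>lebesgue_on \<Omega>0)"
      and T_le: "(\<integral>x. max (T (\<phi> s x) s) 0 \<partial>lebesgue_on \<Omega>0) \<le> ?I0 + (N s + s) * (m + 1) / 2"
    proof -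
      have "(\<lambda>x. (x, s)) ` closure \<Omega>0 \<subseteq> closure \<Omega>0 \<times> {0<..}" using s by auto
      then have "continuous_on (closure \<Omega>0) (\<lambda>x. (\<lambda>(x, t). T (\<phi> t x) t) (x, s))"
        by (intro continuous_on_compose2[OF T_cont] continuous_intros)
      then have Tc: "continuous_on (closure \<Omega>0) (\<lambda>x. T (\<phi> s x) s)" by simp
      have "compact (closure \<Omega>0)" using domain_bounded by (simp add: compact_closure)
      then obtain C where C: "\<And>x. x \<in> closure \<Omega>0 \<Longrightarrow> norm (T (\<phi> s x) s) \<le> C"
        using compact_continuous_norm_bound[OF _ Tc] by metis
      have Tm: "(\<lambda>x. T (\<phi> s x) s) \<in> borel_measurable (lebesgue_on \<Omega>0)"
        using \<Omega> by (intro continuous_imp_measurable_on_sets_lebesgue continuous_on_subset[OF Tc] closure_subset) auto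
      have Ti: "integrable (lebesgue_on \<Omega>0) (\<lambda>x. (T (\<phi> s x) s)\<^sup>2)"
      proof (rule M.integrable_const_bound[where B = "C\<^sup>2"])
        show "AE x in lebesgue_on \<Omega>0. norm ((T (\<phi> s x) s)\<^sup>2) \<le> C\<^sup>2"
        proof (rule AE_I2)
          fix x assume "x \<in> space (lebesgue_on \<Omega>0)"
          then have "x \<in> closure \<Omega>0" using closure_subset by auto
          from power_mono[OF C[OF this], of 2] show "norm ((T (\<phi> s x) s)\<^sup>2) \<le> C\<^sup>2" by simp
        qed
      qed (use Tm in simp)
      have N0: "N s \<ge> 0" by (auto simp: N_def L2_norm_on_def intro!: Bochner_Integration.integral_nonneg)
      show "(\<integral>x. max (T (\<phi> s x) s) 0 \<partial>lebesgue_on \<Omega>0) \<le> ?I0 + (N s + s) * (m + 1) / 2"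
        unfolding m_def
      proof (rule M.integral_positive_part_L2[OF Tm Ti])
        show "0 < N s + s" using N0 s by simp
        have "sqrt (\<integral>x. (T (\<phi> s x) s - T0 x)\<^sup>2 \<partial>lebesgue_on \<Omega>0) = N s"
          by (simp add: N_def L2_norm_on_def)
        then show "sqrt (\<integral>x. (T (\<phi> s x) s - T0 x)\<^sup>2 \<partial>lebesgue_on \<Omega>0) \<le> N s + s" using s by simp
      qed (use T0 in \<open>auto simp: in_L2_def\<close>)
      have Tint: "integrable (lebesgue_on \<Omega>0) (\<lambda>x. exp (A s) * max (T (\<phi> s x) s) 0)"
        using M.integrable_of_square_integrable[OF Tm Ti] by (intro integrable_mult_right integrable_max) auto
      show "integral\<^sup>L (lebesgue_on \<Omega>0) ?f \<le> (\<integral>x. exp (A s) * max (T (\<phi> s x) s) 0 \<partial>lebesgue_on \<Omega>0)"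
      proof (rule integral_mono'[OF Tint])
        fix x assume "x \<in> space (lebesgue_on \<Omega>0)"
        then have "?f x \<le> max (exp (A s) * T (\<phi> s x) s) 0" using g(10)[of "w s x"] by (simp add: w_def)
        also have "\<dots> = exp (A s) * max (T (\<phi> s x) s) 0" by (simp add: max_mult_distrib_left)
        finally show "?f x \<le> exp (A s) * max (T (\<phi> s x) s) 0" .
      qed simp
    qed
    have "(\<integral>y. g (u t y) \<partial>lborel) \<le> (\<integral>y. g (u s y) \<partial>lborel)"
      using s by (intro cutoff_integral_mono[OF e _ _ g(1-6,8,9)]) auto
    also have "\<dots> = (\<integral>y. ?f (\<phi> (- s) y) \<partial>lborel)" by (simp add: u_def)
    also have "\<dots> \<le> exp (B * s) * integral\<^sup>L lborel ?f"
      by (rule B[OF f' g(7) _ s1]) (use f_supp R0 in blast)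
    also have "integral\<^sup>L lborel ?f = integral\<^sup>L (lebesgue_on \<Omega>0) ?f"
      using \<Omega> by (intro integral_lebesgue_on_support[symmetric] f_cont f_supp) auto
    also have "exp (B * s) * integral\<^sup>L (lebesgue_on \<Omega>0) ?f \<le>
        exp (B * s) * (exp (A s) * (\<integral>x. max (T (\<phi> s x) s) 0 \<partial>lebesgue_on \<Omega>0))"
      using f_le by simp
    also have "\<dots> \<le> exp (B * s) * (exp (A s) * (?I0 + (N s + s) * (m + 1) / 2))"
      using T_le by simp
    finally show ?thesis .
  qed
  have "((\<lambda>s. exp (B * s) * (exp (A s) * (?I0 + (N s + s) * (m + 1) / 2))) \<longlongrightarrow>
      exp (B * 0) * (exp 0 * (?I0 + (0 + 0) * (m + 1) / 2))) (at_right 0)"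
    by (intro tendsto_intros A_tendsto_0 lim[folded N_def]) simp
  moreover have "\<forall>\<^sub>F s in at_right 0. (\<integral>y. g (u t y) \<partial>lborel) \<le> exp (B * s) * (exp (A s) * (?I0 + (N s + s) * (m + 1) / 2))"
    using eventually_at_right_real[of 0 "min 1 t"] t by (auto elim!: eventually_mono intro!: bound)
  ultimately show ?thesis
    using tendsto_lowerbound[OF _ _ trivial_limit_at_right_real] by force
qed

text \<open>Removal of the cut-off: on the domain \<open>u\<close> exceeds \<open>g u\<close> by at
  most three times the threshold, and the domain has finite volume, so the threshold can be sent to
  0.\<close>

lemma weighted_integral_bound:
  assumes t: "t > 0"
    and T0: "in_L2 \<Omega>0 T0" "AE x in lebesgue_on \<Omega>0. 0 \<le> T0 x"
    and lim: "((\<lambda>t. L2_norm_on \<Omega>0 (\<lambda>x. T (\<phi> t x) t - T0 x)) \<longlongrightarrow> 0) (at_right 0)"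
  shows "(\<integral>y. T y t \<partial>lebesgue_on (\<phi> t ` \<Omega>0)) \<le> exp (- A t) * (\<integral>x. T0 x \<partial>lebesgue_on \<Omega>0)"
proof -
  let ?\<Omega> = "\<phi> t ` \<Omega>0" and ?I0 = "\<integral>x. T0 x \<partial>lebesgue_on \<Omega>0"
  obtain R where "\<forall>r\<in>{0..t}. \<phi> r ` \<Omega>0 \<subseteq> cball 0 R" using moving_bounded ..
  then have R: "?\<Omega> \<subseteq> cball 0 R" using t by auto
  have op: "open ?\<Omega>" by (rule open_flow_image[OF domain_open])
  then have \<Omega>: "?\<Omega> \<in> lmeasurable" using R bounded_subset[OF bounded_cball] by (intro lmeasurable_open) auto
  have u_supp: "u t y = 0" if "y \<notin> ?\<Omega>" for y using that by (simp add: u_def w_def mem_flow_image)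
  have u_int: "integrable lborel (u t)"
    using R u_supp by (intro integrable_continuous_bounded_support[OF u_cont_space[OF t], of R]) blast
  have "integral\<^sup>L lborel (u t) \<le> ?I0 + e" if "e > 0" for e
  proof -
    \<comment> \<open>Makes the total error \<open>3 * k\<close> times the volume at most
      \<open>e\<close>; the added 1 keeps the denominator positive when the volume is 0.\<close>
    define k where "k = e / (3 * (measure lborel ?\<Omega> + 1))"
    have k: "k > 0" "3 * k * measure lborel ?\<Omega> \<le> e"
      using \<open>e > 0\<close> by (auto simp: k_def divide_simps add_nonneg_pos mult_left_mono)
    obtain g g1 g2 where g: "\<And>s. (g has_real_derivative g1 s) (at s)" "\<And>s. (g1 has_real_derivative g2 s) (at s)" "continuous_on UNIV g2"
      "\<And>s. s \<le> k \<Longrightarrow> g s = 0" "\<And>s. s \<le> k \<Longrightarrow> g1 s = 0" "\<And>s. s \<le> k \<Longrightarrow> g2 s = 0"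
      "\<And>s. 0 \<le> g s" "\<And>s. 0 \<le> g1 s" "\<And>s. 0 \<le> g2 s" "\<And>s. g s \<le> max s 0" "\<And>s. s \<le> g s + 3 * k"
      by (rule smooth_positive_part[OF k(1)], rule that)
    have g_cont: "continuous_on UNIV g"
      using g(1) DERIV_isCont by (blast intro: continuous_at_imp_continuous_on)
    have gu_int: "integrable lborel (\<lambda>y. g (u t y))"
    proof (rule integrable_continuous_bounded_support)
      show "continuous_on UNIV (\<lambda>y. g (u t y))" by (rule continuous_on_compose2[OF g_cont u_cont_space[OF t]]) auto
      show "g (u t y) = 0" if "y \<notin> cball 0 R" for y
      proof -
        have "y \<notin> ?\<Omega>" using R that by blast
        then show ?thesis using u_supp k(1) by (simp add: g(4))
      qed
    qed
    have fin: "emeasure lborel ?\<Omega> < \<infinity>"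
      using emeasure_bounded_finite[OF bounded_subset[OF bounded_cball R]] .
    have ind: "integrable lborel (\<lambda>y. 3 * k * indicator ?\<Omega> y)"
      using op fin by (intro integrable_mult_right integrable_real_indicator) auto
    have "integral\<^sup>L lborel (u t) \<le> (\<integral>y. g (u t y) + 3 * k * indicator ?\<Omega> y \<partial>lborel)"
    proof (rule integral_mono[OF u_int Bochner_Integration.integrable_add[OF gu_int ind]])
      show "u t y \<le> g (u t y) + 3 * k * indicator ?\<Omega> y" for y
        using g(11)[of "u t y"] g(7)[of "u t y"] u_supp[of y] by (cases "y \<in> ?\<Omega>") auto
    qed
    also have "\<dots> = (\<integral>y. g (u t y) \<partial>lborel) + 3 * k * measure lborel ?\<Omega>"
      using gu_int ind op by (subst Bochner_Integration.integral_add) auto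
    also have "\<dots> \<le> ?I0 + e"
      using cutoff_integral_initial[OF k(1) t g(1-10) T0 lim] k(2) by linarith
    finally show ?thesis .
  qed
  then have bound: "integral\<^sup>L lborel (u t) \<le> ?I0" by (rule field_le_epsilon)
  have "(\<integral>y. T y t \<partial>lebesgue_on ?\<Omega>) = (\<integral>y. exp (- A t) * u t y \<partial>lebesgue_on ?\<Omega>)"
    by (rule Bochner_Integration.integral_cong[OF refl])
      (simp add: u_in mem_flow_image exp_minus)
  also have "\<dots> = exp (- A t) * integral\<^sup>L lborel (u t)"
    using integral_lebesgue_on_support[OF u_cont_space[OF t] u_supp] \<Omega> by auto
  also have "\<dots> \<le> exp (- A t) * ?I0" using bound by simp
  finally show ?thesis .
qed

end

section \<open>Decay of the exponential factor, and the conclusion\<close>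

lemma exp_integral_tendsto_0:
  fixes \<alpha> :: "real \<Rightarrow> real"
  assumes "Liminf at_top (\<lambda>t. ereal (1 / t * integral {0..t} \<alpha>)) > ereal \<alpha>0" "\<alpha>0 > 0"
  shows "((\<lambda>t. exp (- integral {0..t} \<alpha>)) \<longlongrightarrow> 0) at_top"
proof (rule tendsto_sandwich[OF _ _ tendsto_const])
  \<comment> \<open>A strict lower bound on the \<open>Liminf\<close> holds eventually for the
    averages themselves, so the integral of \<alpha> eventually exceeds
    \<open>\<alpha>0 * t\<close>.\<close>
  have "\<forall>\<^sub>F t in at_top. ereal \<alpha>0 < ereal (1 / t * integral {0..t} \<alpha>)"
    using less_LiminfD[OF assms(1)] .
  then show "\<forall>\<^sub>F t in at_top. exp (- integral {0..t} \<alpha>) \<le> exp (- (\<alpha>0 * t))"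
    using eventually_gt_at_top[of 0]
    by eventually_elim (simp add: field_simps)
  have "filterlim (\<lambda>t. \<alpha>0 * t) at_top at_top"
    by (rule filterlim_tendsto_pos_mult_at_top[OF tendsto_const assms(2) filterlim_ident])
  then show "((\<lambda>t. exp (- (\<alpha>0 * t))) \<longlongrightarrow> 0) at_top"
    by (intro filterlim_compose[OF exp_at_bot] filterlim_uminus_at_bot[THEN iffD2]) simp
qed simp

theorem proposition9p1:
  fixes \<Omega>0 :: "(real^'n) set"
    and V :: "real^'n \<Rightarrow> real^'n"
    and \<phi> :: "real \<Rightarrow> real^'n \<Rightarrow> real^'n"
    and a T :: "real^'n \<Rightarrow> real \<Rightarrow> real"
    and T0 :: "real^'n \<Rightarrow> real"
    and \<alpha> :: "real \<Rightarrow> real"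
    and \<alpha>0 :: real
  assumes "bounded \<Omega>0" and "smooth_open_set \<Omega>0"
    and "smooth_on UNIV V" and "is_flow V \<phi>"
    and "continuous_on {(y, t). t \<ge> 0 \<and> y \<in> closure (\<phi> t ` \<Omega>0)} (\<lambda>(y, t). a y t)"
    and "in_L2 \<Omega>0 T0" and "AE x in lebesgue_on \<Omega>0. T0 x \<ge> 0"
    and "is_solution \<Omega>0 \<phi> a T0 T"
    and "smooth_on {0..} \<alpha>"
    and "\<forall>t\<ge>0. \<forall>y\<in>\<phi> t ` \<Omega>0. \<alpha> t \<le> a y t"
    and "Liminf at_top (\<lambda>t. ereal (1 / t * integral {0..t} \<alpha>)) > ereal \<alpha>0" and "\<alpha>0 > 0"
  shows "(\<forall>t\<ge>0. (\<integral>y. T y t \<partial>(lebesgue_on (\<phi> t ` \<Omega>0)))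
             \<le> exp (- integral {0..t} \<alpha>) * (\<integral>x. T0 x \<partial>(lebesgue_on \<Omega>0))) \<and>
         ((\<lambda>t. exp (- integral {0..t} \<alpha>) * (\<integral>x. T0 x \<partial>(lebesgue_on \<Omega>0))) \<longlongrightarrow> 0) at_top"
proof -
  obtain V' where "C2_flow V V' \<phi>" using smooth_field_C2_flow assms(3,4) by blast
  then interpret C2_flow V V' \<phi> .
  have sol: "C21_on (closure \<Omega>0) (\<lambda>x t. T (\<phi> t x) t)"
    "\<And>t y. t > 0 \<Longrightarrow> y \<in> \<phi> t ` \<Omega>0 \<Longrightarrow> deriv (\<lambda>s. T y s) t - laplacian (\<lambda>z. T z t) y + a y t * T y t = 0"
    "\<And>t y. t > 0 \<Longrightarrow> y \<in> frontier (\<phi> t ` \<Omega>0) \<Longrightarrow> T y t = 0"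
    "AE y in lebesgue_on \<Omega>0. T y 0 = T0 y"
    "((\<lambda>t. L2_norm_on \<Omega>0 (\<lambda>x. T (\<phi> t x) t - T0 x)) \<longlongrightarrow> 0) (at_right 0)"
    using assms(8) unfolding is_solution_def by blast+
  obtain G H D where GHD: "\<forall>x\<in>closure \<Omega>0. \<forall>t>0.
         ((\<lambda>z. T (\<phi> t z) t) has_derivative (\<lambda>h. G x t \<bullet> h)) (at x within closure \<Omega>0) \<and>
         ((\<lambda>z. G z t) has_derivative (\<lambda>h. H x t *v h)) (at x within closure \<Omega>0) \<and>
         ((\<lambda>s. T (\<phi> s x) s) has_real_derivative D x t) (at t)"
      "continuous_on (closure \<Omega>0 \<times> {0<..}) (\<lambda>(x, t). T (\<phi> t x) t)"
      "continuous_on (closure \<Omega>0 \<times> {0<..}) (\<lambda>(x, t). G x t)"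
      "continuous_on (closure \<Omega>0 \<times> {0<..}) (\<lambda>(x, t). H x t)"
      "continuous_on (closure \<Omega>0 \<times> {0<..}) (\<lambda>(x, t). D x t)"
    using sol(1) unfolding C21_on_def by blast
  have \<alpha>: "continuous_on {0..} \<alpha>"
    using assms(9) unfolding smooth_on_def by (metis Ck_on.simps(1))
  have op: "open \<Omega>0" using assms(2) by (simp add: smooth_open_set_def)
  interpret heat_moving_domain V V' \<phi> \<Omega>0 a T \<alpha> G H D
    by unfold_locales (use assms(1,10) op GHD sol(2,3) \<alpha> in blast)+
  have "(\<integral>y. T y t \<partial>(lebesgue_on (\<phi> t ` \<Omega>0))) \<le> exp (- integral {0..t} \<alpha>) * (\<integral>x. T0 x \<partial>(lebesgue_on \<Omega>0))"
    if "t \<ge> 0" for t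
  proof (cases "t = 0")
    case False
    then show ?thesis using weighted_integral_bound[OF _ assms(6,7) sol(5), of t] that by (simp add: A_def)
  next
    case True
    have "(\<integral>y. T y 0 \<partial>lebesgue_on \<Omega>0) \<le> (\<integral>x. T0 x \<partial>lebesgue_on \<Omega>0)"
    \<comment> \<open>At \<open>t = 0\<close> the values of \<open>T\<close> are prescribed only
      almost everywhere. In the non-integrable case the integral on the left has its default value
      0, and nonnegativity of \<open>T0\<close> gives the inequality.\<close>
    proof (cases "integrable (lebesgue_on \<Omega>0) (\<lambda>y. T y 0)")
      case True
      then have "(\<integral>y. T y 0 \<partial>lebesgue_on \<Omega>0) = (\<integral>x. T0 x \<partial>lebesgue_on \<Omega>0)"
        using assms(6) sol(4) by (intro integral_cong_AE) (auto simp: in_L2_def)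
      then show ?thesis by simp
    next
      case False
      then show ?thesis
        using integral_nonneg_AE[OF assms(7)] by (simp add: not_integrable_integral_eq)
    qed
    then show ?thesis using True by simp
  qed
  moreover have "((\<lambda>t. exp (- integral {0..t} \<alpha>) * (\<integral>x. T0 x \<partial>(lebesgue_on \<Omega>0))) \<longlongrightarrow> 0) at_top"
    using tendsto_mult_left_zero[OF exp_integral_tendsto_0[OF assms(11,12)]] .
  ultimately show ?thesis by blast
qed

end
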